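(* Every quasirandom-forcing set of $4$-point permutations has cardinality at least five.
   Context: A $k$-point permutation is a bijection $\pi:[k]\to[k]$, $[k]=\{1,\dots,k\}$. For a $k$-point permutation $\sigma$ and an $n$-point permutation $\pi$ with $n\ge k$, the (pattern) density $d(\sigma,\pi)$ is the probability that, for a uniformly random $k$-element subset $A=\{a_1<\dots<a_k\}\subseteq[n]$, the permutation induced by $A$ is $\sigma$, i.e. $\sigma(i)<\sigma(j)\iff\pi(a_i)<\pi(a_j)$ for all $i,j\in[k]$. A sequence $(\pi_n)_{n\in\mathbb N}$ of permutations whose sizes tend to infinity is quasirandom if $d(\sigma,\pi_n)\to 1/|\sigma|!$ for every permutation $\sigma$. A set $S$ of permutations is quasirandom-forcing if every sequence $(\pi_n)$ of permutations with sizes tending to infinity such that $d(\sigma,\pi_n)\to1/|\sigma|!$ for every $\sigma\in S$ is quasirandom. *)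

theory Defs
  imports Complex_Main "HOL-Combinatorics.Permutations"
begin

text \<open>
  A permutation is a pair of its size \<open>k\<close> and a function permuting \<open>{1..k}\<close>. The size is stored
  explicitly since a function that permutes \<open>{1..k}\<close> also permutes \<open>{1..n}\<close> for every \<open>n \<ge> k\<close>.
  As \<open>permutes\<close> forces the identity outside \<open>{1..k}\<close>, distinct pairs are distinct permutations.
\<close>

type_synonym sized_perm = "nat \<times> (nat \<Rightarrow> nat)"

abbreviation psize :: "sized_perm \<Rightarrow> nat" where
  "psize \<equiv> fst"

abbreviation papply :: "sized_perm \<Rightarrow> nat \<Rightarrow> nat" where
  "papply \<equiv> snd"

definition point_perms :: "nat \<Rightarrow> sized_perm set" where
  "point_perms k = {\<sigma>. psize \<sigma> = k \<and> papply \<sigma> permutes {1..k}}"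

definition all_perms :: "sized_perm set" where
  "all_perms = (\<Union>k. point_perms k)"

text \<open>List positions start at 0, so the \<open>i\<close>-th smallest element of \<open>A\<close> is at position \<open>i - 1\<close>.\<close>

definition elem_at :: "nat set \<Rightarrow> nat \<Rightarrow> nat" where
  "elem_at A i = sorted_list_of_set A ! (i - 1)"

definition induces :: "sized_perm \<Rightarrow> nat set \<Rightarrow> sized_perm \<Rightarrow> bool" where
  "induces \<pi> A \<sigma> \<longleftrightarrow>
     (\<forall>i\<in>{1..psize \<sigma>}. \<forall>j\<in>{1..psize \<sigma>}.
        papply \<sigma> i < papply \<sigma> j \<longleftrightarrow> papply \<pi> (elem_at A i) < papply \<pi> (elem_at A j))"

text \<open>Meaningful for \<open>psize \<sigma> \<le> psize \<pi>\<close>; otherwise the value is \<open>0 / 0 = 0\<close>.\<close>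

definition pattern_density :: "sized_perm \<Rightarrow> sized_perm \<Rightarrow> real" where
  "pattern_density \<sigma> \<pi> =
     real (card {A. A \<subseteq> {1..psize \<pi>} \<and> card A = psize \<sigma> \<and> induces \<pi> A \<sigma>}) /
     real (card {A. A \<subseteq> {1..psize \<pi>} \<and> card A = psize \<sigma>})"

definition growing_perms :: "(nat \<Rightarrow> sized_perm) \<Rightarrow> bool" where
  "growing_perms \<pi> \<longleftrightarrow>
     (\<forall>n. \<pi> n \<in> all_perms) \<and> filterlim (\<lambda>n. psize (\<pi> n)) at_top sequentially"

definition random_density_limit :: "sized_perm \<Rightarrow> (nat \<Rightarrow> sized_perm) \<Rightarrow> bool" where
  "random_density_limit \<sigma> \<pi> \<longleftrightarrow>
     (\<lambda>n. pattern_density \<sigma> (\<pi> n)) \<longlonglongrightarrow> 1 / fact (psize \<sigma>)"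

definition quasirandom :: "(nat \<Rightarrow> sized_perm) \<Rightarrow> bool" where
  "quasirandom \<pi> \<longleftrightarrow> growing_perms \<pi> \<and> (\<forall>\<sigma>\<in>all_perms. random_density_limit \<sigma> \<pi>)"

definition quasirandom_forcing :: "sized_perm set \<Rightarrow> bool" where
  "quasirandom_forcing S \<longleftrightarrow>
     (\<forall>\<pi>. growing_perms \<pi> \<and> (\<forall>\<sigma>\<in>S. random_density_limit \<sigma> \<pi>) \<longrightarrow> quasirandom \<pi>)"

end

theory Submission
  imports Defs "HOL-Analysis.Analysis"
begin

text \<open>
  A superset of a forcing set is forcing, so it suffices to defeat every set of four patterns. Let
  \<open>P\<^sub>\<sigma>\<close> be the permutation matrix of \<open>\<sigma>\<close>. To first order, perturbing the uniform density on a
  \<open>4 \<times> 4\<close> grid changes the density of \<open>\<sigma>\<close> by the inner product of \<open>P\<^sub>\<sigma>\<close> with an arbitrary matrix of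
  entry sum \<open>0\<close>. If the four matrices and the all-ones matrix are linearly independent, some fifth
  permutation matrix is independent of them, and the open mapping theorem yields a non-uniform density
  in which the four patterns keep density \<open>1/24\<close> while the fifth does not.

  Otherwise the four patterns are the rows of a Latin square, or \<open>P\<^sub>x + P\<^sub>y = P\<^sub>u + P\<^sub>v\<close> after
  relabelling. Each of these 42 sets is defeated by an inflation of a fixed permutation by monotone
  blocks: an integer certificate and Brouwer's theorem give block weights for which the four densities
  are exactly \<open>1/24\<close>, and a further pattern has density less than \<open>1/24\<close>.
\<close>

section \<open>Permutations from doubly ordered point sets\<close>

text \<open>Why a 4 x 4 grid suffices: at the uniform measure, the derivative of the density of
  \<open>\<sigma>\<close> is integration against a multiple of the sum over \<open>i\<close> of
  b_i(x) b_{\<sigma>(i)}(y), with cubic Bernstein polynomials b_i. A perturbation therefore acts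
  only through a 4 x 4 matrix of moments, and step functions on the grid realise every such matrix.
  Entry sum 0 is conservation of mass, which is why the all-ones matrix joins the permutation
  matrices.

  In the dependent case the gradients of the four densities, restricted to perturbations of mass 0,
  are dependent at the uniform measure, so first-order perturbation there is inconclusive and
  measures far from uniform are used. Inflations by monotone blocks suit this: up to normalisation
  their densities are quartic forms in the block weights with nonnegative integer coefficients, so
  remainder bounds and monotonicity come cheaply. The four densities must be exact, while the fifth
  needs only an inequality; hence Brouwer's theorem, which turns an integer inequality into exact
  weights that are never computed.\<close>

definition pattern_lists :: "'a set \<Rightarrow> ('a \<Rightarrow> nat) \<Rightarrow> ('a \<Rightarrow> nat) \<Rightarrow> sized_perm \<Rightarrow> 'a list set" where
  "pattern_lists P fx fy \<sigma> = {ps. length ps = psize \<sigma> \<and> set ps \<subseteq> P \<and> sorted_wrt (\<lambda>p q. fx p < fx q) ps \<and>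
     (\<forall>i<psize \<sigma>. \<forall>j<psize \<sigma>. papply \<sigma> (Suc i) < papply \<sigma> (Suc j) \<longleftrightarrow> fy (ps ! i) < fy (ps ! j))}"

definition point_rank :: "('a \<Rightarrow> nat) \<Rightarrow> 'a set \<Rightarrow> 'a \<Rightarrow> nat" where
  "point_rank f P p = card {q \<in> P. f q \<le> f p}"

lemma point_rank_less_iff:
  assumes "finite P" "p \<in> P" "q \<in> P"
  shows "point_rank f P p < point_rank f P q \<longleftrightarrow> f p < f q"
proof -
  have mono: "point_rank f P p \<le> point_rank f P q" if "f p \<le> f q" for p q
    unfolding point_rank_def using that assms(1) by (intro card_mono) auto
  moreover have "point_rank f P p < point_rank f P q" if "f p < f q"
    unfolding point_rank_def
  proof (rule psubset_card_mono)
    show "finite {r \<in> P. f r \<le> f q}" using assms(1) by simp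
    have "q \<in> {r \<in> P. f r \<le> f q}" "q \<notin> {r \<in> P. f r \<le> f p}" using that assms by auto
    then have "{r \<in> P. f r \<le> f p} \<noteq> {r \<in> P. f r \<le> f q}" by blast
    moreover have "{r \<in> P. f r \<le> f p} \<subseteq> {r \<in> P. f r \<le> f q}" using that by auto
    ultimately show "{r \<in> P. f r \<le> f p} \<subset> {r \<in> P. f r \<le> f q}" by (simp add: psubset_eq)
  qed
  ultimately show ?thesis by (meson linorder_not_le order.strict_iff_not)
qed

lemma bij_betw_point_rank:
  assumes "finite P" "inj_on f P"
  shows "bij_betw (point_rank f P) P {1..card P}"
proof -
  have inj: "inj_on (point_rank f P) P"
  proof (rule inj_onI)
    fix p q assume "p \<in> P" "q \<in> P" "point_rank f P p = point_rank f P q"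
    then have "\<not> f p < f q" "\<not> f q < f p"
      using point_rank_less_iff[OF assms(1)] by (metis less_irrefl)+
    then show "p = q" using assms(2) \<open>p \<in> P\<close> \<open>q \<in> P\<close> by (metis inj_onD linorder_neqE_nat)
  qed
  have "point_rank f P p \<in> {1..card P}" if "p \<in> P" for p
  proof -
    have "{p} \<subseteq> {q \<in> P. f q \<le> f p}" using that by auto
    then have "card {p} \<le> point_rank f P p" unfolding point_rank_def using assms(1) by (intro card_mono) auto
    moreover have "point_rank f P p \<le> card P" unfolding point_rank_def using assms(1) by (intro card_mono) auto
    ultimately show ?thesis by simp
  qed
  then have "point_rank f P ` P \<subseteq> {1..card P}" by blast
  moreover have "card (point_rank f P ` P) = card P" using inj by (rule card_image)
  ultimately have "point_rank f P ` P = {1..card P}" by (simp add: card_subset_eq)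
  with inj show ?thesis by (simp add: bij_betw_def)
qed

text \<open>The points, sorted by \<open>fx\<close>, get their \<open>fy\<close>-ranks as values.
  Only the order of the keys matters, so the constructions below may use any injective keys, with
  gaps. Occurrences become lists in \<open>fx\<close>-order; lists are indexed from 0 and patterns
  from 1, whence the \<open>Suc\<close> in \<open>pattern_lists\<close>. One permutation serves all
  patterns at once.\<close>

lemma exists_perm_of_points:
  fixes fx fy :: "'a \<Rightarrow> nat"
  assumes fin: "finite P" and fx: "inj_on fx P" and fy: "inj_on fy P"
  shows "\<exists>\<pi>\<in>point_perms (card P). \<forall>\<sigma>.
    card {A. A \<subseteq> {1..psize \<pi>} \<and> card A = psize \<sigma> \<and> induces \<pi> A \<sigma>} = card (pattern_lists P fx fy \<sigma>)"
proof -
  let ?n = "card P"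
  let ?rx = "point_rank fx P" and ?ry = "point_rank fy P"
  have bx: "bij_betw ?rx P {1..?n}" and by': "bij_betw ?ry P {1..?n}"
    using bij_betw_point_rank fin fx fy by blast+
  define g where "g = inv_into P ?rx"
  have gb: "bij_betw g {1..?n} P" unfolding g_def using bx by (rule bij_betw_inv_into)
  have g_rx: "g (?rx p) = p" if "p \<in> P" for p
    unfolding g_def using bx that by (simp add: bij_betw_def)
  have rx_g: "?rx (g i) = i" if "i \<in> {1..?n}" for i
    unfolding g_def using bx that by (metis bij_betw_inv_into_right)
  define p where "p = (\<lambda>i. if i \<in> {1..?n} then ?ry (g i) else i)"
  have "bij_betw (\<lambda>i. ?ry (g i)) {1..?n} {1..?n}"
    using bij_betw_trans[OF gb by'] by (simp add: comp_def)
  then have "bij_betw p {1..?n} {1..?n}"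
    by (rule bij_betw_cong[THEN iffD1, rotated]) (simp add: p_def)
  then have perm: "p permutes {1..?n}"
    by (intro bij_imp_permutes) (auto simp: p_def)
  let ?\<pi> = "(?n, p)"
  have "card {A. A \<subseteq> {1..?n} \<and> card A = psize \<sigma> \<and> induces ?\<pi> A \<sigma>} = card (pattern_lists P fx fy \<sigma>)" for \<sigma>
  proof -
    let ?k = "psize \<sigma>"
    let ?L = "pattern_lists P fx fy \<sigma>"
    let ?h = "\<lambda>ps. set (map ?rx ps)"
    let ?C = "{A. A \<subseteq> {1..?n} \<and> card A = ?k \<and> induces ?\<pi> A \<sigma>}"
    have p_rx: "p (?rx q) = ?ry q" if "q \<in> P" for q
      using that bx g_rx by (auto simp: p_def bij_betw_def)
    have slist: "sorted_list_of_set (?h ps) = map ?rx ps" if "set ps \<subseteq> P" "sorted_wrt (\<lambda>p q. fx p < fx q) ps" for ps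
    proof -
      have "sorted_wrt (\<lambda>p q. ?rx p < ?rx q) ps"
        using that by (auto intro!: sorted_wrt_mono_rel[OF _ that(2)] simp: point_rank_less_iff[OF fin] subset_iff)
      then have "sorted_wrt (<) (map ?rx ps)" by (simp add: sorted_wrt_map)
      then show ?thesis
        by (metis sorted_list_of_set.idem_if_sorted_distinct strict_sorted_iff)
    qed
    have ind: "induces ?\<pi> (?h ps) \<sigma> \<longleftrightarrow>
        (\<forall>i<?k. \<forall>j<?k. papply \<sigma> (Suc i) < papply \<sigma> (Suc j) \<longleftrightarrow> fy (ps ! i) < fy (ps ! j))"
      if "set ps \<subseteq> P" "sorted_wrt (\<lambda>p q. fx p < fx q) ps" "length ps = ?k" for ps
    proof -
      have e: "elem_at (?h ps) (Suc i) = ?rx (ps ! i)" if "i < ?k" for i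
        using that \<open>length ps = ?k\<close> slist[OF \<open>set ps \<subseteq> P\<close> \<open>sorted_wrt _ ps\<close>] by (simp add: elem_at_def)
      have v: "p (elem_at (?h ps) (Suc i)) < p (elem_at (?h ps) (Suc j)) \<longleftrightarrow> fy (ps ! i) < fy (ps ! j)"
        if "i < ?k" "j < ?k" for i j
      proof -
        have "ps ! i \<in> P" "ps ! j \<in> P" using that \<open>length ps = ?k\<close> \<open>set ps \<subseteq> P\<close> by (metis nth_mem subsetD)+
        then show ?thesis using e that by (simp add: p_rx point_rank_less_iff[OF fin])
      qed
      have "induces ?\<pi> (?h ps) \<sigma> \<longleftrightarrow> (\<forall>i<?k. \<forall>j<?k. papply \<sigma> (Suc i) < papply \<sigma> (Suc j) \<longleftrightarrow>
          p (elem_at (?h ps) (Suc i)) < p (elem_at (?h ps) (Suc j)))"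
        unfolding induces_def
      proof (safe, goal_cases)
        case (3 i j)
        then show ?case by (metis Suc_pred atLeastAtMost_iff less_eq_Suc_le Suc_le_lessD snd_conv One_nat_def)
      next
        case (4 i j)
        then show ?case by (metis Suc_pred atLeastAtMost_iff less_eq_Suc_le Suc_le_lessD snd_conv One_nat_def)
      qed (auto)
      then show ?thesis using v by simp
    qed
    have "bij_betw ?h ?L ?C"
    proof (rule bij_betw_imageI)
      show "inj_on ?h ?L"
      proof (rule inj_onI)
        fix ps qs assume a: "ps \<in> ?L" "qs \<in> ?L" "?h ps = ?h qs"
        then have "map ?rx ps = map ?rx qs"
          using slist unfolding pattern_lists_def by (metis (no_types, lifting) mem_Collect_eq)
        then have "map g (map ?rx ps) = map g (map ?rx qs)" by simp
        moreover have "map g (map ?rx xs) = xs" if "set xs \<subseteq> P" for xs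
          using that by (simp add: map_idI subset_iff g_rx)
        ultimately show "ps = qs" using a by (simp add: pattern_lists_def)
      qed
      show "?h ` ?L = ?C"
      proof (intro equalityI subsetI)
        fix A assume "A \<in> ?h ` ?L"
        then obtain ps where ps: "ps \<in> ?L" "A = ?h ps" by blast
        then have s: "set ps \<subseteq> P" "sorted_wrt (\<lambda>p q. fx p < fx q) ps" "length ps = ?k"
          by (auto simp: pattern_lists_def)
        have "A \<subseteq> {1..?n}" using ps s bx by (auto simp: bij_betw_def)
        moreover have "card A = ?k"
          by (metis s ps(2) slist length_map sorted_list_of_set.length_sorted_key_list_of_set)
        moreover have "induces ?\<pi> A \<sigma>" using ps(1) ind[OF s] unfolding ps(2) by (simp add: pattern_lists_def)
        ultimately show "A \<in> ?C" by simp
      next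
        fix A assume A: "A \<in> ?C"
        then have finA: "finite A" using finite_subset by fastforce
        define ps where "ps = map g (sorted_list_of_set A)"
        have sub: "set ps \<subseteq> P" using A finA gb by (auto simp: ps_def bij_betw_def)
        have rxps: "map ?rx ps = sorted_list_of_set A"
          unfolding ps_def using A finA by (auto simp: comp_def intro!: map_idI rx_g)
        have len: "length ps = ?k" using A by (simp add: ps_def)
        have "sorted_wrt (<) (map ?rx ps)" unfolding rxps by simp
        then have "sorted_wrt (\<lambda>p q. ?rx p < ?rx q) ps" by (simp add: sorted_wrt_map)
        then have so: "sorted_wrt (\<lambda>p q. fx p < fx q) ps"
          by (rule sorted_wrt_mono_rel[rotated]) (use sub point_rank_less_iff[OF fin] in \<open>auto simp: subset_iff\<close>)
        have hA: "?h ps = A" unfolding rxps using finA by simp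
        then have "ps \<in> ?L" using A ind[OF sub so len] sub so len by (simp add: pattern_lists_def)
        then show "A \<in> ?h ` ?L" using hA by blast
      qed
    qed
    from bij_betw_same_card[OF this] show ?thesis by (rule sym)
  qed
  moreover have "?\<pi> \<in> point_perms ?n" using perm by (simp add: point_perms_def)
  ultimately show ?thesis by (intro bexI[of _ ?\<pi>]) simp_all
qed

section \<open>Counting increasing lists over blocks\<close>

lemma card_sorted_lists:
  assumes "finite A"
  shows "card {us::nat list. length us = r \<and> sorted_wrt (<) us \<and> set us \<subseteq> A} = card A choose r"
proof -
  have "bij_betw set {us::nat list. length us = r \<and> sorted_wrt (<) us \<and> set us \<subseteq> A} {U. U \<subseteq> A \<and> card U = r}"
  proof (rule bij_betw_byWitness[where f' = sorted_list_of_set])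
    show "\<forall>us\<in>{us::nat list. length us = r \<and> sorted_wrt (<) us \<and> set us \<subseteq> A}. sorted_list_of_set (set us) = us"
      by (metis (mono_tags, lifting) mem_Collect_eq sorted_list_of_set.idem_if_sorted_distinct strict_sorted_iff)
    show "\<forall>U\<in>{U. U \<subseteq> A \<and> card U = r}. set (sorted_list_of_set U) = U"
      by (simp add: finite_subset[OF _ assms])
    show "set ` {us. length us = r \<and> sorted_wrt (<) us \<and> set us \<subseteq> A} \<subseteq> {U. U \<subseteq> A \<and> card U = r}"
      by (auto simp: strict_sorted_iff distinct_card)
    show "sorted_list_of_set ` {U. U \<subseteq> A \<and> card U = r} \<subseteq> {us. length us = r \<and> sorted_wrt (<) us \<and> set us \<subseteq> A}"
      by (auto simp: finite_subset[OF _ assms])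
  qed
  then show ?thesis using n_subsets[OF assms] by (simp add: bij_betw_same_card)
qed

abbreviation lex_less :: "nat \<times> nat \<Rightarrow> nat \<times> nat \<Rightarrow> bool" where
  "lex_less p q \<equiv> fst p < fst q \<or> fst p = fst q \<and> snd p < snd q"

text \<open>A point is a block index with an offset. The block indices are prescribed by
  \<open>as\<close>, so only the offsets vary.\<close>

definition inc_lists :: "(nat \<Rightarrow> nat) \<Rightarrow> nat list \<Rightarrow> (nat \<times> nat) list set" where
  "inc_lists s as = {ps. map fst ps = as \<and> (\<forall>p\<in>set ps. snd p < s (fst p)) \<and> sorted_wrt lex_less ps}"

text \<open>Offsets in different blocks are independent, and those in block \<open>i\<close> form a
  set of size \<open>count_list as i\<close>. The induction splits off the last block, whose indices
  stand at the end of the sorted list \<open>as\<close>.\<close>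

lemma finite_card_inc_lists:
  assumes "sorted as" "set as \<subseteq> {..<k}"
  shows "finite (inc_lists s as) \<and> card (inc_lists s as) = (\<Prod>i<k. s i choose count_list as i)"
  using assms
proof (induction k arbitrary: as)
  case 0
  then have "inc_lists s as = {[]}" by (auto simp: inc_lists_def)
  with 0 show ?case by simp
next
  case (Suc k)
  define bs where "bs = filter (\<lambda>i. i < k) as"
  define r where "r = count_list as k"
  have as: "as = bs @ replicate r k"
    using Suc.prems unfolding bs_def r_def
  proof (induction as)
    case (Cons a as)
    show ?case
    proof (cases "a = k")
      case True
      with Cons.prems have "\<forall>x\<in>set as. x = k" by force
      then have "as = replicate (length as) k" by (metis replicate_length_same)
      moreover have "count_list (replicate n k) k = n" for n by (induction n) simp_all
      ultimately have "filter (\<lambda>i. i < k) as = []" "count_list as k = length as"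
        by (metis \<open>\<forall>x\<in>set as. x = k\<close> filter_False less_irrefl, metis)
      with True \<open>as = replicate (length as) k\<close> show ?thesis by simp
    next
      case False
      with Cons.prems have "a < k" by simp
      with Cons show ?thesis by simp
    qed
  qed simp
  have bs: "sorted bs" "set bs \<subseteq> {..<k}" using Suc.prems(1) by (auto simp: bs_def sorted_wrt_filter)
  have cnt: "count_list bs i = count_list as i" if "i < k" for i
    using that unfolding as by (simp add: count_list_append)
  let ?U = "{us::nat list. length us = r \<and> sorted_wrt (<) us \<and> set us \<subseteq> {..<s k}}"
  let ?f = "\<lambda>(ps, us). ps @ map (Pair k) us"
  have "bij_betw ?f (inc_lists s bs \<times> ?U) (inc_lists s as)"
  proof (rule bij_betw_imageI)
    show "inj_on ?f (inc_lists s bs \<times> ?U)"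
    proof (rule inj_onI, clarify)
      fix ps us qs vs
      assume a: "ps \<in> inc_lists s bs" "qs \<in> inc_lists s bs" "ps @ map (Pair k) us = qs @ map (Pair k) vs"
      then have "map fst ps = bs" "map fst qs = bs" by (simp_all add: inc_lists_def)
      then have "length ps = length qs" by (metis length_map)
      with a(3) have "ps = qs" "map (Pair k) us = map (Pair k) vs" by auto
      moreover have "inj (Pair k)" by (simp add: inj_def)
      ultimately show "ps = qs \<and> us = vs" by (metis inj_map_eq_map)
    qed
    show "?f ` (inc_lists s bs \<times> ?U) = inc_lists s as"
    proof (intro equalityI subsetI)
      fix xs assume "xs \<in> ?f ` (inc_lists s bs \<times> ?U)"
      then obtain ps us where xs: "xs = ps @ map (Pair k) us" "ps \<in> inc_lists s bs" "us \<in> ?U" by auto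
      then have "map fst ps = bs" by (simp add: inc_lists_def)
      then have "\<forall>p\<in>set ps. fst p < k" using bs(2) by (metis image_eqI lessThan_iff list.set_map subsetD)
      then show "xs \<in> inc_lists s as"
        using xs \<open>map fst ps = bs\<close>
        by (auto simp: inc_lists_def as sorted_wrt_append sorted_wrt_map comp_def map_replicate_const subset_iff)
    next
      fix xs assume xs: "xs \<in> inc_lists s as"
      define ps where "ps = take (length bs) xs"
      define qs where "qs = drop (length bs) xs"
      have x: "xs = ps @ qs" by (simp add: ps_def qs_def)
      have m: "map fst xs = as" using xs by (simp add: inc_lists_def)
      then have mp: "map fst ps = bs" and mq: "map fst qs = replicate r k"
        unfolding ps_def qs_def by (auto simp: take_map[symmetric] drop_map[symmetric] as)
      have q: "qs = map (Pair k) (map snd qs)"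
      proof (rule nth_equalityI)
        fix i assume "i < length qs"
        then have "fst (qs ! i) = k" using mq by (metis length_map nth_map nth_replicate length_replicate)
        then show "qs ! i = map (Pair k) (map snd qs) ! i" using \<open>i < length qs\<close> by (simp add: prod_eq_iff)
      qed simp
      have fk: "\<forall>q\<in>set qs. fst q = k" using mq by (metis image_eqI in_set_replicate list.set_map)
      have "ps \<in> inc_lists s bs" using xs mp by (auto simp: inc_lists_def x sorted_wrt_append)
      moreover have "sorted_wrt lex_less qs" using xs by (auto simp: inc_lists_def x sorted_wrt_append)
      then have "sorted_wrt (\<lambda>p q. snd p < snd q) qs"
        by (rule sorted_wrt_mono_rel[rotated]) (use fk in auto)
      then have "map snd qs \<in> ?U"
        using xs fk mq by (auto simp: inc_lists_def x sorted_wrt_map) (metis length_map length_replicate)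
      ultimately show "xs \<in> ?f ` (inc_lists s bs \<times> ?U)" using x q by (metis (no_types, lifting) SigmaI case_prod_conv image_eqI)
    qed
  qed
  moreover have "finite ?U" by (rule finite_subset[OF _ finite_lists_length_eq[of "{..<s k}" r]]) auto
  moreover have "card ?U = s k choose r" using card_sorted_lists[of "{..<s k}" r] by simp
  moreover have "finite (inc_lists s bs)" "card (inc_lists s bs) = (\<Prod>i<k. s i choose count_list as i)"
    using Suc.IH[OF bs] cnt by simp_all
  ultimately have "finite (inc_lists s as)" "card (inc_lists s as) = (\<Prod>i<k. s i choose count_list as i) * (s k choose r)"
    using bij_betw_finite[of ?f "inc_lists s bs \<times> ?U" "inc_lists s as"] bij_betw_same_card[of ?f "inc_lists s bs \<times> ?U" "inc_lists s as"]
    by (simp_all add: card_cartesian_product)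
  then show ?case by (simp add: r_def)
qed

section \<open>Inflations by monotone blocks\<close>

definition plist :: "sized_perm \<Rightarrow> nat list" where
  "plist \<sigma> = map (papply \<sigma>) [1, 2, 3, 4]"

lemma plist_nth: "i < 4 \<Longrightarrow> plist \<sigma> ! i = papply \<sigma> (Suc i)"
  by (auto simp: plist_def numeral_eq_Suc less_Suc_eq)

text \<open>The blocks of four points decide which pattern they induce: two points of one block
  compare by its direction, points of different blocks by \<open>\<tau>\<close>. Testing
  \<open>i < j\<close> is enough because distinct points have distinct heights.\<close>

definition block_compat :: "(nat \<Rightarrow> nat) \<Rightarrow> (nat \<Rightarrow> bool) \<Rightarrow> nat list \<Rightarrow> nat list \<Rightarrow> bool" where
  "block_compat \<tau> inc s as \<longleftrightarrow>
     (\<forall>j<4. \<forall>i<j. s ! i < s ! j \<longleftrightarrow> (if as ! i = as ! j then inc (as ! i) else \<tau> (as ! i) < \<tau> (as ! j)))"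

definition block_lists :: "nat \<Rightarrow> (nat \<Rightarrow> nat) \<Rightarrow> (nat \<Rightarrow> bool) \<Rightarrow> nat list \<Rightarrow> nat list set" where
  "block_lists k \<tau> inc s = {as. length as = 4 \<and> sorted as \<and> set as \<subseteq> {..<k} \<and> block_compat \<tau> inc s as}"

lemma finite_block_lists: "finite (block_lists k \<tau> inc s)"
  by (rule finite_subset[OF _ finite_lists_length_eq[of "{..<k}" 4]]) (auto simp: block_lists_def)

text \<open>Lexicographic order becomes the order of numbers with last digit in base
  \<open>M\<close>; all keys below are built this way.\<close>

lemma block_key_less:
  fixes i j u v M :: nat
  assumes "u < M" "v < M"
  shows "i * M + u < j * M + v \<longleftrightarrow> i < j \<or> i = j \<and> u < v"
proof -
  have "i * M + u < j * M + v" if "i < j" "u < M" for i j u v :: nat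
  proof -
    have "i * M + u < Suc i * M" using \<open>u < M\<close> by simp
    also have "\<dots> \<le> j * M" using that by (intro mult_le_mono1) simp
    finally show ?thesis by simp
  qed
  from this[of i j u v] this[of j i v u] show ?thesis
    using assms by (cases i j rule: linorder_cases) auto
qed

lemma point_perm_less_iff:
  assumes "\<sigma> \<in> point_perms 4" "i \<noteq> j"
  shows "papply \<sigma> i < papply \<sigma> j \<longleftrightarrow> \<not> papply \<sigma> j < papply \<sigma> i"
proof -
  have "inj (papply \<sigma>)" using assms(1) by (auto simp: point_perms_def permutes_inj)
  then show ?thesis using assms(2) by (metis injD linorder_less_linear not_less_iff_gr_or_eq)
qed

text \<open>Since the blocks alone decide the pattern, the occurrences are the disjoint union of
  complete sets \<open>inc_lists s as\<close> over the compatible \<open>as\<close>. In a decreasing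
  block the offset is mirrored to \<open>M - 1 - u\<close>, which is exact because
  \<open>u < M\<close>.\<close>

lemma card_pattern_lists_blocks:
  fixes s :: "nat \<Rightarrow> nat" and inc :: "nat \<Rightarrow> bool"
  assumes \<tau>: "inj_on \<tau> {..<k}" and M: "\<And>i. i < k \<Longrightarrow> s i \<le> M" and \<sigma>: "\<sigma> \<in> point_perms 4"
  defines "fx \<equiv> \<lambda>(i, u). i * M + u"
    and "fy \<equiv> \<lambda>(i, u). \<tau> i * M + (if inc i then u else M - 1 - u)"
    and "P \<equiv> SIGMA i:{..<k}. {..<s i}"
  shows "inj_on fx P" "inj_on fy P"
    "card (pattern_lists P fx fy \<sigma>) =
       (\<Sum>as\<in>block_lists k \<tau> inc (plist \<sigma>). \<Prod>i<k. s i choose count_list as i)"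
proof -
  have u: "snd p < M" if "p \<in> P" for p
    using that M[of "fst p"] by (auto simp: P_def)
  have fx: "fx p < fx q \<longleftrightarrow> lex_less p q" if "p \<in> P" "q \<in> P" for p q
    using u[OF that(1)] u[OF that(2)] by (simp add: fx_def case_prod_beta block_key_less)
  have fy: "fy p < fy q \<longleftrightarrow> (if fst p = fst q then if inc (fst p) then snd p < snd q else snd q < snd p
      else \<tau> (fst p) < \<tau> (fst q))" if "p \<in> P" "q \<in> P" for p q
  proof -
    note u = u[OF that(1)] u[OF that(2)]
    have "fst p < k" "fst q < k" using that by (auto simp: P_def)
    then have "\<tau> (fst p) = \<tau> (fst q) \<longleftrightarrow> fst p = fst q" using \<tau> by (auto dest: inj_onD)
    moreover have "fy p < fy q \<longleftrightarrow> \<tau> (fst p) < \<tau> (fst q) \<or> \<tau> (fst p) = \<tau> (fst q) \<and>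
        (if inc (fst p) then snd p else M - 1 - snd p) < (if inc (fst q) then snd q else M - 1 - snd q)"
      unfolding fy_def case_prod_beta using u by (intro block_key_less) auto
    ultimately show ?thesis using u by auto
  qed
  show "inj_on fx P"
  proof (rule inj_onI)
    fix p q assume pq: "p \<in> P" "q \<in> P" "fx p = fx q"
    then have "\<not> fx p < fx q" "\<not> fx q < fx p" by auto
    then have "\<not> lex_less p q" "\<not> lex_less q p" using fx[OF pq(1,2)] fx[OF pq(2,1)] by auto
    then show "p = q" by (simp add: prod_eq_iff) (meson linorder_less_linear)
  qed
  show injy: "inj_on fy P"
  proof (rule inj_onI)
    fix p q assume pq: "p \<in> P" "q \<in> P" "fy p = fy q"
    then have "\<not> fy p < fy q" "\<not> fy q < fy p" by auto
    note n = this[unfolded fy[OF pq(1,2)] fy[OF pq(2,1)]]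
    have "fst p < k" "fst q < k" using pq by (auto simp: P_def)
    then have a: "fst p = fst q" using n \<tau> by (cases "fst p = fst q") (auto dest: inj_onD)
    then have "snd p = snd q" using n by (cases "inc (fst p)") auto
    with a show "p = q" by (simp add: prod_eq_iff)
  qed
  have sz: "psize \<sigma> = 4" using \<sigma> by (simp add: point_perms_def)
  have key: "fy (ps ! i) < fy (ps ! j) \<longleftrightarrow>
      (if as ! i = as ! j then inc (as ! i) else \<tau> (as ! i) < \<tau> (as ! j))"
    if "map fst ps = as" "set ps \<subseteq> P" "sorted_wrt lex_less ps" "i < j" "j < length ps" for ps as i j
  proof -
    have "lex_less (ps ! i) (ps ! j)" using sorted_wrt_nth_less[OF that(3-5)] .
    moreover have "as ! i = fst (ps ! i)" "as ! j = fst (ps ! j)" using that by auto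
    moreover have "ps ! i \<in> P" "ps ! j \<in> P" using that by auto
    ultimately show ?thesis using fy[of "ps ! i" "ps ! j"] by auto
  qed
  have full: "(\<forall>i<4. \<forall>j<4. papply \<sigma> (Suc i) < papply \<sigma> (Suc j) \<longleftrightarrow> fy (ps ! i) < fy (ps ! j)) \<longleftrightarrow>
      block_compat \<tau> inc (plist \<sigma>) (map fst ps)"
    if ps: "set ps \<subseteq> P" "sorted_wrt lex_less ps" "length ps = 4" for ps
  proof -
    let ?A = "\<lambda>i j. papply \<sigma> (Suc i) < papply \<sigma> (Suc j)" and ?B = "\<lambda>i j. fy (ps ! i) < fy (ps ! j)"
    have A: "?A i j \<longleftrightarrow> \<not> ?A j i" if "i \<noteq> j" for i j
      by (rule point_perm_less_iff[OF \<sigma>]) (simp add: that)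
    have B: "?B i j \<longleftrightarrow> \<not> ?B j i" if "i \<noteq> j" "i < 4" "j < 4" for i j
    proof -
      have ne: "ps ! i \<noteq> ps ! j" if "i < j" "j < 4" for i j
        using sorted_wrt_nth_less[OF ps(2) that(1)] that(2) ps(3) by auto
      have "ps ! i \<noteq> ps ! j" using ne[of i j] ne[of j i] that by (cases "i < j") auto
      moreover have "ps ! i \<in> P" "ps ! j \<in> P" using that ps by auto
      ultimately have "fy (ps ! i) \<noteq> fy (ps ! j)" using injy by (auto dest: inj_onD)
      then show ?thesis by auto
    qed
    \<comment> \<open>On distinct indices both relations hold in exactly one direction, so agreement
      for \<open>i < j\<close> gives agreement everywhere.\<close>
    have "(\<forall>i<4. \<forall>j<4. ?A i j \<longleftrightarrow> ?B i j) \<longleftrightarrow> (\<forall>j<4. \<forall>i<j. ?A i j \<longleftrightarrow> ?B i j)"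
    proof (rule iffI; intro allI impI)
      fix i j :: nat assume "\<forall>i<4. \<forall>j<4. ?A i j \<longleftrightarrow> ?B i j" "j < 4" "i < j"
      then show "?A i j \<longleftrightarrow> ?B i j" by (meson order.strict_trans)
    next
      fix i j :: nat assume H: "\<forall>j<4. \<forall>i<j. ?A i j \<longleftrightarrow> ?B i j" and ij: "i < 4" "j < 4"
      show "?A i j \<longleftrightarrow> ?B i j"
      proof (cases i j rule: linorder_cases)
        case less then show ?thesis using H ij by blast
      next
        case greater
        then have "?A j i \<longleftrightarrow> ?B j i" using H ij by blast
        then show ?thesis using A[of i j] B[of i j] greater ij by blast
      qed simp
    qed
    also have "\<dots> \<longleftrightarrow> block_compat \<tau> inc (plist \<sigma>) (map fst ps)"
      unfolding block_compat_def using key[OF refl ps(1,2)] ps(3) by (simp add: plist_nth)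
    finally show ?thesis .
  qed
  have "pattern_lists P fx fy \<sigma> = (\<Union>as\<in>block_lists k \<tau> inc (plist \<sigma>). inc_lists s as)"
  proof (intro equalityI subsetI)
    fix ps assume "ps \<in> pattern_lists P fx fy \<sigma>"
    then have ps: "length ps = 4" "set ps \<subseteq> P" "sorted_wrt (\<lambda>p q. fx p < fx q) ps"
      "\<forall>i<4. \<forall>j<4. papply \<sigma> (Suc i) < papply \<sigma> (Suc j) \<longleftrightarrow> fy (ps ! i) < fy (ps ! j)"
      by (simp_all add: pattern_lists_def sz)
    have "lex_less p q" if "p \<in> set ps" "q \<in> set ps" "fx p < fx q" for p q
      using fx[of p q] that ps(2) by auto
    then have so: "sorted_wrt lex_less ps" by (rule sorted_wrt_mono_rel[OF _ ps(3)])
    have "sorted (map fst ps)"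
      unfolding sorted_wrt_map by (rule sorted_wrt_mono_rel[OF _ so]) auto
    then have "map fst ps \<in> block_lists k \<tau> inc (plist \<sigma>)"
      using ps so full[of ps] by (auto simp: block_lists_def P_def)
    moreover have "ps \<in> inc_lists s (map fst ps)"
      using ps(2) so by (auto simp: inc_lists_def P_def)
    ultimately show "ps \<in> (\<Union>as\<in>block_lists k \<tau> inc (plist \<sigma>). inc_lists s as)" by blast
  next
    fix ps assume "ps \<in> (\<Union>as\<in>block_lists k \<tau> inc (plist \<sigma>). inc_lists s as)"
    then have as: "map fst ps \<in> block_lists k \<tau> inc (plist \<sigma>)" and
      i: "\<forall>p\<in>set ps. snd p < s (fst p)" "sorted_wrt lex_less ps" by (auto simp: inc_lists_def)
    have sub: "set ps \<subseteq> P" using as i(1) by (force simp: P_def block_lists_def)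
    have "fx p < fx q" if "p \<in> set ps" "q \<in> set ps" "lex_less p q" for p q
      using fx[of p q] that sub by auto
    then have "sorted_wrt (\<lambda>p q. fx p < fx q) ps" by (rule sorted_wrt_mono_rel[OF _ i(2)])
    then show "ps \<in> pattern_lists P fx fy \<sigma>"
      using as sub full[OF sub i(2)] by (auto simp: pattern_lists_def sz block_lists_def)
  qed
  moreover have "card (\<Union>as\<in>block_lists k \<tau> inc (plist \<sigma>). inc_lists s as) =
      (\<Sum>as\<in>block_lists k \<tau> inc (plist \<sigma>). card (inc_lists s as))"
  proof (rule card_UN_disjoint)
    show "\<forall>as\<in>block_lists k \<tau> inc (plist \<sigma>). finite (inc_lists s as)"
      using finite_card_inc_lists[of _ k s] unfolding block_lists_def by blast
  qed (auto simp: finite_block_lists inc_lists_def)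
  ultimately show "card (pattern_lists P fx fy \<sigma>) =
       (\<Sum>as\<in>block_lists k \<tau> inc (plist \<sigma>). \<Prod>i<k. s i choose count_list as i)"
    using finite_card_inc_lists[of _ k s]
    by (simp only:) (intro sum.cong refl, unfold block_lists_def, blast)
qed

section \<open>Limits of scaled counts\<close>

lemma choose_limit:
  fixes n :: "nat \<Rightarrow> nat" and r :: "nat \<Rightarrow> real"
  assumes "(\<lambda>m. real (n m) / r m) \<longlonglongrightarrow> z" "(\<lambda>m. 1 / r m) \<longlonglongrightarrow> 0"
  shows "(\<lambda>m. real (n m choose c) / r m ^ c) \<longlonglongrightarrow> z ^ c / fact c"
proof -
  \<comment> \<open>Each factor \<open>n m - i\<close> of the falling factorial is divided by its
    own \<open>r m\<close>; the shift by \<open>i\<close> disappears as \<open>1 / r m\<close> tends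
    to 0.\<close>
  have "(\<lambda>m. real (n m) / r m - real i * (1 / r m)) \<longlonglongrightarrow> z - real i * 0" for i
    by (intro tendsto_intros assms)
  then have "(\<lambda>m. (\<Prod>i=0..<c. real (n m) / r m - real i * (1 / r m)) / fact c) \<longlonglongrightarrow> (\<Prod>i=0..<c. z) / fact c"
    by (intro tendsto_intros) auto
  moreover have "(\<Prod>i=0..<c. real (n m) / r m - real i * (1 / r m)) / fact c = real (n m choose c) / r m ^ c" for m
    by (simp add: binomial_gbinomial gbinomial_prod_rev prod_dividef flip: diff_divide_distrib)
  ultimately show ?thesis by simp
qed

lemma floor_scaled_limit:
  fixes z :: real
  assumes "0 \<le> z"
  shows "(\<lambda>m. real (nat \<lfloor>real m * z\<rfloor>) / real m) \<longlonglongrightarrow> z"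
proof (rule tendsto_sandwich)
  show "\<forall>\<^sub>F m in sequentially. z - 1 / real m \<le> real (nat \<lfloor>real m * z\<rfloor>) / real m"
    using eventually_gt_at_top[of 0]
  proof eventually_elim
    case (elim m)
    have "real (nat \<lfloor>real m * z\<rfloor>) = real_of_int \<lfloor>real m * z\<rfloor>" using assms by simp
    then have "real m * z - 1 \<le> real (nat \<lfloor>real m * z\<rfloor>)" by linarith
    then have "(real m * z - 1) / real m \<le> real (nat \<lfloor>real m * z\<rfloor>) / real m" by (rule divide_right_mono) simp
    then show ?case using elim by (simp add: diff_divide_distrib)
  qed
  show "\<forall>\<^sub>F m in sequentially. real (nat \<lfloor>real m * z\<rfloor>) / real m \<le> z"
    using eventually_gt_at_top[of 0]
  proof eventually_elim
    case (elim m)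
    have "real (nat \<lfloor>real m * z\<rfloor>) \<le> real m * z" using assms by simp
    then show ?case using elim by (simp add: divide_le_eq mult.commute)
  qed
  show "(\<lambda>m. z - 1 / real m) \<longlonglongrightarrow> z"
    using tendsto_diff[OF tendsto_const lim_1_over_n, of z] by simp
qed simp

lemma growing_of_power:
  assumes "\<And>m. \<pi> m \<in> point_perms (n m)" "(\<lambda>m. real (n m) / real m ^ d) \<longlonglongrightarrow> Z" "0 < Z" "0 < d"
  shows "growing_perms \<pi>"
proof -
  have "filterlim (\<lambda>m. real m ^ d) at_top sequentially"
    using \<open>0 < d\<close> by (intro filterlim_pow_at_top filterlim_real_sequentially)
  then have "filterlim (\<lambda>m. (real (n m) / real m ^ d) * real m ^ d) at_top sequentially"
    by (rule filterlim_tendsto_pos_mult_at_top[OF assms(2,3)])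
  moreover have "\<forall>\<^sub>F m in sequentially. (real (n m) / real m ^ d) * real m ^ d = real (n m)"
    by (rule eventually_mono[OF eventually_gt_at_top[of 0]]) simp
  ultimately have "filterlim (\<lambda>m. real (n m)) at_top sequentially"
    by (rule filterlim_mono_eventually[OF _ order.refl order.refl])
  then have "filterlim n at_top sequentially"
    by (simp add: filterlim_sequentially_iff_filterlim_real)
  then show ?thesis
    using assms(1) by (auto simp: growing_perms_def all_perms_def point_perms_def)
qed

text \<open>Block \<open>i\<close> receives about \<open>m * z i\<close> points, so the counts are
  sums of products of binomials in the block sizes, exact before the limit. The factor 24 is the 4!
  from the number of four-element subsets.\<close>

theorem monotone_inflation_limit:
  assumes k: "0 < k" and \<tau>: "inj_on \<tau> {..<k}" and z: "\<And>i. i < k \<Longrightarrow> 0 < z i"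
  shows "\<exists>\<pi>. growing_perms \<pi> \<and> (\<forall>\<sigma>\<in>point_perms 4. (\<lambda>m. pattern_density \<sigma> (\<pi> m)) \<longlonglongrightarrow>
     24 * (\<Sum>as\<in>block_lists k \<tau> inc (plist \<sigma>). \<Prod>i<k. z i ^ count_list as i / fact (count_list as i)) / (\<Sum>i<k. z i) ^ 4)"
proof -
  define s where "s m i = nat \<lfloor>real m * z i\<rfloor>" for m i
  define M where "M m = (\<Sum>i<k. s m i)" for m
  define P where "P m = (SIGMA i:{..<k}. {..<s m i})" for m
  define fx where "fx m = (\<lambda>(i, u). i * M m + u)" for m
  define fy where "fy m = (\<lambda>(i, u). \<tau> i * M m + (if inc i then u else M m - 1 - u))" for m
  have M: "s m i \<le> M m" if "i < k" for m i
    unfolding M_def using that by (intro member_le_sum) auto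
  have cP: "card (P m) = M m" for m by (simp add: P_def M_def)
  have fP: "finite (P m)" for m by (simp add: P_def)
  have bl: "inj_on (fx m) (P m)" "inj_on (fy m) (P m)"
    "card (pattern_lists (P m) (fx m) (fy m) \<sigma>) =
       (\<Sum>as\<in>block_lists k \<tau> inc (plist \<sigma>). \<Prod>i<k. s m i choose count_list as i)"
    if "\<sigma> \<in> point_perms 4" for m \<sigma>
    using card_pattern_lists_blocks(1)[OF \<tau> _ that, where s = "s m" and M = "M m"]
      card_pattern_lists_blocks(2-3)[OF \<tau> _ that, where s = "s m" and M = "M m" and inc = inc] M
    unfolding fx_def fy_def P_def by simp_all
  \<comment> \<open>The injectivity statements in \<open>bl\<close> do not depend on the pattern;
    the identity supplies an instance for the premise.\<close>
  have id4: "(4, id) \<in> point_perms 4" by (simp add: point_perms_def permutes_id)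
  have "\<exists>p\<in>point_perms (M m). \<forall>\<sigma>. card {A. A \<subseteq> {1..psize p} \<and> card A = psize \<sigma> \<and> induces p A \<sigma>} =
      card (pattern_lists (P m) (fx m) (fy m) \<sigma>)" for m
    using exists_perm_of_points[OF fP bl(1)[OF id4] bl(2)[OF id4], of m] cP by simp
  then have "\<forall>m. \<exists>p. p \<in> point_perms (M m) \<and> (\<forall>\<sigma>. card {A. A \<subseteq> {1..psize p} \<and> card A = psize \<sigma> \<and> induces p A \<sigma>} =
      card (pattern_lists (P m) (fx m) (fy m) \<sigma>))" by blast
  from choice[OF this] obtain \<pi> where \<pi>: "\<And>m. \<pi> m \<in> point_perms (M m)" and
    cnt: "\<And>m \<sigma>. card {A. A \<subseteq> {1..psize (\<pi> m)} \<and> card A = psize \<sigma> \<and> induces (\<pi> m) A \<sigma>} =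
      card (pattern_lists (P m) (fx m) (fy m) \<sigma>)" by blast
  let ?Z = "\<Sum>i<k. z i"
  have Z: "0 < ?Z" using k z by (intro sum_pos) auto
  have sl: "(\<lambda>m. real (s m i) / real m) \<longlonglongrightarrow> z i" if "i < k" for i
    unfolding s_def using z[OF that] by (intro floor_scaled_limit) simp
  have Ml: "(\<lambda>m. real (M m) / real m) \<longlonglongrightarrow> ?Z"
    unfolding M_def using sl by (simp add: sum_divide_distrib) (intro tendsto_sum, simp)
  have "growing_perms \<pi>" using growing_of_power[OF \<pi>, where d = 1] Ml Z by simp
  moreover have "(\<lambda>m. pattern_density \<sigma> (\<pi> m)) \<longlonglongrightarrow>
     24 * (\<Sum>as\<in>block_lists k \<tau> inc (plist \<sigma>). \<Prod>i<k. z i ^ count_list as i / fact (count_list as i)) / ?Z ^ 4"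
    if \<sigma>: "\<sigma> \<in> point_perms 4" for \<sigma>
  proof -
    let ?B = "block_lists k \<tau> inc (plist \<sigma>)"
    have sz: "psize \<sigma> = 4" and szp: "psize (\<pi> m) = M m" for m
      using \<sigma> \<pi>[of m] by (simp_all add: point_perms_def)
    have d: "pattern_density \<sigma> (\<pi> m) = real (\<Sum>as\<in>?B. \<Prod>i<k. s m i choose count_list as i) / real (M m choose 4)" for m
      unfolding pattern_density_def cnt using n_subsets[of "{1..M m}" 4] bl(3)[OF \<sigma>, of m]
      by (simp add: sz szp)
    have sum4: "(\<Sum>i<k. count_list as i) = 4" if "as \<in> ?B" for as
      using that sum_count_set[of as "{..<k}"] by (simp add: block_lists_def)
    have "(\<lambda>m. (\<Sum>as\<in>?B. \<Prod>i<k. real (s m i choose count_list as i) / real m ^ count_list as i) / (real (M m choose 4) / real m ^ 4))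
      \<longlonglongrightarrow> (\<Sum>as\<in>?B. \<Prod>i<k. z i ^ count_list as i / fact (count_list as i)) / (?Z ^ 4 / fact 4)"
      using Z by (intro tendsto_divide tendsto_sum tendsto_prod choose_limit lim_1_over_n sl Ml) auto
    moreover have "\<forall>\<^sub>F m in sequentially. (\<Sum>as\<in>?B. \<Prod>i<k. real (s m i choose count_list as i) / real m ^ count_list as i) / (real (M m choose 4) / real m ^ 4)
       = pattern_density \<sigma> (\<pi> m)"
      using eventually_gt_at_top[of 0]
    proof eventually_elim
      case (elim m)
      have "(\<Prod>i<k. real (s m i choose count_list as i) / real m ^ count_list as i)
          = (\<Prod>i<k. real (s m i choose count_list as i)) / real m ^ 4" if "as \<in> ?B" for as
        using sum4[OF that] by (simp add: prod_dividef flip: power_sum)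
      then have "(\<Sum>as\<in>?B. \<Prod>i<k. real (s m i choose count_list as i) / real m ^ count_list as i)
          = (\<Sum>as\<in>?B. (\<Prod>i<k. real (s m i choose count_list as i))) / real m ^ 4"
        by (simp add: sum_divide_distrib)
      then show ?case using elim by (simp add: d)
    qed
    ultimately have "(\<lambda>m. pattern_density \<sigma> (\<pi> m)) \<longlonglongrightarrow>
      (\<Sum>as\<in>?B. \<Prod>i<k. z i ^ count_list as i / fact (count_list as i)) / (?Z ^ 4 / fact 4)"
      by (rule Lim_transform_eventually)
    moreover have "(fact 4 :: real) = 24" by (simp add: fact_numeral)
    ultimately show ?thesis by (simp add: mult.commute)
  qed
  ultimately show ?thesis by blast
qed

section \<open>Certificates\<close>

text \<open>The multinomial coefficient of the monomial with sorted indices \<open>a \<le> b \<le> c \<le> d\<close>.\<close>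

definition kap :: "nat \<Rightarrow> nat \<Rightarrow> nat \<Rightarrow> nat \<Rightarrow> int" where
  "kap a b c d = (if a = b then if b = c then if c = d then 1 else 4 else if c = d then 6 else 12
     else if b = c then if c = d then 4 else 12 else if c = d then 12 else 24)"

lemma kap_nonneg: "0 \<le> kap a b c d"
  by (simp add: kap_def)

lemma block_weight_eq_kap:
  fixes z :: "nat \<Rightarrow> real"
  assumes "sorted [a, b, c, d]" "d < k"
  shows "24 * (\<Prod>i<k. z i ^ count_list [a, b, c, d] i / fact (count_list [a, b, c, d] i))
    = of_int (kap a b c d) * z a * z b * z c * z d"
proof -
  let ?g = "\<lambda>i. z i ^ count_list [a, b, c, d] i / fact (count_list [a, b, c, d] i)"
  have "(\<Prod>i<k. ?g i) = (\<Prod>i\<in>{a, b, c, d}. ?g i)"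
    using assms by (intro prod.mono_neutral_right) auto
  moreover have "a \<le> b" "b \<le> c" "c \<le> d" using assms by auto
  ultimately show ?thesis
    by (cases "a = b"; cases "b = c"; cases "c = d")
      (auto simp: kap_def fact_numeral power2_eq_square power3_eq_cube power4_eq_xxxx)
qed

section \<open>Density polynomials as lists of monomials\<close>

definition block_pair_ok :: "nat list \<Rightarrow> bool list \<Rightarrow> nat \<Rightarrow> nat \<Rightarrow> nat \<Rightarrow> nat \<Rightarrow> bool" where
  "block_pair_ok t f x y a b \<longleftrightarrow> x < y \<longleftrightarrow> (if a = b then f ! a else t ! a < t ! b)"

lemma block_compat_Cons:
  "block_compat ((!) t) ((!) f) s [a, b, c, d] \<longleftrightarrow>
     block_pair_ok t f (s ! 0) (s ! 1) a b \<and> (block_pair_ok t f (s ! 0) (s ! 2) a c \<and> block_pair_ok t f (s ! 1) (s ! 2) b c) \<and>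
     (block_pair_ok t f (s ! 0) (s ! 3) a d \<and> block_pair_ok t f (s ! 1) (s ! 3) b d \<and> block_pair_ok t f (s ! 2) (s ! 3) c d)"
proof -
  have "(\<forall>j<4. \<forall>i<j. Q i j) \<longleftrightarrow> Q 0 1 \<and> (Q 0 2 \<and> Q 1 2) \<and> (Q 0 3 \<and> Q 1 3 \<and> Q 2 3)" for Q :: "nat \<Rightarrow> nat \<Rightarrow> bool"
    by (simp add: numeral_eq_Suc All_less_Suc) blast
  then show ?thesis unfolding block_compat_def block_pair_ok_def by simp
qed

text \<open>The loops run over sorted index quadruples and are pruned: an inner loop is entered only
  if all pairs chosen so far comply with the pattern. This keeps the evaluation feasible with a
  dozen blocks.\<close>

definition block_monomials :: "nat \<Rightarrow> nat list \<Rightarrow> bool list \<Rightarrow> nat list \<Rightarrow> (int \<times> nat \<times> nat \<times> nat \<times> nat) list" where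
  "block_monomials k t f s =
     concat (map (\<lambda>a. concat (map (\<lambda>b. if block_pair_ok t f (s ! 0) (s ! 1) a b then
       concat (map (\<lambda>c. if block_pair_ok t f (s ! 0) (s ! 2) a c \<and> block_pair_ok t f (s ! 1) (s ! 2) b c then
         concat (map (\<lambda>d. if block_pair_ok t f (s ! 0) (s ! 3) a d \<and> block_pair_ok t f (s ! 1) (s ! 3) b d \<and>
             block_pair_ok t f (s ! 2) (s ! 3) c d then [(kap a b c d, a, b, c, d)] else [])
           [c..<k]) else []) [b..<k]) else []) [a..<k])) [0..<k])"

text \<open>Quartic forms over any commutative ring: certificates are evaluated over the integers,
  the analysis takes place over the reals.\<close>

definition qev :: "(int \<times> nat \<times> nat \<times> nat \<times> nat) list \<Rightarrow> (nat \<Rightarrow> 'a::comm_ring_1) \<Rightarrow> 'a" where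
  "qev ms z = (\<Sum>(q, a, b, c, d)\<leftarrow>ms. of_int q * z a * z b * z c * z d)"

text \<open>The derivative of \<open>qev ms\<close> at \<open>z\<close> in direction
  \<open>v\<close>, by the product rule.\<close>

definition qdir :: "(int \<times> nat \<times> nat \<times> nat \<times> nat) list \<Rightarrow> (nat \<Rightarrow> 'a::comm_ring_1) \<Rightarrow> (nat \<Rightarrow> 'a) \<Rightarrow> 'a" where
  "qdir ms z v = (\<Sum>(q, a, b, c, d)\<leftarrow>ms. of_int q *
     (v a * z b * z c * z d + z a * v b * z c * z d + z a * z b * v c * z d + z a * z b * z c * v d))"

lemma sum_list_concat_map:
  "(\<Sum>x\<leftarrow>concat (map f xs). g x) = (\<Sum>y\<leftarrow>xs. \<Sum>x\<leftarrow>f y. g x)"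
  for g :: "'b \<Rightarrow> 'c::comm_monoid_add"
  by (induction xs) simp_all

lemma sum_list_if: "(\<Sum>x\<leftarrow>(if P then xs else []). g x) = (if P then \<Sum>x\<leftarrow>xs. g x else 0)"
  by simp

lemma sum_upt_eq: "(\<Sum>x\<leftarrow>[a..<k]. g x) = (\<Sum>x<k. if a \<le> x then g x else 0)"
  for g :: "nat \<Rightarrow> 'c::comm_monoid_add"
proof -
  have "(\<Sum>x\<leftarrow>[a..<k]. g x) = (\<Sum>x\<in>{x. x < k \<and> a \<le> x}. g x)"
    by (simp add: sum_list_distinct_conv_sum_set) (rule sum.cong, auto)
  also have "\<dots> = (\<Sum>x<k. if a \<le> x then g x else 0)"
    by (subst sum.inter_filter[symmetric]) auto
  finally show ?thesis .
qed

lemma if_sum: "(if P then \<Sum>x\<in>A. g x else 0) = (\<Sum>x\<in>A. if P then g x else 0)"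
  by simp

text \<open>The numerator of the limit density is thus an integer form: 24 divided by the factorials
  of the multiplicities is the multinomial coefficient \<open>kap\<close>.\<close>

lemma qev_block_monomials:
  fixes z :: "nat \<Rightarrow> real"
  shows "24 * (\<Sum>as\<in>block_lists k ((!) t) ((!) f) s. \<Prod>i<k. z i ^ count_list as i / fact (count_list as i))
    = qev (block_monomials k t f s) z"
proof -
  let ?F = "\<lambda>a b c d. of_int (kap a b c d) * z a * z b * z c * z d"
  let ?ok = "block_pair_ok t f"
  let ?P = "\<lambda>a b c d. a \<le> b \<and> ?ok (s ! 0) (s ! 1) a b \<and> b \<le> c \<and> (?ok (s ! 0) (s ! 2) a c \<and> ?ok (s ! 1) (s ! 2) b c) \<and>
     c \<le> d \<and> (?ok (s ! 0) (s ! 3) a d \<and> ?ok (s ! 1) (s ! 3) b d \<and> ?ok (s ! 2) (s ! 3) c d)"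
  let ?D = "{x \<in> {..<k} \<times> {..<k} \<times> {..<k} \<times> {..<k}. case x of (a, b, c, d) \<Rightarrow> ?P a b c d}"
  have "qev (block_monomials k t f s) z = (\<Sum>a<k. \<Sum>b<k. \<Sum>c<k. \<Sum>d<k. if ?P a b c d then ?F a b c d else 0)"
    unfolding qev_def block_monomials_def sum_list_concat_map sum_list_if sum_upt_eq if_sum
    by (intro sum.cong refl) simp
  also have "\<dots> = (\<Sum>x\<in>{..<k} \<times> {..<k} \<times> {..<k} \<times> {..<k}. case x of (a, b, c, d) \<Rightarrow> if ?P a b c d then ?F a b c d else 0)"
    by (simp add: sum.cartesian_product)
  also have "\<dots> = (\<Sum>x\<in>?D. case x of (a, b, c, d) \<Rightarrow> ?F a b c d)"
    by (subst sum.inter_filter) (auto intro!: sum.cong)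
  also have "\<dots> = (\<Sum>as\<in>block_lists k ((!) t) ((!) f) s. 24 * (\<Prod>i<k. z i ^ count_list as i / fact (count_list as i)))"
  proof -
    let ?h = "\<lambda>(a, b, c, d). [a, b, c, d]"
    let ?G = "\<lambda>as. 24 * (\<Prod>i<k. z i ^ count_list as i / fact (count_list as i))"
    have "bij_betw ?h ?D (block_lists k ((!) t) ((!) f) s)"
    proof (rule bij_betw_imageI)
      show "inj_on ?h ?D" by (auto simp: inj_on_def)
      show "?h ` ?D = block_lists k ((!) t) ((!) f) s"
      proof (intro equalityI subsetI)
        fix as assume "as \<in> block_lists k ((!) t) ((!) f) s"
        then obtain a b c d where "as = [a, b, c, d]" and abcd: "[a, b, c, d] \<in> block_lists k ((!) t) ((!) f) s"
          by (auto simp: block_lists_def length_Suc_conv numeral_eq_Suc)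
        moreover have "(a, b, c, d) \<in> ?D"
          using abcd unfolding block_lists_def mem_Collect_eq block_compat_Cons by auto
        ultimately show "as \<in> ?h ` ?D" by (intro image_eqI[of _ _ "(a, b, c, d)"]) simp_all
      next
        fix as assume "as \<in> ?h ` ?D"
        then obtain a b c d where "(a, b, c, d) \<in> ?D" "as = [a, b, c, d]" by auto
        then show "as \<in> block_lists k ((!) t) ((!) f) s"
          unfolding block_lists_def mem_Collect_eq by (auto simp: block_compat_Cons)
      qed
    qed
    then have "(\<Sum>as\<in>block_lists k ((!) t) ((!) f) s. ?G as) = (\<Sum>x\<in>?D. ?G (?h x))"
      by (rule sum.reindex_bij_betw[symmetric])
    also have "\<dots> = (\<Sum>x\<in>?D. case x of (a, b, c, d) \<Rightarrow> ?F a b c d)"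
    proof (rule sum.cong[OF refl])
      fix x assume x: "x \<in> ?D"
      obtain a b c d where "x = (a, b, c, d)" by (cases x) auto
      with x show "?G (?h x) = (case x of (a, b, c, d) \<Rightarrow> ?F a b c d)"
        using block_weight_eq_kap[of a b c d k z] by simp
    qed
    finally show ?thesis by (rule sym)
  qed
  finally show ?thesis by (simp add: sum_distrib_left)
qed

section \<open>Taylor remainders of quartic forms\<close>

lemma qev_of_int: "qev ms (\<lambda>l. of_int (C l)) = (of_int (qev ms C) :: real)"
  unfolding qev_def by (induction ms) auto

lemma qdir_of_int: "qdir ms (\<lambda>l. of_int (C l)) (\<lambda>l. of_int (v l)) = (of_int (qdir ms C v) :: real)"
  unfolding qdir_def by (induction ms) auto

lemma qdir_sum:
  "qdir ms C (\<lambda>l. \<Sum>j\<in>J. x j * b j l) = (\<Sum>j\<in>J. x j * qdir ms C (b j))" for x :: "'j \<Rightarrow> real"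
proof -
  have "qdir ms C (\<lambda>l. r * w l + v l) = r * qdir ms C w + qdir ms C v" for v w :: "nat \<Rightarrow> real" and r
    unfolding qdir_def by (induction ms) (auto simp: algebra_simps)
  note lin = this
  have "qdir ms C (\<lambda>l. 0) = 0" unfolding qdir_def by (induction ms) auto
  then show ?thesis
    by (induction J rule: infinite_finite_induct) (simp_all add: lin)
qed

lemma continuous_on_qev:
  assumes "\<And>l. continuous_on S (\<lambda>x. z x l :: real)"
  shows "continuous_on S (\<lambda>x. qev ms (z x))"
  unfolding qev_def
  by (induction ms) (auto intro!: continuous_intros assms)

text \<open>What remains after the linear term is a sum of eleven products with two, three or four
  deviations (six, four and one of them). With nonnegative base values, each is at most the same
  product formed with the bounds.\<close>

lemma monomial_remainder:
  fixes A B C D :: real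
  assumes "0 \<le> A" "0 \<le> B" "0 \<le> C" "0 \<le> D" "\<bar>a\<bar> \<le> r" "\<bar>b\<bar> \<le> s" "\<bar>c\<bar> \<le> t" "\<bar>d\<bar> \<le> u"
  shows "\<bar>(A + a) * (B + b) * (C + c) * (D + d) - A * B * C * D -
       (a * B * C * D + A * b * C * D + A * B * c * D + A * B * C * d)\<bar>
    \<le> (A + r) * (B + s) * (C + t) * (D + u) - A * B * C * D -
       (r * B * C * D + A * s * C * D + A * B * t * D + A * B * C * u)"
proof -
  have m2: "\<bar>x * y\<bar> \<le> X * Y" if "\<bar>x\<bar> \<le> X" "\<bar>y\<bar> \<le> Y" for x y X Y :: real
    using that by (simp add: abs_mult mult_mono')
  note ab = m2[OF assms(5,6)] and ac = m2[OF assms(5,7)] and ad = m2[OF assms(5,8)]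
    and bc = m2[OF assms(6,7)] and bd = m2[OF assms(6,8)] and cd = m2[OF assms(7,8)]
  have p: "\<bar>A\<bar> \<le> A" "\<bar>B\<bar> \<le> B" "\<bar>C\<bar> \<le> C" "\<bar>D\<bar> \<le> D" using assms by auto
  note t = m2[OF ab m2[OF p(3,4)]] m2[OF ac m2[OF p(2,4)]] m2[OF ad m2[OF p(2,3)]]
    m2[OF bc m2[OF p(1,4)]] m2[OF bd m2[OF p(1,3)]] m2[OF cd m2[OF p(1,2)]]
    m2[OF p(1) m2[OF assms(6) cd]] m2[OF p(2) m2[OF assms(5) cd]]
    m2[OF p(3) m2[OF assms(5) bd]] m2[OF p(4) m2[OF assms(5) bc]] m2[OF ab cd]
  have e: "(A + a) * (B + b) * (C + c) * (D + d) - A * B * C * D -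
       (a * B * C * D + A * b * C * D + A * B * c * D + A * B * C * d) =
     a * b * (C * D) + a * c * (B * D) + a * d * (B * C) + b * c * (A * D) + b * d * (A * C) + c * d * (A * B)
     + A * (b * (c * d)) + B * (a * (c * d)) + C * (a * (b * d)) + D * (a * (b * c)) + a * b * (c * d)"
    for a b c d by (simp add: algebra_simps)
  show ?thesis unfolding e
    by (intro order_trans[OF abs_triangle_ineq add_mono[OF _ t(11)]] order_trans[OF abs_triangle_ineq add_mono[OF _ t(10)]]
      order_trans[OF abs_triangle_ineq add_mono[OF _ t(9)]] order_trans[OF abs_triangle_ineq add_mono[OF _ t(8)]]
      order_trans[OF abs_triangle_ineq add_mono[OF _ t(7)]] order_trans[OF abs_triangle_ineq add_mono[OF _ t(6)]]
      order_trans[OF abs_triangle_ineq add_mono[OF _ t(5)]] order_trans[OF abs_triangle_ineq add_mono[OF _ t(4)]]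
      order_trans[OF abs_triangle_ineq add_mono[OF _ t(3)]] order_trans[OF abs_triangle_ineq add_mono[OF t(1) t(2)]])
qed

lemma qev_remainder:
  fixes C r v :: "nat \<Rightarrow> real"
  assumes "\<And>m. m \<in> set ms \<Longrightarrow> 0 \<le> fst m" "\<And>l. 0 \<le> C l" "\<And>l. \<bar>v l\<bar> \<le> r l"
  shows "\<bar>qev ms (\<lambda>l. C l + v l) - qev ms C - qdir ms C v\<bar>
    \<le> qev ms (\<lambda>l. C l + r l) - qev ms C - qdir ms C r"
  using assms(1)
proof (induction ms)
  case (Cons m ms)
  obtain q a b c d where m: "m = (q, a, b, c, d)" by (cases m) auto
  have q: "0 \<le> real_of_int q" using Cons.prems[of m] m by simp
  let ?R = "\<lambda>v. (C a + v a) * (C b + v b) * (C c + v c) * (C d + v d) - C a * C b * C c * C d -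
       (v a * C b * C c * C d + C a * v b * C c * C d + C a * C b * v c * C d + C a * C b * C c * v d)"
  have "\<bar>?R v\<bar> \<le> ?R r" by (intro monomial_remainder assms)
  then have a1: "\<bar>of_int q * ?R v\<bar> \<le> of_int q * ?R r" using q by (simp add: abs_mult mult_left_mono)
  have eq: "qev (m # ms) (\<lambda>l. C l + v l) - qev (m # ms) C - qdir (m # ms) C v =
      of_int q * ?R v + (qev ms (\<lambda>l. C l + v l) - qev ms C - qdir ms C v)" for v
    by (simp add: m qev_def qdir_def algebra_simps)
  have a2: "\<bar>qev ms (\<lambda>l. C l + v l) - qev ms C - qdir ms C v\<bar>
      \<le> qev ms (\<lambda>l. C l + r l) - qev ms C - qdir ms C r"
    using Cons by auto
  show ?case unfolding eq by (rule order_trans[OF abs_triangle_ineq add_mono[OF a1 a2]])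
qed (simp add: qev_def qdir_def)

lemma qev_mono:
  fixes y z :: "nat \<Rightarrow> real"
  assumes "\<And>m. m \<in> set ms \<Longrightarrow> 0 \<le> fst m" "\<And>l. 0 \<le> y l" "\<And>l. y l \<le> z l"
  shows "qev ms y \<le> qev ms z"
  using assms(1)
proof (induction ms)
  case (Cons m ms)
  obtain q a b c d where m: "m = (q, a, b, c, d)" by (cases m) auto
  have "0 \<le> real_of_int q" using Cons.prems[of m] m by simp
  then have "of_int q * y a * y b * y c * y d \<le> of_int q * z a * z b * z c * z d"
    using assms(2,3) order_trans[OF assms(2,3)] by (intro mult_mono mult_nonneg_nonneg) auto
  moreover have "qev ms y \<le> qev ms z" using Cons by auto
  ultimately show ?case by (simp add: m qev_def)
qed (simp add: qev_def)

lemma block_monomials_elem: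
  assumes "m \<in> set (block_monomials k t f s)"
  shows "\<exists>a<k. \<exists>b<k. \<exists>c<k. \<exists>d<k. m = (kap a b c d, a, b, c, d)"
proof -
  have set_if: "x \<in> set (if P then xs else []) \<longleftrightarrow> P \<and> x \<in> set xs" for x :: "int \<times> nat \<times> nat \<times> nat \<times> nat" and P xs
    by simp
  show ?thesis
    using assms unfolding block_monomials_def set_concat set_map UN_iff set_if Bex_def image_iff
    by (elim exE conjE) auto
qed

lemma block_monomials_nonneg: "m \<in> set (block_monomials k t f s) \<Longrightarrow> 0 \<le> fst m"
  using block_monomials_elem[of m k t f s] by (auto simp: kap_nonneg)

text \<open>The largest possible displacement of coordinate \<open>l\<close> by a combination of the
  directions \<open>B\<close> with coefficients in \<open>[-1, 1]\<close>.\<close>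

definition deviation :: "int list list \<Rightarrow> int list \<Rightarrow> nat \<Rightarrow> int" where
  "deviation B C l = (\<Sum>b\<leftarrow>B. \<bar>b ! l\<bar>)"

text \<open>
  The blocks have weights \<open>C\<close>, and the directions \<open>B\<close> invert the derivative of the four densities up
  to the factor \<open>L\<close>. As the density polynomials have nonnegative coefficients, their remainder after
  the linear term is largest at the corner of a box with all deviations positive.
\<close>

definition certified_pattern :: "(int \<times> nat \<times> nat \<times> nat \<times> nat) list \<Rightarrow> int list \<Rightarrow> int list list \<Rightarrow> int \<Rightarrow> nat \<Rightarrow> bool" where
  "certified_pattern ms C B L j \<longleftrightarrow>
     \<bar>24 * qev ms ((!) C) - sum_list C ^ 4\<bar>
     + (\<Sum>i\<leftarrow>[0..<4]. \<bar>24 * qdir ms ((!) C) ((!) (B ! i)) - (if i = j then L else 0)\<bar>)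
     + 24 * (qev ms (\<lambda>l. C ! l + deviation B C l) - qev ms ((!) C) - qdir ms ((!) C) (deviation B C)) \<le> L"

text \<open>Directions of sum 0 keep the total weight, so density 1/24 always means
  \<open>24 * qev = sum_list C ^ 4\<close>. The bound \<open>deviation B C l < C ! l\<close> keeps
  all weights of the box positive. The last condition tests the fifth pattern only at the upper
  corner of the box, where a form with nonnegative coefficients is largest.\<close>

definition certified :: "nat list \<Rightarrow> bool list \<Rightarrow> int list \<Rightarrow> int list list \<Rightarrow> int \<Rightarrow> nat list list \<Rightarrow> nat list \<Rightarrow> bool" where
  "certified t f C B L ss s' \<longleftrightarrow> t \<noteq> [] \<and> distinct t \<and> length C = length t \<and> 0 < L \<and> length ss = 4 \<and> length B = 4 \<and>
     list_all (\<lambda>b. length b = length t \<and> sum_list b = 0) B \<and>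
     list_all (\<lambda>l. deviation B C l < C ! l) [0..<length t] \<and>
     list_all (\<lambda>j. certified_pattern (block_monomials (length t) t f (ss ! j)) C B L j) [0..<4] \<and>
     24 * qev (block_monomials (length t) t f s') (\<lambda>l. C ! l + deviation B C l) < sum_list C ^ 4"

lemma sum_list_nth: "sum_list xs = (\<Sum>l<length xs. xs ! l)"
  by (simp add: sum_list_sum_nth lessThan_atLeast0)

lemma block_monomials_cong:
  assumes "\<And>l. l < k \<Longrightarrow> y l = z l"
  shows "qev (block_monomials k t f s) y = qev (block_monomials k t f s) z"
    and "(\<And>l. l < k \<Longrightarrow> u l = v l) \<Longrightarrow> qdir (block_monomials k t f s) y u = qdir (block_monomials k t f s) z v"
proof -
  have "a < k \<and> b < k \<and> c < k \<and> d < k" if "(q, a, b, c, d) \<in> set (block_monomials k t f s)" for q a b c d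
    using block_monomials_elem[OF that] by auto
  note bound = this
  show "qev (block_monomials k t f s) y = qev (block_monomials k t f s) z"
    unfolding qev_def by (intro arg_cong[of _ _ sum_list] map_cong refl) (auto dest!: bound simp: assms)
  show "qdir (block_monomials k t f s) y u = qdir (block_monomials k t f s) z v" if "\<And>l. l < k \<Longrightarrow> u l = v l"
    unfolding qdir_def by (intro arg_cong[of _ _ sum_list] map_cong refl) (auto dest!: bound simp: assms that)
qed

text \<open>The candidates are \<open>C\<close> plus combinations of the four directions with
  coefficients \<open>x\<close> in a cube. In these coordinates the vector \<open>G\<close> of the
  four errors has derivative close to \<open>L\<close> times the identity, so a zero of
  \<open>G\<close> is found as a fixed point of a simplified Newton map.\<close>

lemma certified_weights:
  assumes cert: "certified t f C B L ss s'"
  defines "k \<equiv> length t"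
  shows "\<exists>z :: nat \<Rightarrow> real. (\<forall>l<k. 0 < z l) \<and> (\<Sum>l<k. z l) = of_int (sum_list C) \<and>
    (\<forall>s\<in>set ss. 24 * qev (block_monomials k t f s) z = of_int (sum_list C) ^ 4) \<and>
    24 * qev (block_monomials k t f s') z < of_int (sum_list C) ^ 4"
proof -
  let ?r = "deviation B C"
  let ?ms = "\<lambda>s. block_monomials k t f s"
  \<comment> \<open>Beyond \<open>k\<close> the entry \<open>C ! l\<close> is unspecified; the value
    0 gives the remainder bound nonnegative weights at every index.\<close>
  let ?c = "\<lambda>l. if l < k then real_of_int (C ! l) else 0"
  let ?Q = "sum_list C"
  have C: "length C = k" and L: "0 < L" and ss: "length ss = 4" and B: "length B = 4"
    and Bs: "\<And>b. b \<in> set B \<Longrightarrow> length b = k \<and> sum_list b = 0"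
    and dev: "\<And>l. l < k \<Longrightarrow> ?r l < C ! l"
    and pat: "\<And>j. j < 4 \<Longrightarrow> certified_pattern (?ms (ss ! j)) C B L j"
    and low: "24 * qev (?ms s') (\<lambda>l. C ! l + ?r l) < ?Q ^ 4"
    using cert by (auto simp: certified_def k_def list_all_iff)
  \<comment> \<open>Brouwer's theorem is applied in \<open>real^4\<close>, whose coordinates are
    indexed by the type \<open>4\<close>, while the lists are indexed by numbers; \<open>h\<close>
    translates.\<close>
  have "card (UNIV :: 4 set) = card {..<4::nat}" by simp
  then obtain h where h: "bij_betw h (UNIV :: 4 set) {..<4::nat}"
    using bij_betw_iff_card[of "UNIV :: 4 set" "{..<4::nat}"] by auto
  have h4: "h j < 4" for j using h by (auto simp: bij_betw_def)
  define v where "v x l = (\<Sum>j\<in>UNIV. x $ j * (if l < k then real_of_int (B ! h j ! l) else 0))" for x :: "real^4" and l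
  define z where "z x l = ?c l + v x l" for x l
  let ?K = "cbox (\<chi> j. -1) (\<chi> j. 1) :: (real^4) set"
  have K: "x \<in> ?K \<longleftrightarrow> (\<forall>j. \<bar>x $ j\<bar> \<le> 1)" for x by (auto simp: mem_box_cart abs_le_iff)
  let ?rr = "\<lambda>l. if l < k then real_of_int (?r l) else 0"
  have sumB: "(\<Sum>j\<in>UNIV. g (h j)) = (\<Sum>i<4. g i)" for g :: "nat \<Rightarrow> real"
    by (rule sum.reindex_bij_betw[OF h])
  have r_eq: "?r l = (\<Sum>i<4. \<bar>B ! i ! l\<bar>)" for l
    unfolding deviation_def sum_list_nth by (simp add: B)
  have v_le: "\<bar>v x l\<bar> \<le> ?rr l" if "x \<in> ?K" for x l
  proof (cases "l < k")
    case True
    have "\<bar>v x l\<bar> \<le> (\<Sum>j\<in>UNIV. \<bar>x $ j * real_of_int (B ! h j ! l)\<bar>)"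
      unfolding v_def using True by (simp add: sum_abs)
    also have "\<dots> \<le> (\<Sum>j\<in>UNIV. \<bar>real_of_int (B ! h j ! l)\<bar>)"
      using that K by (intro sum_mono) (simp add: abs_mult mult_left_le_one_le)
    also have "\<dots> = ?rr l" using True sumB[of "\<lambda>i. \<bar>real_of_int (B ! i ! l)\<bar>"] by (simp add: r_eq)
    finally show ?thesis .
  qed (simp add: v_def)
  have r0: "0 \<le> ?r l" for l unfolding r_eq by (simp add: sum_nonneg)
  have c0: "0 \<le> ?c l" for l using dev[of l] r0[of l] by auto
  have qc: "qev (?ms s) ?c = of_int (qev (?ms s) ((!) C))" for s
    unfolding qev_of_int[symmetric] by (rule block_monomials_cong) simp
  have qcr: "qev (?ms s) (\<lambda>l. ?c l + ?rr l) = of_int (qev (?ms s) (\<lambda>l. C ! l + ?r l))" for s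
    unfolding qev_of_int[symmetric] by (rule block_monomials_cong) simp
  have qdr: "qdir (?ms s) ?c ?rr = of_int (qdir (?ms s) ((!) C) ?r)" for s
    unfolding qdir_of_int[symmetric] by (rule block_monomials_cong) simp_all
  have qd: "qdir (?ms s) ?c (\<lambda>l. if l < k then real_of_int (B ! i ! l) else 0) = of_int (qdir (?ms s) ((!) C) ((!) (B ! i)))" for s i
    unfolding qdir_of_int[symmetric] by (rule block_monomials_cong) simp_all
  define G where "G x j = 24 * qev (?ms (ss ! h j)) (z x) - of_int ?Q ^ 4" for x j
  \<comment> \<open>Three errors add up: the value at the centre, the difference between the true
    linear part and \<open>L * x $ j\<close>, and the Taylor remainder. Their bounds are the three
    summands of \<open>certified_pattern\<close>.\<close>
  have est: "\<bar>L * x $ j - G x j\<bar> \<le> L" if x: "x \<in> ?K" for x j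
  proof -
    let ?m = "?ms (ss ! h j)"
    let ?D = "\<lambda>i. real_of_int (24 * qdir ?m ((!) C) ((!) (B ! i)))"
    let ?e = "\<lambda>i. real_of_int (if i = h j then L else 0)"
    let ?R = "qev ?m (z x) - qev ?m ?c - qdir ?m ?c (v x)"
    have "\<bar>?R\<bar> \<le> qev ?m (\<lambda>l. ?c l + ?rr l) - qev ?m ?c - qdir ?m ?c ?rr"
      unfolding z_def by (intro qev_remainder block_monomials_nonneg[of _ k t f "ss ! h j"] c0 v_le x)
    then have R: "24 * \<bar>?R\<bar> \<le> real_of_int (24 * (qev ?m (\<lambda>l. C ! l + ?r l) - qev ?m ((!) C) - qdir ?m ((!) C) ?r))"
      by (simp add: qc qcr qdr)
    have dv: "24 * qdir ?m ?c (v x) = (\<Sum>i\<in>UNIV. x $ i * ?D (h i))"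
      unfolding v_def qdir_sum qd by (simp add: sum_distrib_left mult_ac)
    have ej: "(\<Sum>i\<in>UNIV. x $ i * ?e (h i)) = L * x $ j"
    proof -
      have "h i = h j \<longleftrightarrow> i = j" for i using h by (auto simp: bij_betw_def inj_on_def)
      then have "(\<Sum>i\<in>UNIV. x $ i * ?e (h i)) = (\<Sum>i\<in>UNIV. if i = j then L * x $ i else 0)"
        by (intro sum.cong) auto
      then show ?thesis by simp
    qed
    have tri: "\<bar>- a - b - 24 * c\<bar> \<le> \<bar>a\<bar> + \<bar>b\<bar> + 24 * \<bar>c\<bar>" for a b c :: real by linarith
    have "L * x $ j - G x j = - (24 * qev ?m ?c - of_int ?Q ^ 4) - (\<Sum>i\<in>UNIV. x $ i * (?D (h i) - ?e (h i))) - 24 * ?R"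
      unfolding G_def right_diff_distrib sum_subtractf ej using dv by (simp add: algebra_simps)
    then have "\<bar>L * x $ j - G x j\<bar> \<le> \<bar>24 * qev ?m ?c - of_int ?Q ^ 4\<bar> + \<bar>\<Sum>i\<in>UNIV. x $ i * (?D (h i) - ?e (h i))\<bar> + 24 * \<bar>?R\<bar>"
      by (simp only: tri)
    also have "\<dots> \<le> real_of_int \<bar>24 * qev ?m ((!) C) - ?Q ^ 4\<bar>
       + real_of_int (\<Sum>i\<leftarrow>[0..<4]. \<bar>24 * qdir ?m ((!) C) ((!) (B ! i)) - (if i = h j then L else 0)\<bar>)
       + real_of_int (24 * (qev ?m (\<lambda>l. C ! l + ?r l) - qev ?m ((!) C) - qdir ?m ((!) C) ?r))"
    proof (intro add_mono R)
      show "\<bar>24 * qev ?m ?c - of_int ?Q ^ 4\<bar> \<le> real_of_int \<bar>24 * qev ?m ((!) C) - ?Q ^ 4\<bar>"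
        by (simp add: qc)
      have "\<bar>\<Sum>i\<in>UNIV. x $ i * (?D (h i) - ?e (h i))\<bar> \<le> (\<Sum>i\<in>UNIV. \<bar>?D (h i) - ?e (h i)\<bar>)"
        using x K by (intro order_trans[OF sum_abs] sum_mono) (simp add: abs_mult mult_left_le_one_le)
      also have "\<dots> = (\<Sum>i<4. \<bar>?D i - ?e i\<bar>)" by (rule sumB)
      also have "\<dots> = real_of_int (\<Sum>i\<leftarrow>[0..<4]. \<bar>24 * qdir ?m ((!) C) ((!) (B ! i)) - (if i = h j then L else 0)\<bar>)"
        unfolding sum_list_distinct_conv_sum_set[OF distinct_upt] by (simp add: lessThan_atLeast0)
      finally show "\<bar>\<Sum>i\<in>UNIV. x $ i * (?D (h i) - ?e (h i))\<bar> \<le>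
        real_of_int (\<Sum>i\<leftarrow>[0..<4]. \<bar>24 * qdir ?m ((!) C) ((!) (B ! i)) - (if i = h j then L else 0)\<bar>)" .
    qed
    also have "\<dots> = real_of_int (\<bar>24 * qev ?m ((!) C) - ?Q ^ 4\<bar>
       + (\<Sum>i\<leftarrow>[0..<4]. \<bar>24 * qdir ?m ((!) C) ((!) (B ! i)) - (if i = h j then L else 0)\<bar>)
       + 24 * (qev ?m (\<lambda>l. C ! l + ?r l) - qev ?m ((!) C) - qdir ?m ((!) C) ?r))"
      by (simp only: of_int_add)
    also have "\<dots> \<le> L" using pat[OF h4[of j]] unfolding certified_pattern_def by (simp only: of_int_le_iff)
    finally show ?thesis .
  qed
  \<comment> \<open>The fixed points of \<open>F\<close> are the zeros of \<open>G\<close>, and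
    \<open>est\<close> divided by \<open>L\<close> says that \<open>F\<close> maps the cube into
    itself.\<close>
  define F where "F x = (\<chi> j. x $ j - G x j / L)" for x
  have zc: "continuous_on ?K (\<lambda>x. z x l)" for l
    unfolding z_def v_def by (intro continuous_intros)
  have "continuous_on ?K F"
    unfolding F_def G_def using L by (intro continuous_intros continuous_on_qev zc) auto
  moreover have "F \<in> ?K \<rightarrow> ?K"
  proof
    fix x assume x: "x \<in> ?K"
    have "\<bar>F x $ j\<bar> \<le> 1" for j
    proof -
      have "F x $ j = (L * x $ j - G x j) / L" using L by (simp add: F_def field_simps)
      then show ?thesis using est[OF x, of j] L by (simp add: abs_divide)
    qed
    then show "F x \<in> ?K" by (simp add: K)
  qed
  moreover have "0 \<in> ?K" by (simp add: K)
  ultimately obtain x where x: "x \<in> ?K" "F x = x"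
    using brouwer[of ?K F] compact_cbox convex_box(1) by (metis empty_iff)
  have zero: "G x j = 0" for j
  proof -
    have "F x $ j = x $ j" using x(2) by simp
    then show ?thesis using L by (simp add: F_def)
  qed
  show ?thesis
  proof (intro exI[of _ "z x"] conjI allI impI ballI)
    fix l assume l: "l < k"
    have "real_of_int (?r l) < real_of_int (C ! l)" using dev[OF l] by (simp only: of_int_less_iff)
    then show "0 < z x l" using v_le[OF x(1), of l] l by (simp add: z_def abs_le_iff)
  next
    have "(\<Sum>l<k. real_of_int (B ! h j ! l)) = 0" for j
    proof -
      have "B ! h j \<in> set B" using h4[of j] B by simp
      then have "sum_list (B ! h j) = 0" "length (B ! h j) = k" using Bs by auto
      then show ?thesis by (simp add: sum_list_nth flip: of_int_sum)
    qed
    then have "(\<Sum>l<k. v x l) = 0"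
      unfolding v_def by (subst sum.swap) (simp flip: sum_distrib_left)
    then show "(\<Sum>l<k. z x l) = of_int ?Q"
      by (simp add: z_def sum.distrib sum_list_nth C)
  next
    fix s assume "s \<in> set ss"
    then obtain i where "i < 4" "s = ss ! i" using ss by (metis in_set_conv_nth)
    moreover then obtain j where "h j = i" using h by (metis bij_betw_iff_bijections lessThan_iff)
    ultimately show "24 * qev (?ms s) (z x) = of_int ?Q ^ 4" using zero[of j] by (simp add: G_def)
  next
    have le: "qev (?ms s') (z x) \<le> qev (?ms s') (\<lambda>l. ?c l + ?rr l)"
    proof (intro qev_mono block_monomials_nonneg[of _ k t f s'])
      show "z x l \<le> ?c l + ?rr l" for l using v_le[OF x(1), of l] by (simp add: z_def abs_le_iff)
      show "0 \<le> z x l" for l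
      proof (cases "l < k")
        case True
        then have "real_of_int (?r l) < real_of_int (C ! l)" using dev by (simp only: of_int_less_iff)
        then show ?thesis using v_le[OF x(1), of l] True by (simp add: z_def abs_le_iff)
      qed (simp add: z_def v_def)
    qed
    have lt: "24 * qev (?ms s') (\<lambda>l. ?c l + ?rr l) < of_int ?Q ^ 4"
    proof -
      have "real_of_int (24 * qev (?ms s') (\<lambda>l. C ! l + ?r l)) < real_of_int (?Q ^ 4)"
        using low by (simp only: of_int_less_iff)
      then show ?thesis by (simp add: qcr)
    qed
    show "24 * qev (?ms s') (z x) < of_int ?Q ^ 4"
      by (rule le_less_trans[OF mult_left_mono[OF le] lt]) simp
  qed
qed

theorem certified_not_forcing:
  assumes cert: "certified t f C B L ss s'" and S: "S \<subseteq> point_perms 4" "plist ` S \<subseteq> set ss"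
    and \<sigma>: "\<sigma> \<in> point_perms 4" "plist \<sigma> = s'"
  shows "\<not> quasirandom_forcing S"
proof
  assume forcing: "quasirandom_forcing S"
  let ?k = "length t"
  let ?Q = "real_of_int (sum_list C)"
  from certified_weights[OF cert] obtain z :: "nat \<Rightarrow> real" where
    z1: "\<forall>l<?k. 0 < z l" and z2: "(\<Sum>l<?k. z l) = ?Q" and
    z3: "\<forall>s\<in>set ss. 24 * qev (block_monomials ?k t f s) z = ?Q ^ 4" and
    z4: "24 * qev (block_monomials ?k t f s') z < ?Q ^ 4"
    by (elim exE conjE)
  note z = z1[rule_format] z2 z3[rule_format] z4
  have "t \<noteq> []" "distinct t" using cert unfolding certified_def by blast+
  then have k: "0 < ?k" and "inj_on ((!) t) {..<?k}" by (auto simp: inj_on_nth)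
  from monotone_inflation_limit[OF this, where z = z and inc = "(!) f", OF z(1)]
  obtain \<pi> where \<pi>: "growing_perms \<pi>" "\<And>\<rho>. \<rho> \<in> point_perms 4 \<Longrightarrow> (\<lambda>m. pattern_density \<rho> (\<pi> m))
      \<longlonglongrightarrow> qev (block_monomials ?k t f (plist \<rho>)) z / ?Q ^ 4"
    unfolding qev_block_monomials z(2) by blast
  have Q: "0 < ?Q ^ 4" using z(1) k unfolding z(2)[symmetric] by (intro zero_less_power sum_pos) auto
  have f4: "1 / fact (psize \<rho>) = (1 / 24 :: real)" if "\<rho> \<in> point_perms 4" for \<rho>
    using that by (simp add: point_perms_def fact_numeral)
  have "random_density_limit \<rho> \<pi>" if "\<rho> \<in> S" for \<rho>
  proof -
    have "24 * qev (block_monomials ?k t f (plist \<rho>)) z = ?Q ^ 4" using that S z(3) by auto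
    then have "qev (block_monomials ?k t f (plist \<rho>)) z / ?Q ^ 4 = 1 / 24" using Q by (simp add: field_simps)
    note eq = this
    have \<rho>: "\<rho> \<in> point_perms 4" using that S(1) by auto
    show ?thesis using \<pi>(2)[OF \<rho>] unfolding eq random_density_limit_def f4[OF \<rho>] .
  qed
  then have "quasirandom \<pi>" using forcing \<pi>(1) by (simp add: quasirandom_forcing_def)
  then have "random_density_limit \<sigma> \<pi>" using \<sigma>(1) by (auto simp: quasirandom_def all_perms_def)
  then have "qev (block_monomials ?k t f s') z / ?Q ^ 4 = 1 / 24"
    unfolding random_density_limit_def f4[OF \<sigma>(1)]
    by (rule LIMSEQ_unique[OF \<pi>(2)[OF \<sigma>(1), unfolded \<sigma>(2)]])
  then show False using z(4) Q by (simp add: field_simps)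
qed

section \<open>Step densities\<close>

definition sorted4 :: "nat list set" where
  "sorted4 = {as. length as = 4 \<and> sorted as \<and> set as \<subseteq> {..<4}}"

lemma finite_sorted4: "finite sorted4"
  by (rule finite_subset[OF _ finite_lists_length_eq[of "{..<4::nat}" 4]]) (auto simp: sorted4_def)

text \<open>The pattern with positions and values counted from 0, to match list indices.\<close>

definition pos :: "sized_perm \<Rightarrow> nat \<Rightarrow> nat" where
  "pos \<sigma> i = papply \<sigma> (Suc i) - 1"

lemma pos_props:
  assumes "\<sigma> \<in> point_perms 4"
  shows "bij_betw (pos \<sigma>) {..<4} {..<4}"
    and "i < 4 \<Longrightarrow> j < 4 \<Longrightarrow> papply \<sigma> (Suc i) < papply \<sigma> (Suc j) \<longleftrightarrow> pos \<sigma> i < pos \<sigma> j"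
proof -
  have p: "papply \<sigma> permutes {1..4}" using assms by (simp add: point_perms_def)
  have r: "papply \<sigma> (Suc i) \<in> {1..4}" if "i < 4" for i using permutes_in_image[OF p, of "Suc i"] that by simp
  have "inj_on (pos \<sigma>) {..<4}"
  proof (rule inj_onI)
    fix i j assume "i \<in> {..<4}" "j \<in> {..<4}" "pos \<sigma> i = pos \<sigma> j"
    then have "papply \<sigma> (Suc i) = papply \<sigma> (Suc j)" using r[of i] r[of j] by (auto simp: pos_def)
    then show "i = j" using permutes_inj[OF p] by (simp add: inj_eq)
  qed
  moreover have "pos \<sigma> ` {..<4} \<subseteq> {..<4}" using r by (force simp: pos_def)
  ultimately show "bij_betw (pos \<sigma>) {..<4} {..<4}" by (simp add: bij_betw_def endo_inj_surj)
  show "papply \<sigma> (Suc i) < papply \<sigma> (Suc j) \<longleftrightarrow> pos \<sigma> i < pos \<sigma> j" if "i < 4" "j < 4"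
    using r[OF that(1)] r[OF that(2)] by (auto simp: pos_def)
qed

text \<open>Four distinct fine columns (or rows) in increasing order, where each of the four coarse
  ones is cut into \<open>m\<close> fine ones.\<close>

definition grid_lists :: "nat \<Rightarrow> (nat \<times> nat) list set" where
  "grid_lists m = {xs. length xs = 4 \<and> set xs \<subseteq> {..<4} \<times> {..<m} \<and> sorted_wrt lex_less xs}"

lemma sum_grid_lists:
  fixes \<phi> :: "nat list \<Rightarrow> nat"
  shows "finite (grid_lists m)"
    "(\<Sum>xs\<in>grid_lists m. \<phi> (map fst xs)) = (\<Sum>as\<in>sorted4. (\<Prod>i<4. m choose count_list as i) * \<phi> as)"
proof -
  let ?inc = "inc_lists (\<lambda>_. m)"
  have U: "grid_lists m = (\<Union>as\<in>sorted4. ?inc as)"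
  proof (intro equalityI subsetI)
    fix xs assume xs: "xs \<in> grid_lists m"
    have "sorted (map fst xs)"
      unfolding sorted_wrt_map by (rule sorted_wrt_mono_rel[of _ lex_less]) (use xs in \<open>auto simp: grid_lists_def\<close>)
    then have "map fst xs \<in> sorted4" using xs by (auto simp: grid_lists_def sorted4_def)
    moreover have "xs \<in> ?inc (map fst xs)" using xs by (auto simp: grid_lists_def inc_lists_def)
    ultimately show "xs \<in> (\<Union>as\<in>sorted4. ?inc as)" by blast
  next
    fix xs assume "xs \<in> (\<Union>as\<in>sorted4. ?inc as)"
    then have "map fst xs \<in> sorted4" "\<forall>p\<in>set xs. snd p < m" "sorted_wrt lex_less xs"
      by (auto simp: inc_lists_def)
    then show "xs \<in> grid_lists m" by (force simp: grid_lists_def sorted4_def)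
  qed
  have fc: "finite (?inc as) \<and> card (?inc as) = (\<Prod>i<4. m choose count_list as i)" if "as \<in> sorted4" for as
    using that finite_card_inc_lists[of as 4 "\<lambda>_. m"] by (simp add: sorted4_def)
  show "finite (grid_lists m)" unfolding U using finite_sorted4 fc by blast
  have "(\<Sum>xs\<in>grid_lists m. \<phi> (map fst xs)) = (\<Sum>as\<in>sorted4. \<Sum>xs\<in>?inc as. \<phi> (map fst xs))"
    unfolding U by (rule sum.UNION_disjoint) (use finite_sorted4 fc in \<open>auto simp: inc_lists_def\<close>)
  also have "\<dots> = (\<Sum>as\<in>sorted4. \<Sum>xs\<in>?inc as. \<phi> as)"
    by (intro sum.cong refl) (simp add: inc_lists_def)
  also have "\<dots> = (\<Sum>as\<in>sorted4. (\<Prod>i<4. m choose count_list as i) * \<phi> as)"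
    by (intro sum.cong refl) (simp add: fc)
  finally show "(\<Sum>xs\<in>grid_lists m. \<phi> (map fst xs)) = (\<Sum>as\<in>sorted4. (\<Prod>i<4. m choose count_list as i) * \<phi> as)" .
qed

section \<open>Point sets approximating a step density\<close>

type_synonym grid_point = "(nat \<times> nat) \<times> (nat \<times> nat) \<times> nat"

text \<open>The coarse cell \<open>(a, b)\<close> is cut into \<open>m * m\<close> squares, each
  holding \<open>n a b\<close> points that differ in the last component. With \<open>n a b\<close>
  proportional to \<open>m\<close> there are of order m^3 points, but only of order m^2 in one fine
  column or row, so coincidences of coordinates are negligible.\<close>

definition grid_points :: "nat \<Rightarrow> (nat \<Rightarrow> nat \<Rightarrow> nat) \<Rightarrow> grid_point set" where
  "grid_points m n = (SIGMA x:{..<4} \<times> {..<m}. SIGMA y:{..<4} \<times> {..<m}. {..<n (fst x) (fst y)})"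

text \<open>The occurrences whose points lie in four different fine columns and four different fine
  rows; only these are counted exactly.\<close>

definition strict_lists :: "nat \<Rightarrow> (nat \<Rightarrow> nat \<Rightarrow> nat) \<Rightarrow> sized_perm \<Rightarrow> grid_point list set" where
  "strict_lists m n \<sigma> = {ps. length ps = 4 \<and> set ps \<subseteq> grid_points m n \<and>
     sorted_wrt (\<lambda>p q. lex_less (fst p) (fst q)) ps \<and>
     (\<forall>i<4. \<forall>j<4. papply \<sigma> (Suc i) < papply \<sigma> (Suc j) \<longleftrightarrow> lex_less (fst (snd (ps ! i))) (fst (snd (ps ! j))))}"

text \<open>Such an occurrence amounts to independent choices: four columns, four rows, and one
  point in each square where column \<open>i\<close> meets row \<open>pos \<sigma> i\<close>. The
  number of points in a square depends only on its coarse cell, which groups the sum by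
  \<open>as\<close> and \<open>bs\<close>.\<close>

lemma card_strict_lists:
  assumes \<sigma>: "\<sigma> \<in> point_perms 4"
  shows "card (strict_lists m n \<sigma>) = (\<Sum>as\<in>sorted4. (\<Prod>i<4. m choose count_list as i) *
    (\<Sum>bs\<in>sorted4. (\<Prod>i<4. m choose count_list bs i) * (\<Prod>i<4. n (as ! i) (bs ! pos \<sigma> i))))"
proof -
  let ?s = "pos \<sigma>"
  note sb = pos_props(1)[OF \<sigma>] and sl = pos_props(2)[OF \<sigma>]
  define t where "t = inv_into {..<4} ?s"
  have s4: "?s i < 4" if "i < 4" for i using sb that by (auto simp: bij_betw_def)
  have t4: "t j < 4" "?s (t j) = j" if "j < 4" for j
    using that bij_betw_inv_into_right[OF sb, of j] bij_betwE[OF bij_betw_inv_into[OF sb]] by (auto simp: t_def)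
  have ts: "t (?s i) = i" if "i < 4" for i
    using that bij_betw_inv_into_left[OF sb, of i] by (simp add: t_def)
  let ?N = "\<lambda>q. \<lambda>i. {..<n (fst (fst q ! i)) (fst (snd q ! ?s i))}"
  let ?Z = "SIGMA q:grid_lists m \<times> grid_lists m. PiE {..<4::nat} (?N q)"
  let ?g = "\<lambda>(q, c). map (\<lambda>i. (fst q ! i, snd q ! ?s i, c i :: nat)) [0..<4]"
  have "bij_betw ?g ?Z (strict_lists m n \<sigma>)"
  proof (rule bij_betw_imageI)
    show "inj_on ?g ?Z"
    proof (rule inj_onI)
      fix z z' assume z: "z \<in> ?Z" "z' \<in> ?Z" "?g z = ?g z'"
      obtain xs ys c xs' ys' c' where zz: "z = ((xs, ys), c)" "z' = ((xs', ys'), c')"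
        by (metis prod.exhaust)
      have a: "xs \<in> grid_lists m" "ys \<in> grid_lists m" "xs' \<in> grid_lists m" "ys' \<in> grid_lists m"
        "c \<in> PiE {..<4} (?N (xs, ys))" "c' \<in> PiE {..<4} (?N (xs', ys'))"
        using z by (auto simp: zz)
      have e: "\<forall>i\<in>{0..<4}. xs ! i = xs' ! i \<and> ys ! ?s i = ys' ! ?s i \<and> c i = c' i"
        using z(3) by (simp add: zz del: upt_rec_numeral)
      have "xs = xs'" using a e by (intro nth_equalityI) (auto simp: grid_lists_def)
      moreover have "ys ! j = ys' ! j" if "j < 4" for j using e t4[OF that] by (metis atLeastLessThan_iff zero_le)
      then have "ys = ys'" using a by (intro nth_equalityI) (auto simp: grid_lists_def)
      moreover have "c i = c' i" for i
        using a(5,6) e by (cases "i < 4") (auto simp: PiE_def extensional_def)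
      then have "c = c'" by (rule ext)
      ultimately show "z = z'" by (simp add: zz)
    qed
    show "?g ` ?Z = strict_lists m n \<sigma>"
    proof (intro equalityI subsetI)
      fix ps assume "ps \<in> ?g ` ?Z"
      then obtain xs ys c where xy: "xs \<in> grid_lists m" "ys \<in> grid_lists m" "c \<in> PiE {..<4} (?N (xs, ys))"
        and ps: "ps = map (\<lambda>i. (xs ! i, ys ! ?s i, c i)) [0..<4]" by auto
      have len: "length xs = 4" "length ys = 4" using xy by (auto simp: grid_lists_def)
      have nth: "ps ! i = (xs ! i, ys ! ?s i, c i)" if "i < 4" for i using that by (simp add: ps)
      have "ps ! i \<in> grid_points m n" if "i < 4" for i
      proof -
        have "xs ! i \<in> set xs" "ys ! ?s i \<in> set ys" using that s4 len by auto
        then have "xs ! i \<in> {..<4} \<times> {..<m}" "ys ! ?s i \<in> {..<4} \<times> {..<m}" using xy(1,2) by (auto simp: grid_lists_def)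
        moreover have "c i \<in> ?N (xs, ys) i" using xy(3) that by (auto simp: PiE_def Pi_def)
        ultimately show ?thesis unfolding nth[OF that] grid_points_def by auto
      qed
      then have "set ps \<subseteq> grid_points m n" by (auto simp: ps)
      moreover have "sorted_wrt (\<lambda>p q. lex_less (fst p) (fst q)) ps"
      proof -
        have "lex_less (fst (ps ! i)) (fst (ps ! j))" if "i < j" "j < length ps" for i j
        proof -
          have "j < 4" "i < 4" using that by (auto simp: ps)
          then show ?thesis using nth sorted_wrt_nth_less[of lex_less xs i j] xy(1) that(1) len by (simp add: grid_lists_def)
        qed
        then show ?thesis by (simp add: sorted_wrt_iff_nth_less)
      qed
      moreover have "papply \<sigma> (Suc i) < papply \<sigma> (Suc j) \<longleftrightarrow> lex_less (fst (snd (ps ! i))) (fst (snd (ps ! j)))"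
        if ij: "i < 4" "j < 4" for i j
      proof -
        have lt: "lex_less (ys ! a) (ys ! b)" if "a < b" "b < 4" for a b
          using sorted_wrt_nth_less[of lex_less ys a b] xy(2) that len by (simp add: grid_lists_def)
        have "lex_less (ys ! a) (ys ! b) \<longleftrightarrow> a < b" if "a < 4" "b < 4" for a b
          using lt[of a b] lt[of b a] that by (cases a b rule: linorder_cases) auto
        then show ?thesis using nth[OF ij(1)] nth[OF ij(2)] sl[OF ij] s4[OF ij(1)] s4[OF ij(2)] by simp
      qed
      ultimately show "ps \<in> strict_lists m n \<sigma>" by (simp add: strict_lists_def ps)
    next
      fix ps assume ps: "ps \<in> strict_lists m n \<sigma>"
      then have len: "length ps = 4" and sub: "set ps \<subseteq> grid_points m n"
        and so: "sorted_wrt (\<lambda>p q. lex_less (fst p) (fst q)) ps"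
        and pat: "\<And>i j. i < 4 \<Longrightarrow> j < 4 \<Longrightarrow> papply \<sigma> (Suc i) < papply \<sigma> (Suc j) \<longleftrightarrow>
          lex_less (fst (snd (ps ! i))) (fst (snd (ps ! j)))"
        by (auto simp: strict_lists_def)
      have mem: "ps ! i \<in> grid_points m n" if "i < 4" for i using that len sub by auto
      define xs where "xs = map fst ps"
      \<comment> \<open>The point in the \<open>j\<close>-th lowest row stands at position
        \<open>t j\<close> of the list.\<close>
      define ys where "ys = map (\<lambda>j. fst (snd (ps ! t j))) [0..<4]"
      define c where "c = restrict (\<lambda>i. snd (snd (ps ! i))) {..<4}"
      have "xs \<in> grid_lists m"
        unfolding grid_lists_def xs_def mem_Collect_eq sorted_wrt_map using len so sub
        by (auto simp: grid_points_def)
      moreover have "ys \<in> grid_lists m"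
      proof -
        have "sorted_wrt lex_less ys"
          unfolding sorted_wrt_iff_nth_less
        proof (intro allI impI)
          fix a b assume "a < b" "b < length ys"
          then have ab: "a < 4" "b < 4" by (auto simp: ys_def)
          then have "papply \<sigma> (Suc (t a)) < papply \<sigma> (Suc (t b))" using sl t4 \<open>a < b\<close> by simp
          then show "lex_less (ys ! a) (ys ! b)" using pat[of "t a" "t b"] t4 ab by (simp add: ys_def)
        qed
        moreover have "set ys \<subseteq> {..<4} \<times> {..<m}"
        proof
          fix y assume "y \<in> set ys"
          then obtain j where "j < 4" "y = fst (snd (ps ! t j))" by (auto simp: ys_def)
          then show "y \<in> {..<4} \<times> {..<m}" using mem[OF t4(1)[OF \<open>j < 4\<close>]] by (cases "ps ! t j") (auto simp: grid_points_def)
        qed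
        ultimately show ?thesis by (simp add: grid_lists_def ys_def)
      qed
      moreover have nth: "xs ! i = fst (ps ! i)" "ys ! ?s i = fst (snd (ps ! i))" "c i = snd (snd (ps ! i))" if "i < 4" for i
        using that s4[OF that] ts[OF that] len by (simp_all add: xs_def ys_def c_def del: upt_rec_numeral)
      have "c \<in> PiE {..<4} (?N (xs, ys))"
      proof (rule PiE_I)
        fix i :: nat assume "i \<in> {..<4}"
        then show "c i \<in> ?N (xs, ys) i"
          using mem[of i] by (cases "ps ! i") (auto simp: nth grid_points_def)
      qed (simp add: c_def)
      moreover have "ps = ?g ((xs, ys), c)"
        using len by (intro nth_equalityI) (simp_all add: nth del: upt_rec_numeral)
      ultimately show "ps \<in> ?g ` ?Z" by (intro image_eqI[of _ _ "((xs, ys), c)"]) auto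
    qed
  qed
  then have "card (strict_lists m n \<sigma>) = card ?Z" by (simp add: bij_betw_same_card)
  also have "\<dots> = (\<Sum>q\<in>grid_lists m \<times> grid_lists m. \<Prod>i<4. n (fst (fst q ! i)) (fst (snd q ! ?s i)))"
    using sum_grid_lists(1) by (subst card_SigmaI) (auto simp: card_PiE finite_PiE)
  also have "\<dots> = (\<Sum>xs\<in>grid_lists m. \<Sum>ys\<in>grid_lists m. \<Prod>i<4. n (fst (xs ! i)) (fst (ys ! ?s i)))"
    by (simp add: sum.cartesian_product case_prod_beta)
  also have "\<dots> = (\<Sum>xs\<in>grid_lists m. \<Sum>ys\<in>grid_lists m. \<Prod>i<4. n (map fst xs ! i) (map fst ys ! ?s i))"
    using s4 by (intro sum.cong prod.cong refl) (auto simp: grid_lists_def)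
  also have "\<dots> = (\<Sum>xs\<in>grid_lists m. \<Sum>bs\<in>sorted4. (\<Prod>i<4. m choose count_list bs i) * (\<Prod>i<4. n (map fst xs ! i) (bs ! ?s i)))"
    by (intro sum.cong refl sum_grid_lists(2)[where \<phi> = "\<lambda>bs. \<Prod>i<4. n (map fst _ ! i) (bs ! ?s i)"])
  also have "\<dots> = (\<Sum>as\<in>sorted4. (\<Prod>i<4. m choose count_list as i) *
    (\<Sum>bs\<in>sorted4. (\<Prod>i<4. m choose count_list bs i) * (\<Prod>i<4. n (as ! i) (bs ! ?s i))))"
    by (rule sum_grid_lists(2)[where \<phi> = "\<lambda>as. \<Sum>bs\<in>sorted4. (\<Prod>i<4. m choose count_list bs i) * (\<Prod>i<4. n (as ! i) (bs ! ?s i))"])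
  finally show ?thesis .
qed

text \<open>Deleting entry \<open>j\<close> leaves three arbitrary points, and the key of entry
  \<open>i\<close> among them leaves at most \<open>D\<close> choices for the deleted one.\<close>

lemma card_tied_lists:
  assumes P: "finite P" and D: "\<And>x. card {q \<in> P. key q = x} \<le> D" and ij: "i < j" "j < 4"
  shows "card {ps. length ps = 4 \<and> set ps \<subseteq> P \<and> key (ps ! i) = key (ps ! j)} \<le> card P ^ 3 * D"
proof -
  let ?T = "{ps. length ps = 4 \<and> set ps \<subseteq> P \<and> key (ps ! i) = key (ps ! j)}"
  let ?Q = "{qs. set qs \<subseteq> P \<and> length qs = 3}"
  let ?f = "\<lambda>ps. (take j ps @ drop (Suc j) ps, ps ! j)"
  let ?S = "SIGMA qs:?Q. {q \<in> P. key q = key (qs ! i)}"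
  have "inj_on ?f ?T"
  proof (rule inj_onI)
    fix ps qs assume a: "ps \<in> ?T" "qs \<in> ?T" "?f ps = ?f qs"
    then have "length (take j ps) = length (take j qs)" by simp
    then have "take j ps = take j qs" "drop (Suc j) ps = drop (Suc j) qs" "ps ! j = qs ! j"
      using a(3) by (auto simp: append_eq_append_conv)
    moreover have "j < length ps" "j < length qs" using a ij by auto
    ultimately show "ps = qs" by (metis id_take_nth_drop)
  qed
  moreover have "?f ` ?T \<subseteq> ?S"
  proof (rule image_subsetI)
    fix ps assume ps: "ps \<in> ?T"
    have "(take j ps @ drop (Suc j) ps) ! i = ps ! i" using ij ps by (simp add: nth_append)
    moreover have "set (take j ps @ drop (Suc j) ps) \<subseteq> set ps"
      using set_take_subset[of j ps] set_drop_subset[of "Suc j" ps] by auto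
    moreover have "ps ! j \<in> P" using ps ij by auto
    ultimately show "?f ps \<in> ?S" using ps ij by auto
  qed
  moreover have fin: "finite ?Q" using finite_lists_length_eq[OF P] .
  moreover have "finite ?S" using fin P by (intro finite_SigmaI) auto
  ultimately have "card ?T \<le> card ?S" by (intro card_inj_on_le[where f = ?f])
  also have "\<dots> = (\<Sum>qs\<in>?Q. card {q \<in> P. key q = key (qs ! i)})"
    using fin P by (intro card_SigmaI) auto
  also have "\<dots> \<le> (\<Sum>qs\<in>?Q. D)" by (intro sum_mono D)
  also have "\<dots> = card P ^ 3 * D" using card_lists_length_eq[OF P, of 3] by simp
  finally show ?thesis .
qed

text \<open>Points in the same fine column or row need some order for the keys to be injective; ties
  are broken by the other coordinate and then by the number within the square. How they are broken
  is immaterial, since only tied lists are affected: six pairs of positions for each of the two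
  coordinates give the factor 12.\<close>

lemma card_pattern_lists_grid:
  fixes n :: "nat \<Rightarrow> nat \<Rightarrow> nat" and m K :: nat
  assumes K: "\<And>a b. a < 4 \<Longrightarrow> b < 4 \<Longrightarrow> n a b \<le> K" and \<sigma>: "\<sigma> \<in> point_perms 4"
  defines "e \<equiv> \<lambda>x. fst x * m + snd x"
  defines "fx \<equiv> \<lambda>p. (e (fst p) * (4 * m) + e (fst (snd p))) * K + snd (snd p)"
    and "fy \<equiv> \<lambda>p. (e (fst (snd p)) * (4 * m) + e (fst p)) * K + snd (snd p)"
    and "P \<equiv> grid_points m n"
  shows "finite P" "inj_on fx P" "inj_on fy P"
    "card (strict_lists m n \<sigma>) \<le> card (pattern_lists P fx fy \<sigma>)"
    "card (pattern_lists P fx fy \<sigma>) \<le> card (strict_lists m n \<sigma>) + 12 * (card P ^ 3 * (4 * m * K))"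
proof -
  let ?E = "{..<4::nat} \<times> {..<m}"
  show finP: "finite P" by (simp add: P_def grid_points_def)
  have PD: "fst p \<in> ?E" "fst (snd p) \<in> ?E" "snd (snd p) < K" if "p \<in> P" for p
    using that by (auto simp: P_def grid_points_def intro!: order.strict_trans2[OF _ K])
  have e4: "e x < 4 * m" if "x \<in> ?E" for x
  proof -
    have "fst x * m + snd x < Suc (fst x) * m" using that by auto
    also have "\<dots> \<le> 4 * m" using that by (intro mult_le_mono1) auto
    finally show ?thesis by (simp add: e_def)
  qed
  have el: "e x < e y \<longleftrightarrow> lex_less x y" if "x \<in> ?E" "y \<in> ?E" for x y
    unfolding e_def using that by (intro block_key_less) auto
  have ee: "e x = e y \<longleftrightarrow> x = y" if "x \<in> ?E" "y \<in> ?E" for x y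
  proof
    assume "e x = e y"
    then have "\<not> lex_less x y" "\<not> lex_less y x" using el[OF that] el[OF that(2,1)] by auto
    then show "x = y" by (simp add: prod_eq_iff) (meson linorder_less_linear)
  qed simp
  have kk: "(e x * (4 * m) + e y) * K + c < (e x' * (4 * m) + e y') * K + c' \<longleftrightarrow>
      lex_less x x' \<or> x = x' \<and> (lex_less y y' \<or> y = y' \<and> c < c')"
    if xy: "x \<in> ?E" "y \<in> ?E" "x' \<in> ?E" "y' \<in> ?E" and c: "c < K" "c' < K" for x y x' y' c c'
  proof -
    have "e x * (4 * m) + e y < e x' * (4 * m) + e y' \<longleftrightarrow> e x < e x' \<or> e x = e x' \<and> e y < e y'"
      using e4 xy by (intro block_key_less) auto
    moreover have "e x' * (4 * m) + e y' < e x * (4 * m) + e y \<longleftrightarrow> e x' < e x \<or> e x' = e x \<and> e y' < e y"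
      using e4 xy by (intro block_key_less) auto
    ultimately have "e x * (4 * m) + e y = e x' * (4 * m) + e y' \<longleftrightarrow> e x = e x' \<and> e y = e y'"
      by (metis less_irrefl linorder_less_linear)
    then show ?thesis
      unfolding block_key_less[OF c] \<open>(e x * (4 * m) + e y < e x' * (4 * m) + e y') = _\<close>
      using el[OF xy(1,3)] el[OF xy(2,4)] ee[OF xy(1,3)] ee[OF xy(2,4)] by blast
  qed
  let ?x = "\<lambda>p::grid_point. fst p" and ?y = "\<lambda>p::grid_point. fst (snd p)" and ?c = "\<lambda>p::grid_point. snd (snd p)"
  have fx: "fx p < fx q \<longleftrightarrow> lex_less (?x p) (?x q) \<or> ?x p = ?x q \<and> (lex_less (?y p) (?y q) \<or> ?y p = ?y q \<and> ?c p < ?c q)"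
    if "p \<in> P" "q \<in> P" for p q unfolding fx_def using PD[OF that(1)] PD[OF that(2)] by (intro kk)
  have fy: "fy p < fy q \<longleftrightarrow> lex_less (?y p) (?y q) \<or> ?y p = ?y q \<and> (lex_less (?x p) (?x q) \<or> ?x p = ?x q \<and> ?c p < ?c q)"
    if "p \<in> P" "q \<in> P" for p q unfolding fy_def using PD[OF that(1)] PD[OF that(2)] by (intro kk)
  have lin: "x = y" if "\<not> lex_less x y" "\<not> lex_less y x" for x y :: "nat \<times> nat"
    using that by (simp add: prod_eq_iff) (meson linorder_less_linear)
  show "inj_on fx P"
  proof (rule inj_onI)
    fix p q assume pq: "p \<in> P" "q \<in> P" "fx p = fx q"
    then have n: "\<not> fx p < fx q" "\<not> fx q < fx p" by auto
    then have x: "?x p = ?x q" using fx[OF pq(1,2)] fx[OF pq(2,1)] by (intro lin) blast+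
    then have y: "?y p = ?y q" using n fx[OF pq(1,2)] fx[OF pq(2,1)] by (intro lin) auto
    have "?c p = ?c q" using n fx[OF pq(1,2)] fx[OF pq(2,1)] x y by auto
    with x y show "p = q" by (simp add: prod_eq_iff)
  qed
  show "inj_on fy P"
  proof (rule inj_onI)
    fix p q assume pq: "p \<in> P" "q \<in> P" "fy p = fy q"
    then have n: "\<not> fy p < fy q" "\<not> fy q < fy p" by auto
    then have y: "?y p = ?y q" using fy[OF pq(1,2)] fy[OF pq(2,1)] by (intro lin) blast+
    then have x: "?x p = ?x q" using n fy[OF pq(1,2)] fy[OF pq(2,1)] by (intro lin) auto
    have "?c p = ?c q" using n fy[OF pq(1,2)] fy[OF pq(2,1)] x y by auto
    with x y show "p = q" by (simp add: prod_eq_iff)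
  qed
  have sz: "psize \<sigma> = 4" using \<sigma> by (simp add: point_perms_def)
  let ?A = "\<lambda>i j. papply \<sigma> (Suc i) < papply \<sigma> (Suc j)"
  have finL: "finite {ps. set ps \<subseteq> P \<and> length ps = 4}" using finP by (rule finite_lists_length_eq)
  have "strict_lists m n \<sigma> \<subseteq> pattern_lists P fx fy \<sigma>"
  proof
    fix ps assume ps: "ps \<in> strict_lists m n \<sigma>"
    then have len: "length ps = 4" and sub: "set ps \<subseteq> P"
      and so: "sorted_wrt (\<lambda>p q. lex_less (fst p) (fst q)) ps"
      and pat: "\<And>i j. i < 4 \<Longrightarrow> j < 4 \<Longrightarrow> ?A i j \<longleftrightarrow> lex_less (?y (ps ! i)) (?y (ps ! j))"
      by (auto simp: strict_lists_def P_def)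
    have "fx p < fx q" if "p \<in> set ps" "q \<in> set ps" "lex_less (fst p) (fst q)" for p q
      using fx[of p q] that sub by auto
    then have "sorted_wrt (\<lambda>p q. fx p < fx q) ps" by (rule sorted_wrt_mono_rel[OF _ so])
    moreover have "?A i j \<longleftrightarrow> fy (ps ! i) < fy (ps ! j)" if "i < 4" "j < 4" for i j
    proof (cases "i = j")
      case False
      have "ps ! i \<in> P" "ps ! j \<in> P" using that len sub by auto
      moreover have "papply \<sigma> (Suc i) \<noteq> papply \<sigma> (Suc j)"
        using False permutes_inj[of "papply \<sigma>" "{1..4}"] \<sigma> by (simp add: point_perms_def inj_eq)
      then have "?A i j \<or> ?A j i" by linarith
      then have ne: "?y (ps ! i) \<noteq> ?y (ps ! j)"
        unfolding pat[OF that] pat[OF that(2,1)] by (metis less_irrefl)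
      ultimately show ?thesis unfolding pat[OF that] using fy[of "ps ! i" "ps ! j"] by blast
    qed simp
    ultimately show "ps \<in> pattern_lists P fx fy \<sigma>" using len sub by (simp add: pattern_lists_def sz)
  qed
  moreover have "finite (pattern_lists P fx fy \<sigma>)"
    by (rule finite_subset[OF _ finL]) (auto simp: pattern_lists_def sz)
  ultimately show "card (strict_lists m n \<sigma>) \<le> card (pattern_lists P fx fy \<sigma>)" by (intro card_mono)
  let ?I = "{(0,1), (0,2), (0,3), (1,2), (1,3), (2,3::nat)} :: (nat \<times> nat) set"
  let ?T = "\<lambda>key (i, j). {ps. length ps = 4 \<and> set ps \<subseteq> P \<and> key (ps ! i) = (key (ps ! j) :: nat \<times> nat)}"
  have "pattern_lists P fx fy \<sigma> \<subseteq> strict_lists m n \<sigma> \<union> ((\<Union>ij\<in>?I. ?T ?x ij) \<union> (\<Union>ij\<in>?I. ?T ?y ij))"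
  proof
    fix ps assume "ps \<in> pattern_lists P fx fy \<sigma>"
    then have len: "length ps = 4" and sub: "set ps \<subseteq> P" and so: "sorted_wrt (\<lambda>p q. fx p < fx q) ps"
      and pat: "\<And>i j. i < 4 \<Longrightarrow> j < 4 \<Longrightarrow> ?A i j \<longleftrightarrow> fy (ps ! i) < fy (ps ! j)"
      by (auto simp: pattern_lists_def sz)
    show "ps \<in> strict_lists m n \<sigma> \<union> ((\<Union>ij\<in>?I. ?T ?x ij) \<union> (\<Union>ij\<in>?I. ?T ?y ij))"
    proof (cases "ps \<in> (\<Union>ij\<in>?I. ?T ?x ij) \<union> (\<Union>ij\<in>?I. ?T ?y ij)")
      case False
      have I: "(i, j) \<in> ?I" if "i < j" "j < 4" for i j using that by (auto simp: numeral_eq_Suc less_Suc_eq)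
      have ne1: "?x (ps ! i) \<noteq> ?x (ps ! j) \<and> ?y (ps ! i) \<noteq> ?y (ps ! j)" if "i < j" "j < 4" for i j
        using False I[OF that] len sub by blast
      have ne: "?x (ps ! i) \<noteq> ?x (ps ! j) \<and> ?y (ps ! i) \<noteq> ?y (ps ! j)" if "i \<noteq> j" "i < 4" "j < 4" for i j
        using ne1[of i j] ne1[of j i] that by (cases "i < j") auto
      have mem: "ps ! i \<in> P" if "i < 4" for i using that len sub by auto
      have "sorted_wrt (\<lambda>p q. lex_less (fst p) (fst q)) ps"
        unfolding sorted_wrt_iff_nth_less
      proof (intro allI impI)
        fix i j assume ij: "i < j" "j < length ps"
        have "fx (ps ! i) < fx (ps ! j)" using sorted_wrt_nth_less[OF so ij] .
        moreover have "i < 4" "j < 4" "i \<noteq> j" using ij len by auto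
        ultimately show "lex_less (fst (ps ! i)) (fst (ps ! j))"
          using fx[OF mem mem, OF \<open>i < 4\<close> \<open>j < 4\<close>] ne[of i j] by blast
      qed
      moreover have "?A i j \<longleftrightarrow> lex_less (?y (ps ! i)) (?y (ps ! j))" if "i < 4" "j < 4" for i j
      proof (cases "i = j")
        case False
        show ?thesis
          unfolding pat[OF that] using fy[OF mem[OF that(1)] mem[OF that(2)]] ne[OF False that] by blast
      qed simp
      ultimately show ?thesis using len sub by (simp add: strict_lists_def P_def)
    qed blast
  qed
  moreover have fT: "finite (?T key ij)" for key ij
    by (rule finite_subset[OF _ finL]) (auto split: prod.split)
  moreover have "finite (strict_lists m n \<sigma>)"
    by (rule finite_subset[OF _ finL]) (auto simp: strict_lists_def P_def)
  ultimately have "card (pattern_lists P fx fy \<sigma>) \<le> card (strict_lists m n \<sigma> \<union> ((\<Union>ij\<in>?I. ?T ?x ij) \<union> (\<Union>ij\<in>?I. ?T ?y ij)))"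
    by (intro card_mono finite_UnI finite_UN_I) auto
  also have "\<dots> \<le> card (strict_lists m n \<sigma>) + (card (\<Union>ij\<in>?I. ?T ?x ij) + card (\<Union>ij\<in>?I. ?T ?y ij))"
    by (meson add_left_mono card_Un_le order_trans)
  also have "\<dots> \<le> card (strict_lists m n \<sigma>) + (6 * (card P ^ 3 * (4 * m * K)) + 6 * (card P ^ 3 * (4 * m * K)))"
  proof -
    have cI: "card ?I = 6" by simp
    have bound: "card (\<Union>ij\<in>?I. ?T key ij) \<le> 6 * (card P ^ 3 * (4 * m * K))"
      if D: "\<And>x. card {q \<in> P. key q = x} \<le> 4 * m * K" for key
    proof -
      have "card (\<Union>ij\<in>?I. ?T key ij) \<le> (\<Sum>ij\<in>?I. card (?T key ij))" by (rule card_UN_le) simp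
      also have "\<dots> \<le> (\<Sum>ij\<in>?I. card P ^ 3 * (4 * m * K))"
        by (rule sum_mono) (auto intro!: card_tied_lists[OF finP D])
      also have "\<dots> = 6 * (card P ^ 3 * (4 * m * K))" using cI by simp
      finally show ?thesis .
    qed
    have "card {q \<in> P. ?x q = x} \<le> 4 * m * K" for x
    proof -
      have "{q \<in> P. ?x q = x} \<subseteq> {x} \<times> ?E \<times> {..<K}"
      proof
        fix q assume "q \<in> {q \<in> P. ?x q = x}"
        then show "q \<in> {x} \<times> ?E \<times> {..<K}" using PD[of q] by (cases q) auto
      qed
      then have "card {q \<in> P. ?x q = x} \<le> card ({x} \<times> ?E \<times> {..<K})" by (intro card_mono) auto
      then show ?thesis by (simp add: card_cartesian_product)
    qed
    moreover have "card {q \<in> P. ?y q = y} \<le> 4 * m * K" for y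
    proof -
      have "{q \<in> P. ?y q = y} \<subseteq> ?E \<times> {y} \<times> {..<K}"
      proof
        fix q assume "q \<in> {q \<in> P. ?y q = y}"
        then show "q \<in> ?E \<times> {y} \<times> {..<K}" using PD[of q] by (cases q) auto
      qed
      then have "card {q \<in> P. ?y q = y} \<le> card (?E \<times> {y} \<times> {..<K})" by (intro card_mono) auto
      then show ?thesis by (simp add: card_cartesian_product)
    qed
    ultimately show ?thesis by (intro add_left_mono add_mono bound)
  qed
  finally show "card (pattern_lists P fx fy \<sigma>) \<le> card (strict_lists m n \<sigma>) + 12 * (card P ^ 3 * (4 * m * K))"
    by (simp add: ac_simps)
qed

text \<open>The limit, after division by m^4, of the number of ways to choose increasing fine
  columns in the coarse columns \<open>as\<close>.\<close>

definition tie_weight :: "nat list \<Rightarrow> real" where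
  "tie_weight as = (\<Prod>i<4. 1 / fact (count_list as i))"

text \<open>For total mass 1, this is the probability that four independent points induce
  \<open>\<sigma>\<close>, when cell \<open>(a, b)\<close> has mass \<open>w a b\<close>, spread
  uniformly. The factor 24 counts the assignments of the points to the positions.\<close>

definition step_density :: "sized_perm \<Rightarrow> (nat \<Rightarrow> nat \<Rightarrow> real) \<Rightarrow> real" where
  "step_density \<sigma> w = 24 * (\<Sum>as\<in>sorted4. \<Sum>bs\<in>sorted4. tie_weight as * tie_weight bs *
     (\<Prod>i<4. w (as ! i) (bs ! pos \<sigma> i)))"

lemma card_grid_points: "card (grid_points m n) = m * (m * (\<Sum>a<4. \<Sum>b<4. n a b))"
proof -
  have s: "(\<Sum>x\<in>{..<4}\<times>{..<m}. f (fst x)) = m * (\<Sum>a<4. f a)" for f :: "nat \<Rightarrow> nat"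
    by (simp add: sum.cartesian_product' sum_distrib_left)
  have "card (grid_points m n) = (\<Sum>x\<in>{..<4}\<times>{..<m}. \<Sum>y\<in>{..<4}\<times>{..<m}. n (fst x) (fst y))"
    unfolding grid_points_def by (subst card_SigmaI) auto
  also have "\<dots> = (\<Sum>x\<in>{..<4}\<times>{..<m}. m * (\<Sum>b<4. n (fst x) b))" by (simp only: s)
  also have "\<dots> = m * (\<Sum>a<4. m * (\<Sum>b<4. n a b))" by (rule s)
  finally show ?thesis by (simp add: sum_distrib_left)
qed

text \<open>The exponent 12 is 4 + 4 + 4, for the columns, the rows and the points inside the
  squares.\<close>

lemma strict_lists_limit:
  assumes \<sigma>: "\<sigma> \<in> point_perms 4"
    and n: "\<And>a b. a < 4 \<Longrightarrow> b < 4 \<Longrightarrow> (\<lambda>m. real (n m a b) / real m) \<longlonglongrightarrow> w a b"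
  shows "(\<lambda>m. real (card (strict_lists m (n m) \<sigma>)) / real m ^ 12) \<longlonglongrightarrow> step_density \<sigma> w / 24"
proof -
  let ?c = "\<lambda>m as. \<Prod>i<4. real (m choose count_list as i) / real m ^ count_list as i"
  have p4: "pos \<sigma> i < 4" if "i < 4" for i using pos_props(1)[OF \<sigma>] that by (auto simp: bij_betw_def)
  have nth4: "as ! i < 4" if "as \<in> sorted4" "i < 4" for as i
  proof -
    have "i < length as" "set as \<subseteq> {..<4}" using that by (simp_all add: sorted4_def)
    then show ?thesis by (meson lessThan_iff nth_mem subsetD)
  qed
  have "(\<lambda>m. real m / real m) \<longlonglongrightarrow> 1"
    by (rule tendsto_eventually, rule eventually_mono[OF eventually_gt_at_top[of 0]]) simp
  from choose_limit[OF this lim_1_over_n]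
  have c: "(\<lambda>m. ?c m as) \<longlonglongrightarrow> tie_weight as" for as
    unfolding tie_weight_def by (intro tendsto_prod) simp
  have "(\<lambda>m. \<Sum>as\<in>sorted4. \<Sum>bs\<in>sorted4. ?c m as * ?c m bs * (\<Prod>i<4. real (n m (as ! i) (bs ! pos \<sigma> i)) / real m))
    \<longlonglongrightarrow> (\<Sum>as\<in>sorted4. \<Sum>bs\<in>sorted4. tie_weight as * tie_weight bs * (\<Prod>i<4. w (as ! i) (bs ! pos \<sigma> i)))"
    by (intro tendsto_sum tendsto_mult tendsto_prod c n nth4 p4) auto
  moreover have "(\<Sum>as\<in>sorted4. \<Sum>bs\<in>sorted4. ?c m as * ?c m bs * (\<Prod>i<4. real (n m (as ! i) (bs ! pos \<sigma> i)) / real m))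
    = real (card (strict_lists m (n m) \<sigma>)) / real m ^ 12" for m
  proof -
    have c4: "?c m as = (\<Prod>i<4. real (m choose count_list as i)) / real m ^ 4" if "as \<in> sorted4" for as
    proof -
      have "(\<Sum>i<4. count_list as i) = 4" using that sum_count_set[of as "{..<4}"] by (simp add: sorted4_def)
      then show ?thesis by (simp add: prod_dividef flip: power_sum)
    qed
    have "(\<Sum>as\<in>sorted4. \<Sum>bs\<in>sorted4. ?c m as * ?c m bs * (\<Prod>i<4. real (n m (as ! i) (bs ! pos \<sigma> i)) / real m))
      = (\<Sum>as\<in>sorted4. \<Sum>bs\<in>sorted4. (\<Prod>i<4. real (m choose count_list as i)) * ((\<Prod>i<4. real (m choose count_list bs i)) *
          (\<Prod>i<4. real (n m (as ! i) (bs ! pos \<sigma> i)))) / real m ^ 12)"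
    proof (intro sum.cong refl)
      fix as bs assume ab: "as \<in> sorted4" "bs \<in> sorted4"
      show "?c m as * ?c m bs * (\<Prod>i<4. real (n m (as ! i) (bs ! pos \<sigma> i)) / real m) =
        (\<Prod>i<4. real (m choose count_list as i)) * ((\<Prod>i<4. real (m choose count_list bs i)) *
          (\<Prod>i<4. real (n m (as ! i) (bs ! pos \<sigma> i)))) / real m ^ 12"
        unfolding c4[OF ab(1)] c4[OF ab(2)]
        unfolding prod_dividef prod_constant card_lessThan times_divide_times_eq
        by (simp only: power_add[symmetric] mult.assoc numeral_plus_numeral add_num_simps)
    qed
    then show ?thesis
      unfolding card_strict_lists[OF \<sigma>] by (simp add: sum_divide_distrib sum_distrib_left)
  qed
  ultimately show ?thesis by (simp add: step_density_def)
qed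

theorem step_limit:
  assumes w: "\<And>a b. a < 4 \<Longrightarrow> b < 4 \<Longrightarrow> 0 \<le> w a b" and Z: "(\<Sum>a<4. \<Sum>b<4. w a b) = 1"
  shows "\<exists>\<pi>. growing_perms \<pi> \<and> (\<forall>\<sigma>\<in>point_perms 4. (\<lambda>m. pattern_density \<sigma> (\<pi> m)) \<longlonglongrightarrow> step_density \<sigma> w)"
proof -
  define n where "n m a b = nat \<lfloor>real m * w a b\<rfloor>" for m a b
  \<comment> \<open>\<open>K m\<close> has two roles: it bounds every \<open>n m a b\<close>, and
    \<open>m * m * K m\<close> is the number of points.\<close>
  define K where "K m = (\<Sum>a<4. \<Sum>b<4. n m a b)" for m
  define P where "P m = grid_points m (n m)" for m
  define fx where "fx m = (\<lambda>p. ((fst (fst p) * m + snd (fst p)) * (4 * m) +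
    (fst (fst (snd p)) * m + snd (fst (snd p)))) * K m + snd (snd p))" for m
  define fy where "fy m = (\<lambda>p. ((fst (fst (snd p)) * m + snd (fst (snd p))) * (4 * m) +
    (fst (fst p) * m + snd (fst p))) * K m + snd (snd p))" for m
  have K: "n m a b \<le> K m" if "a < 4" "b < 4" for m a b
  proof -
    have "n m a b \<le> (\<Sum>b<4. n m a b)" using that by (intro member_le_sum) auto
    also have "\<dots> \<le> K m" unfolding K_def using that by (intro member_le_sum[of a]) auto
    finally show ?thesis .
  qed
  have grid: "finite (P m)" "inj_on (fx m) (P m)" "inj_on (fy m) (P m)"
    "card (strict_lists m (n m) \<sigma>) \<le> card (pattern_lists (P m) (fx m) (fy m) \<sigma>)"
    "card (pattern_lists (P m) (fx m) (fy m) \<sigma>) \<le> card (strict_lists m (n m) \<sigma>) + 12 * (card (P m) ^ 3 * (4 * m * K m))"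
    if "\<sigma> \<in> point_perms 4" for m \<sigma>
    unfolding fx_def fy_def P_def by (rule card_pattern_lists_grid[OF K that]; assumption)+
  have id4: "(4, id) \<in> point_perms 4" by (simp add: point_perms_def permutes_id)
  have "\<exists>p\<in>point_perms (card (P m)). \<forall>\<sigma>. card {A. A \<subseteq> {1..psize p} \<and> card A = psize \<sigma> \<and> induces p A \<sigma>} =
      card (pattern_lists (P m) (fx m) (fy m) \<sigma>)" for m
    using exists_perm_of_points[OF grid(1)[OF id4] grid(2)[OF id4] grid(3)[OF id4]] by simp
  then have "\<forall>m. \<exists>p. p \<in> point_perms (card (P m)) \<and> (\<forall>\<sigma>. card {A. A \<subseteq> {1..psize p} \<and> card A = psize \<sigma> \<and> induces p A \<sigma>} =
      card (pattern_lists (P m) (fx m) (fy m) \<sigma>))" by blast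
  from choice[OF this] obtain \<pi> where \<pi>: "\<And>m. \<pi> m \<in> point_perms (card (P m))" and
    cnt: "\<And>m \<sigma>. card {A. A \<subseteq> {1..psize (\<pi> m)} \<and> card A = psize \<sigma> \<and> induces (\<pi> m) A \<sigma>} =
      card (pattern_lists (P m) (fx m) (fy m) \<sigma>)" by blast
  have nl: "(\<lambda>m. real (n m a b) / real m) \<longlonglongrightarrow> w a b" if "a < 4" "b < 4" for a b
    unfolding n_def using w[OF that] by (rule floor_scaled_limit)
  have "(\<lambda>m. \<Sum>a<4. \<Sum>b<4. real (n m a b) / real m) \<longlonglongrightarrow> (\<Sum>a<4. \<Sum>b<4. w a b)"
    by (intro tendsto_sum nl) auto
  then have Kl: "(\<lambda>m. real (K m) / real m) \<longlonglongrightarrow> 1"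
    by (simp add: K_def Z sum_divide_distrib)
  have pos: "\<forall>\<^sub>F m in sequentially. 0 < (m::nat)" by (rule eventually_gt_at_top)
  have Pl: "(\<lambda>m. real (card (P m)) / real m ^ 3) \<longlonglongrightarrow> 1"
    by (rule Lim_transform_eventually[OF Kl], rule eventually_mono[OF pos])
      (simp add: P_def card_grid_points K_def[symmetric] power3_eq_cube)
  have "growing_perms \<pi>" using growing_of_power[OF \<pi> Pl] by simp
  moreover have "(\<lambda>m. pattern_density \<sigma> (\<pi> m)) \<longlonglongrightarrow> step_density \<sigma> w" if \<sigma>: "\<sigma> \<in> point_perms 4" for \<sigma>
  proof -
    let ?N = "\<lambda>m. card (pattern_lists (P m) (fx m) (fy m) \<sigma>)"
    let ?S = "\<lambda>m. real (card (strict_lists m (n m) \<sigma>)) / real m ^ 12"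
    \<comment> \<open>The bound on tied lists divided by m^12, with 48 = 12 * 4; one factor
      \<open>1 / m\<close> is left over.\<close>
    let ?T = "\<lambda>m. 48 * (real (card (P m)) / real m ^ 3) ^ 3 * (real (K m) / real m) * (1 / real m)"
    have Sl: "?S \<longlonglongrightarrow> step_density \<sigma> w / 24" by (rule strict_lists_limit[OF \<sigma> nl])
    have "?T \<longlonglongrightarrow> 48 * 1 ^ 3 * 1 * 0" by (intro tendsto_intros Pl Kl lim_1_over_n)
    then have "(\<lambda>m. ?S m + ?T m) \<longlonglongrightarrow> step_density \<sigma> w / 24"
      using tendsto_add[OF Sl] by fastforce
    then have Nl: "(\<lambda>m. real (?N m) / real m ^ 12) \<longlonglongrightarrow> step_density \<sigma> w / 24"
    proof (rule tendsto_sandwich[OF _ _ Sl, rotated 2])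
      show "\<forall>\<^sub>F m in sequentially. ?S m \<le> real (?N m) / real m ^ 12"
        using grid(4)[OF \<sigma>] by (intro always_eventually allI divide_right_mono) auto
      show "\<forall>\<^sub>F m in sequentially. real (?N m) / real m ^ 12 \<le> ?S m + ?T m"
        using pos
      proof eventually_elim
        case (elim m)
        have "real (?N m) \<le> real (card (strict_lists m (n m) \<sigma>) + 12 * (card (P m) ^ 3 * (4 * m * K m)))"
          using grid(5)[OF \<sigma>, of m] by (simp only: of_nat_le_iff)
        then have "real (?N m) / real m ^ 12 \<le> real (card (strict_lists m (n m) \<sigma>) + 12 * (card (P m) ^ 3 * (4 * m * K m))) / real m ^ 12"
          by (rule divide_right_mono) simp
        also have "\<dots> = ?S m + ?T m" using elim by (simp add: field_simps eval_nat_numeral)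
        finally show ?case .
      qed
    qed
    have "(\<lambda>m. 1 / real m ^ 3) \<longlonglongrightarrow> 0"
      using tendsto_power[OF lim_1_over_n[where 'a = real], of 3] by (simp add: power_one_over)
    from choose_limit[OF Pl this, of 4]
    have "(\<lambda>m. real (card (P m) choose 4) / real m ^ 12) \<longlonglongrightarrow> 1 / 24"
      by (simp add: fact_numeral flip: power_mult)
    from tendsto_divide[OF Nl this]
    have "(\<lambda>m. (real (?N m) / real m ^ 12) / (real (card (P m) choose 4) / real m ^ 12)) \<longlonglongrightarrow> step_density \<sigma> w"
      by simp
    moreover have "\<forall>\<^sub>F m in sequentially. (real (?N m) / real m ^ 12) / (real (card (P m) choose 4) / real m ^ 12) = pattern_density \<sigma> (\<pi> m)"
      using pos
    proof eventually_elim
      case (elim m)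
      have "psize \<sigma> = 4" "psize (\<pi> m) = card (P m)" using \<sigma> \<pi>[of m] by (simp_all add: point_perms_def)
      then show ?case
        unfolding pattern_density_def cnt using n_subsets[of "{1..card (P m)}" 4] elim by simp
    qed
    ultimately show ?thesis by (rule Lim_transform_eventually)
  qed
  ultimately show ?thesis by blast
qed

section \<open>Perturbing the uniform density\<close>

text \<open>
  Inverse of the matrix with entries \<open>\<Sum> tie_weight as\<close> over the \<open>as\<close> with \<open>as ! i = p\<close>; up to a factor,
  these are the integrals of the cubic Bernstein polynomials over the four quarters of the unit interval.
\<close>

fun bernstein_dual :: "nat \<Rightarrow> nat \<Rightarrow> real" where
  "bernstein_dual a p = [[75, -69, 39, -9], [-65, 207, -141, 35], [35, -141, 207, -65], [-9, 39, -69, 75]] ! a ! p / 384"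

lemma sorted4_eq:
  "sorted4 = set (filter sorted (product_lists [[0, 1, 2, 3], [0, 1, 2, 3], [0, 1, 2, 3], [0, 1, 2, 3]]))"
proof -
  have "length as = 4 \<and> set as \<subseteq> set xs \<longleftrightarrow> as \<in> set (product_lists [xs, xs, xs, xs])" for as xs :: "nat list"
    unfolding product_lists_set mem_Collect_eq by (auto simp: numeral_eq_Suc length_Suc_conv list_all2_Cons2)
  moreover have "{..<4::nat} = set [0, 1, 2, 3]" by auto
  ultimately show ?thesis unfolding sorted4_def set_filter by blast
qed

lemma sorted4_list:
  "filter sorted (product_lists [[0, 1, 2, 3], [0, 1, 2, 3], [0, 1, 2, 3], [0, 1, 2, 3::nat]]) =
   [[0, 0, 0, 0], [0, 0, 0, 1], [0, 0, 0, 2], [0, 0, 0, 3], [0, 0, 1, 1], [0, 0, 1, 2], [0, 0, 1, 3],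
    [0, 0, 2, 2], [0, 0, 2, 3], [0, 0, 3, 3], [0, 1, 1, 1], [0, 1, 1, 2], [0, 1, 1, 3], [0, 1, 2, 2],
    [0, 1, 2, 3], [0, 1, 3, 3], [0, 2, 2, 2], [0, 2, 2, 3], [0, 2, 3, 3], [0, 3, 3, 3], [1, 1, 1, 1],
    [1, 1, 1, 2], [1, 1, 1, 3], [1, 1, 2, 2], [1, 1, 2, 3], [1, 1, 3, 3], [1, 2, 2, 2], [1, 2, 2, 3],
    [1, 2, 3, 3], [1, 3, 3, 3], [2, 2, 2, 2], [2, 2, 2, 3], [2, 2, 3, 3], [2, 3, 3, 3], [3, 3, 3, 3]]"
  by code_simp

lemma tie_weight_eq: "tie_weight as = 1 / (fact (count_list as 0) * fact (count_list as 1) * fact (count_list as 2) * fact (count_list as 3))"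
  by (simp add: tie_weight_def eval_nat_numeral)

text \<open>This is 4^4 / 4!, by the multinomial theorem.\<close>

lemma tie_weight_sum: "(\<Sum>as\<in>sorted4. tie_weight as) = 32 / 3"
  unfolding sorted4_eq sorted4_list by (simp add: tie_weight_eq fact_numeral)

lemma tie_weight_dual:
  assumes "a < 4" "i < 4"
  shows "(\<Sum>as\<in>sorted4. tie_weight as * bernstein_dual a (as ! i)) = (if a = i then 1 else 0)"
proof -
  have "a \<in> {0, 1, 2, 3}" "i \<in> {0, 1, 2, 3}" using assms by auto
  then show ?thesis
    unfolding sorted4_eq sorted4_list by (elim insertE) (simp_all add: tie_weight_eq fact_numeral)
qed

text \<open>The inverted matrix has row sums 32/3, because by symmetry all four coarse indices are
  equally frequent; so its inverse has row sums 3/32.\<close>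

lemma bernstein_dual_sum:
  assumes "a < 4"
  shows "(\<Sum>p<4. bernstein_dual a p) = 3 / 32"
proof -
  have "a \<in> {0, 1, 2, 3}" using assms by auto
  then show ?thesis by (elim insertE) (simp_all add: eval_nat_numeral)
qed

lemma step_density_uniform: "step_density \<sigma> (\<lambda>_ _. 1 / 16) = 1 / 24"
proof -
  have "step_density \<sigma> (\<lambda>_ _. 1 / 16) = 24 * ((\<Sum>as\<in>sorted4. tie_weight as) * (\<Sum>bs\<in>sorted4. tie_weight bs)) * (1 / 16) ^ 4"
    by (simp add: step_density_def sum_product sum_distrib_right sum_distrib_left ac_simps)
  then show ?thesis by (simp add: tie_weight_sum power_divide)
qed

lemma sum_swaps:
  "(\<Sum>x\<in>X. \<Sum>y\<in>Y. \<Sum>a\<in>A. F x y a) = (\<Sum>a\<in>A. \<Sum>x\<in>X. \<Sum>y\<in>Y. F x y a)"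
  "(\<Sum>x\<in>X. \<Sum>y\<in>Y. \<Sum>a\<in>A. \<Sum>b\<in>B. H x y a b) = (\<Sum>a\<in>A. \<Sum>b\<in>B. \<Sum>x\<in>X. \<Sum>y\<in>Y. H x y a b)"
  "(\<Sum>x\<in>X. \<Sum>y\<in>Y. \<Sum>k\<in>K. \<Sum>a\<in>A. \<Sum>b\<in>B. J x y k a b) = (\<Sum>k\<in>K. \<Sum>a\<in>A. \<Sum>b\<in>B. \<Sum>x\<in>X. \<Sum>y\<in>Y. J x y k a b)"
  for F :: "'x \<Rightarrow> 'y \<Rightarrow> 'a \<Rightarrow> real"
  by (simp_all only: sum.swap[of _ K Y] sum.swap[of _ A Y] sum.swap[of _ B Y] sum.swap[of _ K X] sum.swap[of _ A X] sum.swap[of _ B X])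

text \<open>The matrices \<open>f k\<close>, dual to the permutation matrices, give one perturbation
  per pattern that moves, to first order, only the density of that pattern. The density vector then
  has a multiple of the identity as derivative, and an open mapping theorem makes the independent
  control exact. The condition \<open>zero\<close> preserves the total mass.\<close>

lemma step_density_perturbation:
  fixes s :: "'k::finite \<Rightarrow> sized_perm" and f :: "'k \<Rightarrow> nat \<Rightarrow> nat \<Rightarrow> real" and k0 :: 'k
  assumes s: "\<And>k. s k \<in> point_perms 4"
    and dual: "\<And>k l. (\<Sum>i<4. f k i (pos (s l) i)) = (if k = l then 1 else 0)"
    and zero: "\<And>k. (\<Sum>i<4. \<Sum>j<4. f k i j) = 0"
  shows "\<exists>w. (\<forall>p<4. \<forall>q<4. 0 \<le> w p q) \<and> (\<Sum>p<4. \<Sum>q<4. w p q) = 1 \<and>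
    (\<forall>k. k \<noteq> k0 \<longrightarrow> step_density (s k) w = 1 / 24) \<and> step_density (s k0) w \<noteq> 1 / 24"
proof -
  \<comment> \<open>Applying the inverse matrix on both sides makes \<open>f k\<close> the matrix of
    moments of \<open>v k\<close>, and these moments are all that the derivative sees.\<close>
  define v where "v k p q = (\<Sum>a<4. \<Sum>b<4. f k a b * (bernstein_dual a p * bernstein_dual b q))" for k p q
  define D where "D t p q = (\<Sum>k\<in>UNIV. t $ k * v k p q)" for t :: "real ^ 'k" and p q
  define w where "w t p q = 1 / 16 + D t p q" for t p q
  define G where "G t = (\<chi> k. step_density (s k) (w t))" for t
  have lin: "bounded_linear (\<lambda>t. D t p q)" for p q
    unfolding D_def by (intro bounded_linear_sum bounded_linear_mult_const bounded_linear_vec_nth)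
  have D0: "D 0 p q = 0" for p q by (simp add: D_def)
  have dw: "((\<lambda>t. w t p q) has_derivative (\<lambda>h. D h p q)) (at 0)" for p q
    unfolding w_def using has_derivative_add[OF has_derivative_const bounded_linear_imp_has_derivative[OF lin]] by simp
  have cw: "continuous_on UNIV (\<lambda>t. w t p q)" for p q
    unfolding w_def by (intro continuous_intros linear_continuous_on lin)
  have p4: "pos (s l) i < 4" if "i < 4" for l i using pos_props(1)[OF s] that by (auto simp: bij_betw_def)
  have key: "(\<Sum>as\<in>sorted4. \<Sum>bs\<in>sorted4. tie_weight as * tie_weight bs * D h (as ! i) (bs ! pos (s l) i)) =
      (\<Sum>k\<in>UNIV. h $ k * f k i (pos (s l) i))" if i: "i < 4" for h l i
  proof -
    let ?r = "\<lambda>a i. \<Sum>as\<in>sorted4. tie_weight as * bernstein_dual a (as ! i)"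
    have "(\<Sum>as\<in>sorted4. \<Sum>bs\<in>sorted4. tie_weight as * tie_weight bs * D h (as ! i) (bs ! pos (s l) i)) =
      (\<Sum>as\<in>sorted4. \<Sum>bs\<in>sorted4. \<Sum>k\<in>UNIV. \<Sum>a<4. \<Sum>b<4. h $ k * f k a b *
        ((tie_weight as * bernstein_dual a (as ! i)) * (tie_weight bs * bernstein_dual b (bs ! pos (s l) i))))"
      unfolding D_def v_def sum_distrib_left by (intro sum.cong refl) (simp only: ac_simps)
    also have "\<dots> = (\<Sum>k\<in>UNIV. \<Sum>a<4. \<Sum>b<4. h $ k * f k a b * (?r a i * ?r b (pos (s l) i)))"
      unfolding sum_product unfolding sum_distrib_left by (rule sum_swaps)
    also have "\<dots> = (\<Sum>k\<in>UNIV. \<Sum>a<4. \<Sum>b<4. if a = i \<and> b = pos (s l) i then h $ k * f k a b else 0)"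
      using i p4[OF i] by (intro sum.cong refl) (simp add: tie_weight_dual del: bernstein_dual.simps)
    also have "\<dots> = (\<Sum>k\<in>UNIV. \<Sum>a<4. if a = i then h $ k * f k i (pos (s l) i) else 0)"
      using p4[OF i] by (intro sum.cong refl) (simp add: sum.delta)
    also have "\<dots> = (\<Sum>k\<in>UNIV. h $ k * f k i (pos (s l) i))" using i by (simp add: sum.delta)
    finally show ?thesis .
  qed
  \<comment> \<open>3/512 is 24 * (1/16)^3, with one factor 1/16 for each of the three unperturbed
    points.\<close>
  have dG: "((\<lambda>t. step_density (s l) (w t)) has_derivative (\<lambda>h. 3 / 512 * h $ l)) (at 0)" for l
  proof -
    have "((\<lambda>t. step_density (s l) (w t)) has_derivative (\<lambda>h. 24 * (\<Sum>as\<in>sorted4. \<Sum>bs\<in>sorted4.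
        tie_weight as * tie_weight bs * (\<Sum>i<4. D h (as ! i) (bs ! pos (s l) i) * (\<Prod>j\<in>{..<4} - {i}. w 0 (as ! j) (bs ! pos (s l) j)))))) (at 0)"
      unfolding step_density_def
      by (intro has_derivative_mult_right has_derivative_sum has_derivative_prod dw)
    moreover have "24 * (\<Sum>as\<in>sorted4. \<Sum>bs\<in>sorted4.
        tie_weight as * tie_weight bs * (\<Sum>i<4. D h (as ! i) (bs ! pos (s l) i) * (\<Prod>j\<in>{..<4} - {i}. w 0 (as ! j) (bs ! pos (s l) j)))) = 3 / 512 * h $ l" for h
    proof -
      have "(\<Sum>as\<in>sorted4. \<Sum>bs\<in>sorted4.
          tie_weight as * tie_weight bs * (\<Sum>i<4. D h (as ! i) (bs ! pos (s l) i) * (\<Prod>j\<in>{..<4} - {i}. w 0 (as ! j) (bs ! pos (s l) j))))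
        = (\<Sum>as\<in>sorted4. \<Sum>bs\<in>sorted4. \<Sum>i<4. (1 / 16) ^ 3 * (tie_weight as * tie_weight bs * D h (as ! i) (bs ! pos (s l) i)))"
        unfolding sum_distrib_left
        by (intro sum.cong refl) (simp add: w_def D0 card_Diff_singleton)
      also have "\<dots> = (1 / 16) ^ 3 * (\<Sum>i<4. \<Sum>as\<in>sorted4. \<Sum>bs\<in>sorted4. tie_weight as * tie_weight bs * D h (as ! i) (bs ! pos (s l) i))"
        unfolding sum_distrib_left by (rule sum_swaps)
      also have "\<dots> = (1 / 16) ^ 3 * (\<Sum>i<4. \<Sum>k\<in>UNIV. h $ k * f k i (pos (s l) i))"
        by (simp add: key)
      also have "\<dots> = (1 / 16) ^ 3 * (\<Sum>k\<in>UNIV. h $ k * (\<Sum>i<4. f k i (pos (s l) i)))"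
        by (subst sum.swap) (simp add: sum_distrib_left)
      also have "\<dots> = (1 / 16) ^ 3 * h $ l" by (simp add: dual if_distrib sum.delta cong: if_cong)
      finally show ?thesis by (simp add: power_divide)
    qed
    ultimately show ?thesis by simp
  qed
  have dG: "(G has_derivative (\<lambda>h. (3 / 512) *\<^sub>R h)) (at 0)"
    unfolding has_derivative_componentwise_within[of G]
    using dG by (auto simp: G_def Basis_vec_def inner_axis)
  have cG: "continuous_on UNIV G"
    unfolding G_def step_density_def by (intro continuous_intros cw)
  define T where "T = (\<Inter>p\<in>{..<4}. \<Inter>q\<in>{..<4}. {t. 0 < w t p q})"
  have "open T" unfolding T_def using cw by (intro open_INT ballI open_Collect_less) auto
  moreover have "0 \<in> T" by (simp add: T_def w_def D0)
  ultimately have "0 \<in> interior T" by (simp add: interior_open)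
  \<comment> \<open>Continuity, the derivative at the single point 0 and a right inverse of it,
    scaling by 512/3, are enough here. Restricting to \<open>T\<close> keeps all cell masses
    positive.\<close>
  then have "G 0 \<in> interior (G ` T)"
    by (intro sussmann_open_mapping[OF open_UNIV cG _ dG, of "\<lambda>h. (512 / 3) *\<^sub>R h"])
      (auto intro: bounded_linear_scaleR_right)
  then obtain e where e: "0 < e" "ball (G 0) e \<subseteq> G ` T" by (auto simp: mem_interior)
  have G0: "G 0 $ k = 1 / 24" for k
  proof -
    have "w 0 = (\<lambda>_ _. 1 / 16)" by (simp add: w_def D0 fun_eq_iff)
    then show ?thesis by (simp add: G_def step_density_uniform)
  qed
  \<comment> \<open>The target changes the density of \<open>s k0\<close> alone.\<close>
  have "G 0 + (e / 2) *\<^sub>R axis k0 1 \<in> ball (G 0) e" using e(1) by (simp add: dist_norm norm_axis_1)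
  then obtain t where t: "t \<in> T" "G t = G 0 + (e / 2) *\<^sub>R axis k0 1" using e(2) by (metis imageE subsetD)
  have Gt: "step_density (s k) (w t) = 1 / 24 + (if k = k0 then e / 2 else 0)" for k
  proof -
    have "G t $ k = 1 / 24 + (if k = k0 then e / 2 else 0)" unfolding t(2) by (simp add: G0 axis_def)
    then show ?thesis by (simp add: G_def)
  qed
  have "(\<Sum>p<4. \<Sum>q<4. v k p q) = 0" for k
  proof -
    have "(\<Sum>p<4. \<Sum>q<4. v k p q) = (\<Sum>a<4. \<Sum>b<4. f k a b * ((\<Sum>p<4. bernstein_dual a p) * (\<Sum>q<4. bernstein_dual b q)))"
      unfolding v_def sum_product unfolding sum_distrib_left by (rule sum_swaps)
    also have "\<dots> = (\<Sum>a<4. \<Sum>b<4. f k a b * (3 / 32 * (3 / 32)))"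
      by (intro sum.cong refl) (simp add: bernstein_dual_sum del: bernstein_dual.simps)
    also have "\<dots> = 0" using zero[of k] by (simp flip: sum_distrib_right sum_divide_distrib)
    finally show ?thesis .
  qed
  then have "(\<Sum>p<4. \<Sum>q<4. D t p q) = 0"
    unfolding D_def by (simp add: sum.swap[of _ "UNIV :: 'k set"] flip: sum_distrib_left)
  then have "(\<Sum>p<4. \<Sum>q<4. w t p q) = 1" by (simp add: w_def sum.distrib)
  moreover have "\<forall>p<4. \<forall>q<4. 0 \<le> w t p q" using t(1) by (force simp: T_def intro: less_imp_le)
  ultimately show ?thesis using Gt e(1) by (intro exI[of _ "w t"]) auto
qed

lemma not_forcing_if_dual:
  assumes R: "R \<subseteq> point_perms 4" "card R = 5" "\<sigma>0 \<in> R"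
    and f: "\<And>\<sigma> \<tau>. \<sigma> \<in> R \<Longrightarrow> \<tau> \<in> R \<Longrightarrow> (\<Sum>i<4. f \<sigma> i (pos \<tau> i)) = (if \<sigma> = \<tau> then 1 else (0::real))"
    and zero: "\<And>\<sigma>. \<sigma> \<in> R \<Longrightarrow> (\<Sum>i<4. \<Sum>j<4. f \<sigma> i j) = 0"
  shows "\<not> quasirandom_forcing (R - {\<sigma>0})"
proof
  assume forcing: "quasirandom_forcing (R - {\<sigma>0})"
  have "finite R" using R(2) by (metis card.infinite zero_neq_numeral)
  then obtain s :: "5 \<Rightarrow> sized_perm" where "bij_betw s UNIV R"
    using finite_same_card_bij[of "UNIV :: 5 set" R] R(2) by auto
  then have sR: "range s = R" and inj: "inj s" by (auto simp: bij_betw_def)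
  then obtain k0 where k0: "s k0 = \<sigma>0" using R(3) by auto
  have sk: "s k \<in> R" for k using sR by auto
  obtain w where w: "\<And>p q. p < 4 \<Longrightarrow> q < 4 \<Longrightarrow> 0 \<le> w p q" "(\<Sum>p<4. \<Sum>q<4. w p q) = 1"
    "\<And>k. k \<noteq> k0 \<Longrightarrow> step_density (s k) w = 1 / 24" "step_density (s k0) w \<noteq> 1 / 24"
  proof -
    have "\<exists>w. (\<forall>p<4. \<forall>q<4. 0 \<le> w p q) \<and> (\<Sum>p<4. \<Sum>q<4. w p q) = 1 \<and>
      (\<forall>k. k \<noteq> k0 \<longrightarrow> step_density (s k) w = 1 / 24) \<and> step_density (s k0) w \<noteq> 1 / 24"
    proof (rule step_density_perturbation)
      show "s k \<in> point_perms 4" for k using sk R(1) by auto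
      show "(\<Sum>i<4. f (s k) i (pos (s l) i)) = (if k = l then 1 else 0)" for k l
        using f[OF sk sk, of k l] inj by (simp add: inj_eq)
    qed (rule zero[OF sk])
    then show thesis using that by blast
  qed
  obtain \<pi> where \<pi>: "growing_perms \<pi>"
    "\<And>\<sigma>. \<sigma> \<in> point_perms 4 \<Longrightarrow> (\<lambda>m. pattern_density \<sigma> (\<pi> m)) \<longlonglongrightarrow> step_density \<sigma> w"
    using step_limit[of w] w(1,2) by blast
  have rd: "random_density_limit \<sigma> \<pi> \<longleftrightarrow> (\<lambda>m. pattern_density \<sigma> (\<pi> m)) \<longlonglongrightarrow> 1 / 24" if "\<sigma> \<in> point_perms 4" for \<sigma>
    using that by (simp add: random_density_limit_def point_perms_def fact_numeral)
  have "random_density_limit \<sigma> \<pi>" if \<sigma>: "\<sigma> \<in> R - {\<sigma>0}" for \<sigma>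
  proof -
    obtain k where k: "\<sigma> = s k" using \<sigma> sR by blast
    have "k \<noteq> k0" using \<sigma> k k0 by auto
    with k show ?thesis using \<pi>(2)[of \<sigma>] w(3)[of k] rd[of \<sigma>] \<sigma> R(1) by auto
  qed
  then have "quasirandom \<pi>" using forcing \<pi>(1) by (auto simp: quasirandom_forcing_def)
  moreover have "\<sigma>0 \<in> point_perms 4" using R by auto
  ultimately have "(\<lambda>m. pattern_density \<sigma>0 (\<pi> m)) \<longlonglongrightarrow> 1 / 24"
    using rd[of \<sigma>0] by (auto simp: quasirandom_def all_perms_def)
  then show False
    using LIMSEQ_unique[OF _ \<pi>(2)[OF \<open>\<sigma>0 \<in> point_perms 4\<close>]] w(4) k0 by auto
qed

section \<open>Linear relations between permutation matrices\<close>

text \<open>Vectors are indexed by finite types, so the indices below 4 are identified with the type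
  \<open>4\<close> by an arbitrary fixed bijection.\<close>

definition cell :: "4 \<Rightarrow> nat" where
  "cell = (SOME h. bij_betw h UNIV {..<4})"

lemma bij_cell: "bij_betw cell UNIV {..<4}"
proof -
  have "\<exists>h. bij_betw h (UNIV :: 4 set) {..<4::nat}" by (rule finite_same_card_bij) auto
  then show ?thesis unfolding cell_def by (rule someI_ex)
qed

definition cell_inv :: "nat \<Rightarrow> 4" where
  "cell_inv = inv_into UNIV cell"

lemma cell_cell_inv: "i < 4 \<Longrightarrow> cell (cell_inv i) = i" and cell_inv_cell: "cell_inv (cell a) = a"
  using bij_betw_inv_into_right[OF bij_cell, of i] bij_betw_inv_into_left[OF bij_cell, of a]
  by (simp_all add: cell_inv_def)

definition perm_vec :: "sized_perm \<Rightarrow> real ^ (4 \<times> 4)" where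
  "perm_vec \<sigma> = (\<chi> p. if pos \<sigma> (cell (fst p)) = cell (snd p) then 1 else 0)"

lemma perm_vec_nth: "i < 4 \<Longrightarrow> j < 4 \<Longrightarrow> perm_vec \<sigma> $ (cell_inv i, cell_inv j) = (if pos \<sigma> i = j then 1 else 0)"
  by (simp add: perm_vec_def cell_cell_inv)

lemma sum_cells: "(\<Sum>p\<in>UNIV. g (cell (fst p)) (cell (snd p))) = (\<Sum>i<4. \<Sum>j<4. g i j)"
  for g :: "nat \<Rightarrow> nat \<Rightarrow> real"
proof -
  have "(\<Sum>p\<in>UNIV. g (cell (fst p)) (cell (snd p))) = (\<Sum>a\<in>UNIV. \<Sum>b\<in>UNIV. g (cell a) (cell b))"
    unfolding UNIV_Times_UNIV[symmetric] sum.cartesian_product' by simp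
  also have "\<dots> = (\<Sum>a\<in>UNIV. \<Sum>j<4. g (cell a) j)"
    by (simp add: sum.reindex_bij_betw[OF bij_cell])
  also have "\<dots> = (\<Sum>i<4. \<Sum>j<4. g i j)"
    by (rule sum.reindex_bij_betw[OF bij_cell, of "\<lambda>i. \<Sum>j<4. g i j"])
  finally show ?thesis .
qed

lemma pos_less: "\<sigma> \<in> point_perms 4 \<Longrightarrow> i < 4 \<Longrightarrow> pos \<sigma> i < 4"
  using pos_props(1)[of \<sigma>] by (auto simp: bij_betw_def)

lemma inner_perm_vec:
  assumes "\<sigma> \<in> point_perms 4"
  shows "x \<bullet> perm_vec \<sigma> = (\<Sum>i<4. x $ (cell_inv i, cell_inv (pos \<sigma> i)))"
proof -
  have "x \<bullet> perm_vec \<sigma> = (\<Sum>p\<in>UNIV. x $ (cell_inv (cell (fst p)), cell_inv (cell (snd p))) *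
      (if pos \<sigma> (cell (fst p)) = cell (snd p) then 1 else 0))"
    by (simp add: inner_vec_def perm_vec_def cell_inv_cell)
  also have "\<dots> = (\<Sum>i<4. \<Sum>j<4. x $ (cell_inv i, cell_inv j) * (if pos \<sigma> i = j then 1 else 0))"
    by (rule sum_cells)
  also have "\<dots> = (\<Sum>i<4. x $ (cell_inv i, cell_inv (pos \<sigma> i)))"
    using pos_less[OF assms] by (intro sum.cong refl) (simp add: if_distrib sum.delta' cong: if_cong)
  finally show ?thesis .
qed

lemma inner_one_vec: "x \<bullet> 1 = (\<Sum>i<4. \<Sum>j<4. x $ (cell_inv i, cell_inv j))" for x :: "real ^ (4 \<times> 4)"
proof -
  have "x \<bullet> 1 = (\<Sum>p\<in>UNIV. x $ (cell_inv (cell (fst p)), cell_inv (cell (snd p))))"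
    by (simp add: inner_vec_def cell_inv_cell)
  also have "\<dots> = (\<Sum>i<4. \<Sum>j<4. x $ (cell_inv i, cell_inv j))" by (rule sum_cells)
  finally show ?thesis .
qed

lemma pos_inj:
  assumes "\<sigma> \<in> point_perms 4" "\<tau> \<in> point_perms 4" "\<And>i. i < 4 \<Longrightarrow> pos \<sigma> i = pos \<tau> i"
  shows "\<sigma> = \<tau>"
proof -
  have p: "papply \<sigma> permutes {1..4}" "papply \<tau> permutes {1..4}" "psize \<sigma> = psize \<tau>"
    using assms(1,2) by (auto simp: point_perms_def)
  have "papply \<sigma> i = papply \<tau> i" for i
  proof (cases "i \<in> {1..4}")
    case True
    then have "papply \<sigma> i \<in> {1..4}" "papply \<tau> i \<in> {1..4}" using p(1,2) by (simp_all only: permutes_in_image)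
    moreover have "pos \<sigma> (i - 1) = pos \<tau> (i - 1)" using True by (intro assms(3)) auto
    ultimately show ?thesis using True by (auto simp: pos_def)
  next
    case False
    then show ?thesis using permutes_not_in[OF p(1)] permutes_not_in[OF p(2)] by simp
  qed
  then show ?thesis using p(3) by (simp add: prod_eq_iff fun_eq_iff)
qed

lemma inj_perm_vec: "inj_on perm_vec (point_perms 4)"
proof (rule inj_onI)
  fix \<sigma> \<tau> assume a: "\<sigma> \<in> point_perms 4" "\<tau> \<in> point_perms 4" "perm_vec \<sigma> = perm_vec \<tau>"
  show "\<sigma> = \<tau>"
  proof (rule pos_inj[OF a(1,2)])
    fix i :: nat assume i: "i < 4"
    have "perm_vec \<tau> $ (cell_inv i, cell_inv (pos \<sigma> i)) = 1"
      using perm_vec_nth[OF i pos_less[OF a(1) i], of \<sigma>] a(3) by simp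
    then show "pos \<sigma> i = pos \<tau> i" using perm_vec_nth[OF i pos_less[OF a(1) i], of \<tau>] by (auto split: if_splits)
  qed
qed

lemma one_not_perm_vec: "1 \<noteq> perm_vec \<sigma>"
proof
  assume e: "1 = perm_vec \<sigma>"
  have "(1 :: real ^ (4 \<times> 4)) $ (cell_inv 0, cell_inv 0) = 1" "(1 :: real ^ (4 \<times> 4)) $ (cell_inv 0, cell_inv 1) = 1" by simp_all
  then show False unfolding e using perm_vec_nth[of 0 0 \<sigma>] perm_vec_nth[of 0 1 \<sigma>] by (simp split: if_splits)
qed

lemma independent_insert_coord:
  fixes a :: "real ^ 'n"
  assumes "independent S" "a $ p \<noteq> 0" "\<And>v. v \<in> S \<Longrightarrow> v $ p = 0"
  shows "independent (insert a S)" "a \<notin> S"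
proof -
  have "span S \<subseteq> {v. v $ p = 0}" using assms(3) by (intro span_minimal) (auto simp: subspace_def)
  then have "a \<notin> span S" using assms(2) by auto
  then show "independent (insert a S)" "a \<notin> S" using assms(1) by (auto simp: independent_insert span_base)
qed

text \<open>Each of the transpositions, exchanging \<open>a < b\<close>, has a 1 at row
  \<open>a\<close> and column \<open>b\<close>, where the matrices inserted before it have 0. Six is
  chosen because the all-ones vector and four permutation matrices span at most five
  dimensions.\<close>

lemma six_independent_perms:
  "\<exists>Q\<subseteq>point_perms 4. finite Q \<and> independent (perm_vec ` Q) \<and> card (perm_vec ` Q) = 6"
proof -
  let ?t = "\<lambda>a b. (4, Transposition.transpose a b) :: sized_perm"
  have t: "?t a b \<in> point_perms 4" if "a \<in> {1..4}" "b \<in> {1..4}" for a b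
    using permutes_swap_id[OF that] by (simp add: point_perms_def)
  note ps = perm_vec_nth pos_def Transposition.transpose_def
  let ?A1 = "{perm_vec (4, id)}"
  let ?A2 = "insert (perm_vec (?t 2 4)) ?A1"
  let ?A3 = "insert (perm_vec (?t 2 3)) ?A2"
  let ?A4 = "insert (perm_vec (?t 1 4)) ?A3"
  let ?A5 = "insert (perm_vec (?t 1 3)) ?A4"
  let ?A6 = "insert (perm_vec (?t 1 2)) ?A5"
  have "perm_vec (4, id) $ (cell_inv 0, cell_inv 0) \<noteq> 0" by (simp add: ps)
  then have "perm_vec (4, id) \<noteq> 0" by (metis zero_index)
  then have 1: "independent ?A1" by simp
  have 2: "independent ?A2" "perm_vec (?t 2 4) \<notin> ?A1"
    by (rule independent_insert_coord[OF 1, where p = "(cell_inv 1, cell_inv 3)"]; auto simp: ps)+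
  have 3: "independent ?A3" "perm_vec (?t 2 3) \<notin> ?A2"
    by (rule independent_insert_coord[OF 2(1), where p = "(cell_inv 1, cell_inv 2)"]; auto simp: ps)+
  have 4: "independent ?A4" "perm_vec (?t 1 4) \<notin> ?A3"
    by (rule independent_insert_coord[OF 3(1), where p = "(cell_inv 0, cell_inv 3)"]; auto simp: ps)+
  have 5: "independent ?A5" "perm_vec (?t 1 3) \<notin> ?A4"
    by (rule independent_insert_coord[OF 4(1), where p = "(cell_inv 0, cell_inv 2)"]; auto simp: ps)+
  have 6: "independent ?A6" "perm_vec (?t 1 2) \<notin> ?A5"
    by (rule independent_insert_coord[OF 5(1), where p = "(cell_inv 0, cell_inv 1)"]; auto simp: ps)+
  have c: "card (insert a A) = Suc (card A)" if "a \<notin> A" "finite A" for a :: "real ^ (4 \<times> 4)" and A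
    using that by simp
  have "card ?A6 = 6"
    by (subst c, rule 6(2), simp, subst c, rule 5(2), simp, subst c, rule 4(2), simp, subst c, rule 3(2), simp, subst c, rule 2(2)) simp_all
  moreover have "?A6 = perm_vec ` {?t 1 2, ?t 1 3, ?t 1 4, ?t 2 3, ?t 2 4, (4, id)}" by simp
  moreover have "{?t 1 2, ?t 1 3, ?t 1 4, ?t 2 3, ?t 2 4, (4, id)} \<subseteq> point_perms 4"
    using t by (auto simp: point_perms_def permutes_id)
  ultimately show ?thesis using 6(1)
    by (intro exI[of _ "{?t 1 2, ?t 1 3, ?t 1 4, ?t 2 3, ?t 2 4, (4, id)}"]) (simp only: finite.intros simp_thms)
qed

text \<open>Six independent permutation matrices cannot all lie in the span of five vectors, so some
  \<open>\<sigma>0\<close> extends the independent family. An independent family has dual vectors,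
  and duality with the all-ones vector included is the mass condition.\<close>

lemma not_forcing_if_independent:
  assumes S: "S \<subseteq> point_perms 4" "card S = 4" and ind: "independent (insert 1 (perm_vec ` S))"
  shows "\<not> quasirandom_forcing S"
proof -
  have finS: "finite S" using S(2) by (metis card.infinite zero_neq_numeral)
  obtain Q where Q: "Q \<subseteq> point_perms 4" "independent (perm_vec ` Q)" "card (perm_vec ` Q) = 6"
    using six_independent_perms by blast
  have "\<not> perm_vec ` Q \<subseteq> span (insert 1 (perm_vec ` S))"
  proof
    assume "perm_vec ` Q \<subseteq> span (insert 1 (perm_vec ` S))"
    then have "6 \<le> card (insert 1 (perm_vec ` S))"
      using independent_span_bound[OF _ Q(2), of "insert 1 (perm_vec ` S)"] Q(3) finS by simp
    also have "\<dots> \<le> Suc (card S)"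
      using card_insert_le_m1[of "Suc (card S)" "perm_vec ` S"] card_image_le[OF finS, of perm_vec] by simp
    finally show False using S(2) by simp
  qed
  then obtain \<sigma>0 where \<sigma>0: "\<sigma>0 \<in> point_perms 4" "perm_vec \<sigma>0 \<notin> span (insert 1 (perm_vec ` S))" using Q(1) by blast
  then have n0: "\<sigma>0 \<notin> S" by (meson image_eqI insertCI span_base)
  define R where "R = insert \<sigma>0 S"
  have R: "R \<subseteq> point_perms 4" "card R = 5" "\<sigma>0 \<in> R" using S \<sigma>0 n0 finS by (auto simp: R_def)
  let ?A = "insert 1 (perm_vec ` R)"
  have "?A = insert (perm_vec \<sigma>0) (insert 1 (perm_vec ` S))" by (auto simp: R_def)
  then have indA: "independent ?A" using ind \<sigma>0(2) by (simp add: independent_insert)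
  have "\<exists>x. (\<forall>\<tau>\<in>R. x \<bullet> perm_vec \<tau> = (if \<sigma> = \<tau> then 1 else 0)) \<and> x \<bullet> 1 = 0" if \<sigma>: "\<sigma> \<in> R" for \<sigma>
  proof -
    \<comment> \<open>Some nonzero \<open>x\<close> in \<open>span ?A\<close> is orthogonal to the
      smaller \<open>span ?B\<close>. It is not orthogonal to \<open>perm_vec \<sigma>\<close>, as
      it would then be orthogonal to itself; rescaling gives the dual vector.\<close>
    let ?B = "?A - {perm_vec \<sigma>}"
    have "perm_vec \<sigma> \<in> span ?A" "perm_vec \<sigma> \<notin> span ?B"
      using indA \<sigma> by (auto simp: dependent_def span_base)
    then have "span ?B \<subset> span ?A" using span_mono[of ?B ?A] by blast
    then obtain x where x: "x \<noteq> 0" "x \<in> span ?A" "\<And>y. y \<in> span ?B \<Longrightarrow> orthogonal x y"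
      by (rule orthogonal_to_subspace_exists_gen) (rule that)
    have B: "x \<bullet> y = 0" if "y \<in> ?B" for y using x(3)[OF span_base[OF that]] by (simp add: orthogonal_def)
    have nz: "x \<bullet> perm_vec \<sigma> \<noteq> 0"
    proof
      assume "x \<bullet> perm_vec \<sigma> = 0"
      then have "orthogonal x y" if "y \<in> ?A" for y using B[of y] that by (cases "y = perm_vec \<sigma>") (auto simp: orthogonal_def)
      then have "orthogonal x x" using x(2) by (rule orthogonal_to_span[rotated])
      then show False using x(1) by (simp add: orthogonal_self)
    qed
    have "x \<bullet> perm_vec \<tau> = 0" if "\<tau> \<in> R" "\<tau> \<noteq> \<sigma>" for \<tau>
      using that \<sigma> R(1) inj_onD[OF inj_perm_vec, of \<tau> \<sigma>] by (intro B) auto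
    moreover have "x \<bullet> 1 = 0" using one_not_perm_vec[of \<sigma>] by (intro B) auto
    ultimately show ?thesis using nz
      by (intro exI[of _ "(1 / (x \<bullet> perm_vec \<sigma>)) *\<^sub>R x"]) auto
  qed
  then have "\<exists>x. \<forall>\<sigma>\<in>R. (\<forall>\<tau>\<in>R. x \<sigma> \<bullet> perm_vec \<tau> = (if \<sigma> = \<tau> then 1 else 0)) \<and> x \<sigma> \<bullet> 1 = 0"
    by (intro bchoice) blast
  then obtain x where x: "\<And>\<sigma> \<tau>. \<sigma> \<in> R \<Longrightarrow> \<tau> \<in> R \<Longrightarrow> x \<sigma> \<bullet> perm_vec \<tau> = (if \<sigma> = \<tau> then 1 else 0)"
    "\<And>\<sigma>. \<sigma> \<in> R \<Longrightarrow> x \<sigma> \<bullet> 1 = 0" by blast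
  have "\<not> quasirandom_forcing (R - {\<sigma>0})"
  proof (rule not_forcing_if_dual[OF R])
    show "(\<Sum>i<4. x \<sigma> $ (cell_inv i, cell_inv (pos \<tau> i))) = (if \<sigma> = \<tau> then 1 else 0)" if "\<sigma> \<in> R" "\<tau> \<in> R" for \<sigma> \<tau>
      using x(1)[OF that] inner_perm_vec[of \<tau> "x \<sigma>"] that R(1) by auto
    show "(\<Sum>i<4. \<Sum>j<4. x \<sigma> $ (cell_inv i, cell_inv j)) = 0" if "\<sigma> \<in> R" for \<sigma>
      using x(2)[OF that] by (simp add: inner_one_vec)
  qed
  moreover have "R - {\<sigma>0} = S" using n0 by (auto simp: R_def)
  ultimately show ?thesis by simp
qed

text \<open>The linear relation is read entry by entry; \<open>d\<close> is the negative of the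
  coefficient of the all-ones matrix.\<close>

lemma relation_if_dependent:
  assumes S: "S \<subseteq> point_perms 4" "finite S" and dep: "dependent (insert 1 (perm_vec ` S))"
  shows "\<exists>c d. (d \<noteq> 0 \<or> (\<exists>\<sigma>\<in>S. c \<sigma> \<noteq> 0)) \<and>
    (\<forall>i<4. \<forall>j<4. (\<Sum>\<sigma>\<in>S. if pos \<sigma> i = j then c \<sigma> else 0) = (d::real))"
proof -
  obtain u where u: "\<exists>v\<in>insert 1 (perm_vec ` S). u v \<noteq> 0" "(\<Sum>v\<in>insert 1 (perm_vec ` S). u v *\<^sub>R v) = 0"
    using dep S(2) by (auto simp: dependent_finite)
  have "inj_on perm_vec S" using inj_perm_vec S(1) by (rule inj_on_subset)
  then have z: "u 1 *\<^sub>R 1 + (\<Sum>\<sigma>\<in>S. u (perm_vec \<sigma>) *\<^sub>R perm_vec \<sigma>) = 0"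
    using u(2) S(2) one_not_perm_vec by (subst (asm) sum.insert) (auto simp: sum.reindex)
  have "(\<Sum>\<sigma>\<in>S. if pos \<sigma> i = j then u (perm_vec \<sigma>) else 0) = - u 1" if "i < 4" "j < 4" for i j
  proof -
    have "(u 1 *\<^sub>R 1 + (\<Sum>\<sigma>\<in>S. u (perm_vec \<sigma>) *\<^sub>R perm_vec \<sigma>)) $ (cell_inv i, cell_inv j) = 0" using z by simp
    then have "u 1 + (\<Sum>\<sigma>\<in>S. u (perm_vec \<sigma>) * (if pos \<sigma> i = j then 1 else 0)) = 0"
      by (simp add: sum_component perm_vec_nth[OF that])
    moreover have "(\<Sum>\<sigma>\<in>S. u (perm_vec \<sigma>) * (if pos \<sigma> i = j then 1 else 0)) = (\<Sum>\<sigma>\<in>S. if pos \<sigma> i = j then u (perm_vec \<sigma>) else 0)"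
      by (intro sum.cong) auto
    ultimately show ?thesis by simp
  qed
  moreover have "- u 1 \<noteq> 0 \<or> (\<exists>\<sigma>\<in>S. u (perm_vec \<sigma>) \<noteq> 0)" using u(1) by auto
  ultimately show ?thesis by (intro exI[of _ "\<lambda>\<sigma>. u (perm_vec \<sigma>)"] exI[of _ "- u 1"]) auto
qed

text \<open>In a row where two of the functions differ, one of those two takes a value that neither
  other function takes, so its coefficient is 0. A row where the two remaining functions differ then
  removes their coefficients as well.\<close>

lemma three_coefficients_vanish:
  fixes ca cb cc :: real and a b c :: "nat \<Rightarrow> nat"
  assumes E: "\<And>i j. i < n \<Longrightarrow> (if a i = j then ca else 0) + (if b i = j then cb else 0) + (if c i = j then cc else 0) = 0"
    and "\<exists>i<n. a i \<noteq> b i" "\<exists>i<n. a i \<noteq> c i" "\<exists>i<n. b i \<noteq> c i"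
  shows "ca = 0 \<and> cb = 0 \<and> cc = 0"
proof -
  obtain i k l where "i < n" "k < n" "l < n" "a i \<noteq> b i" "a k \<noteq> c k" "b l \<noteq> c l" using assms(2-4) by blast
  then show ?thesis
    using E[of i "a i"] E[of i "b i"] E[of i "c i"] E[of k "a k"] E[of k "c k"] E[of l "b l"] E[of l "c l"]
    by (auto split: if_splits)
qed

text \<open>With nonzero coefficients no value occurs exactly once, so the four values fall into two
  equal pairs; if the pairs have different values, the coefficients cancel within each pair.\<close>

lemma pairing:
  fixes ca cb cc cd :: real
  assumes E: "\<And>j::nat. (if a = j then ca else 0) + (if b = j then cb else 0) + (if c = j then cc else 0) + (if d = j then cd else 0) = 0"
    and "ca \<noteq> 0" "cb \<noteq> 0" "cc \<noteq> 0" "cd \<noteq> 0"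
  shows "(a = b \<and> c = d \<and> (a = c \<or> ca + cb = 0)) \<or> (a = c \<and> b = d \<and> (a = b \<or> ca + cc = 0 \<and> cb + cd = 0)) \<or>
    (a = d \<and> b = c \<and> (a = b \<or> cb + cc = 0))"
  using E[of a] E[of b] E[of c] E[of d] assms(2-) by (auto split: if_splits)

text \<open>If \<open>d\<close> is nonzero, every cell is hit by some member of \<open>S\<close>;
  four permutations hitting all four values in each row form a Latin square. If
  \<open>d = 0\<close>, all coefficients are nonzero, each row pairs the four permutations by equal
  values, and it remains to see that one of the three pairings can be avoided in all rows: the two
  permutations it would pair form one side of
  \<open>P\<^sub>x + P\<^sub>y = P\<^sub>u + P\<^sub>v\<close>.\<close>

lemma relation_cases:
  assumes S: "S \<subseteq> point_perms 4" "card S = 4" and nz: "d \<noteq> 0 \<or> (\<exists>\<sigma>\<in>S. c \<sigma> \<noteq> 0)"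
    and rel: "\<And>i j. i < 4 \<Longrightarrow> j < 4 \<Longrightarrow> (\<Sum>\<sigma>\<in>S. if pos \<sigma> i = j then c \<sigma> else 0) = (d::real)"
  shows "(\<forall>\<sigma>\<in>S. \<forall>\<tau>\<in>S. \<sigma> \<noteq> \<tau> \<longrightarrow> (\<forall>i<4. pos \<sigma> i \<noteq> pos \<tau> i)) \<or>
    (\<exists>x y u v. S = {x, y, u, v} \<and> distinct [x, y, u, v] \<and>
      (\<forall>i<4. pos x i = pos u i \<and> pos y i = pos v i \<or> pos x i = pos v i \<and> pos y i = pos u i))"
proof (cases "d = 0")
  case False
  have finS: "finite S" using S(2) by (metis card.infinite zero_neq_numeral)
  have "inj_on (\<lambda>\<sigma>. pos \<sigma> i) S" if i: "i < 4" for i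
  proof (rule eq_card_imp_inj_on[OF finS])
    have "{..<4} \<subseteq> (\<lambda>\<sigma>. pos \<sigma> i) ` S"
    proof (rule subsetI, rule ccontr)
      fix j :: nat assume "j \<in> {..<4}" "j \<notin> (\<lambda>\<sigma>. pos \<sigma> i) ` S"
      then have "(\<Sum>\<sigma>\<in>S. if pos \<sigma> i = j then c \<sigma> else 0) = 0" by (intro sum.neutral) auto
      then show False using rel[OF i, of j] \<open>j \<in> {..<4}\<close> False by simp
    qed
    from card_mono[OF _ this] have "4 \<le> card ((\<lambda>\<sigma>. pos \<sigma> i) ` S)" using finS by simp
    then show "card ((\<lambda>\<sigma>. pos \<sigma> i) ` S) = card S" using card_image_le[OF finS, of "\<lambda>\<sigma>. pos \<sigma> i"] S(2) by simp
  qed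
  then show ?thesis by (auto dest: inj_onD)
next
  case True
  obtain w x y z where Sw: "S = {w, x, y, z}" and dis: "w \<noteq> x" "w \<noteq> y" "w \<noteq> z" "x \<noteq> y" "x \<noteq> z" "y \<noteq> z"
  proof -
    have "card S = Suc 3" using S(2) by simp
    then obtain w A where "S = insert w A" "w \<notin> A" "card A = 3" by (metis card_Suc_eq)
    moreover from \<open>card A = 3\<close> obtain x y z where "A = {x, y, z}" "x \<noteq> y" "y \<noteq> z" "x \<noteq> z" by (metis card_3_iff)
    ultimately show thesis using that[of w x y z] by auto
  qed
  have E: "(if pos w i = j then c w else 0) + (if pos x i = j then c x else 0) + (if pos y i = j then c y else 0) +
      (if pos z i = j then c z else 0) = 0" if i: "i < 4" for i j
  proof (cases "j < 4")
    case True
    show ?thesis using rel[OF i True] dis \<open>d = 0\<close> by (simp add: Sw add.assoc)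
  next
    case False
    have "pos w i < 4" "pos x i < 4" "pos y i < 4" "pos z i < 4"
      using S(1) i by (auto simp: Sw intro: pos_less)
    then show ?thesis using False by auto
  qed
  have df: "\<exists>i<4. pos \<sigma> i \<noteq> pos \<tau> i" if "\<sigma> \<in> S" "\<tau> \<in> S" "\<sigma> \<noteq> \<tau>" for \<sigma> \<tau>
    using pos_inj[of \<sigma> \<tau>] that S(1) by blast
  have "c w \<noteq> 0" "c x \<noteq> 0" "c y \<noteq> 0" "c z \<noteq> 0"
  proof -
    have nz': "\<not> (c w = 0 \<and> c x = 0 \<and> c y = 0 \<and> c z = 0)" using nz True Sw by auto
    show "c w \<noteq> 0"
    proof
      assume z: "c w = 0"
      have "c x = 0 \<and> c y = 0 \<and> c z = 0"
      proof (rule three_coefficients_vanish[of 4 "pos x" _ "pos y" _ "pos z"])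
        show "(if pos x i = j then c x else 0) + (if pos y i = j then c y else 0) + (if pos z i = j then c z else 0) = 0" if "i < 4" for i j
          using E[OF that, of j] by (simp only: z if_cancel add_0_left add_0_right)
      qed (rule df; simp add: Sw dis)+
      with z nz' show False by simp
    qed
    show "c x \<noteq> 0"
    proof
      assume z: "c x = 0"
      have "c w = 0 \<and> c y = 0 \<and> c z = 0"
      proof (rule three_coefficients_vanish[of 4 "pos w" _ "pos y" _ "pos z"])
        show "(if pos w i = j then c w else 0) + (if pos y i = j then c y else 0) + (if pos z i = j then c z else 0) = 0" if "i < 4" for i j
          using E[OF that, of j] by (simp only: z if_cancel add_0_left add_0_right)
      qed (rule df; simp add: Sw dis)+
      with z nz' show False by simp
    qed
    show "c y \<noteq> 0"
    proof
      assume z: "c y = 0"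
      have "c w = 0 \<and> c x = 0 \<and> c z = 0"
      proof (rule three_coefficients_vanish[of 4 "pos w" _ "pos x" _ "pos z"])
        show "(if pos w i = j then c w else 0) + (if pos x i = j then c x else 0) + (if pos z i = j then c z else 0) = 0" if "i < 4" for i j
          using E[OF that, of j] by (simp only: z if_cancel add_0_left add_0_right)
      qed (rule df; simp add: Sw dis)+
      with z nz' show False by simp
    qed
    show "c z \<noteq> 0"
    proof
      assume z: "c z = 0"
      have "c w = 0 \<and> c x = 0 \<and> c y = 0"
      proof (rule three_coefficients_vanish[of 4 "pos w" _ "pos x" _ "pos y"])
        show "(if pos w i = j then c w else 0) + (if pos x i = j then c x else 0) + (if pos y i = j then c y else 0) = 0" if "i < 4" for i j
          using E[OF that, of j] by (simp only: z if_cancel add_0_left add_0_right)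
      qed (rule df; simp add: Sw dis)+
      with z nz' show False by simp
    qed
  qed
  note nz4 = this
  note pr = pairing[OF E nz4]
  \<comment> \<open>If each pairing occurred in a row with two different values, then
    \<open>c w + c x\<close>, \<open>c w + c y\<close> and \<open>c x + c y\<close> would all
    vanish, and so would the coefficients. Rows where all four agree fit every pairing.\<close>
  have "\<not> ((\<exists>i<4. pos w i = pos x i \<and> pos w i \<noteq> pos y i \<and> pos w i \<noteq> pos z i) \<and>
      (\<exists>i<4. pos w i = pos y i \<and> pos w i \<noteq> pos x i \<and> pos w i \<noteq> pos z i) \<and>
      (\<exists>i<4. pos w i = pos z i \<and> pos w i \<noteq> pos x i \<and> pos w i \<noteq> pos y i))"
  proof (rule notI, elim conjE exE)
    fix i k l assume i: "i < 4" "pos w i = pos x i" "pos w i \<noteq> pos y i" "pos w i \<noteq> pos z i"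
      and k: "k < 4" "pos w k = pos y k" "pos w k \<noteq> pos x k" "pos w k \<noteq> pos z k"
      and l: "l < 4" "pos w l = pos z l" "pos w l \<noteq> pos x l" "pos w l \<noteq> pos y l"
    have "c w + c x = 0" using pr[OF i(1)] i by auto
    moreover have "c w + c y = 0" using pr[OF k(1)] k by auto
    moreover have "c x + c y = 0" using pr[OF l(1)] l by auto
    ultimately show False using nz4 by simp
  qed
  then consider "\<forall>i<4. \<not> (pos w i = pos x i \<and> pos w i \<noteq> pos y i \<and> pos w i \<noteq> pos z i)"
    | "\<forall>i<4. \<not> (pos w i = pos y i \<and> pos w i \<noteq> pos x i \<and> pos w i \<noteq> pos z i)"
    | "\<forall>i<4. \<not> (pos w i = pos z i \<and> pos w i \<noteq> pos x i \<and> pos w i \<noteq> pos y i)" by blast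
  then show ?thesis
  proof cases
    case 1
    have "\<forall>i<4. pos w i = pos y i \<and> pos x i = pos z i \<or> pos w i = pos z i \<and> pos x i = pos y i"
    proof (intro allI impI)
      fix i :: nat assume i: "i < 4"
      show "pos w i = pos y i \<and> pos x i = pos z i \<or> pos w i = pos z i \<and> pos x i = pos y i"
        using pr[OF i] 1[rule_format, OF i] by auto
    qed
    then show ?thesis using dis by (intro disjI2 exI[of _ w] exI[of _ x] exI[of _ y] exI[of _ z]) (auto simp: Sw)
  next
    case 2
    have "\<forall>i<4. pos w i = pos x i \<and> pos y i = pos z i \<or> pos w i = pos z i \<and> pos y i = pos x i"
    proof (intro allI impI)
      fix i :: nat assume i: "i < 4"
      show "pos w i = pos x i \<and> pos y i = pos z i \<or> pos w i = pos z i \<and> pos y i = pos x i"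
        using pr[OF i] 2[rule_format, OF i] by auto
    qed
    then show ?thesis using dis by (intro disjI2 exI[of _ w] exI[of _ y] exI[of _ x] exI[of _ z]) (auto simp: Sw)
  next
    case 3
    have "\<forall>i<4. pos w i = pos x i \<and> pos z i = pos y i \<or> pos w i = pos y i \<and> pos z i = pos x i"
    proof (intro allI impI)
      fix i :: nat assume i: "i < 4"
      show "pos w i = pos x i \<and> pos z i = pos y i \<or> pos w i = pos y i \<and> pos z i = pos x i"
        using pr[OF i] 3[rule_format, OF i] by auto
    qed
    then show ?thesis using dis by (intro disjI2 exI[of _ w] exI[of _ z] exI[of _ x] exI[of _ y]) (auto simp: Sw)
  qed
qed

section \<open>The exceptional sets\<close>

text \<open>
  The components are the inflated permutation, the directions of the monotone blocks (\<open>True\<close> for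
  increasing), then \<open>C\<close>, \<open>B\<close>, \<open>L\<close> as above, the four patterns, and the pattern whose density drops
  below \<open>1/24\<close>. All checks are first-order recursive functions, which keeps their evaluation by the
  simplifier feasible.
\<close>

type_synonym certificate = "nat list \<times> bool list \<times> int list \<times> int list list \<times> int \<times> nat list list \<times> nat list"

section \<open>Executable form of the certificate conditions\<close>

fun add_abs :: "int list \<Rightarrow> int list \<Rightarrow> int list" where
  "add_abs (x # xs) (y # ys) = (x + \<bar>y\<bar>) # add_abs xs ys"
| "add_abs _ _ = []"

fun all_less :: "int list \<Rightarrow> int list \<Rightarrow> bool" where
  "all_less (x # xs) (y # ys) \<longleftrightarrow> x < y \<and> all_less xs ys"
| "all_less _ _ \<longleftrightarrow> True"

fun qev_int :: "(int \<times> nat \<times> nat \<times> nat \<times> nat) list \<Rightarrow> int list \<Rightarrow> int" where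
  "qev_int [] R = 0"
| "qev_int ((q, a, b, c, d) # ms) R = q * (R ! a) * (R ! b) * (R ! c) * (R ! d) + qev_int ms R"

fun qdir_int :: "(int \<times> nat \<times> nat \<times> nat \<times> nat) list \<Rightarrow> int list \<Rightarrow> int list \<Rightarrow> int" where
  "qdir_int [] R V = 0"
| "qdir_int ((q, a, b, c, d) # ms) R V = q * ((V ! a) * (R ! b) * (R ! c) * (R ! d) + (R ! a) * (V ! b) * (R ! c) * (R ! d)
     + (R ! a) * (R ! b) * (V ! c) * (R ! d) + (R ! a) * (R ! b) * (R ! c) * (V ! d)) + qdir_int ms R V"

text \<open>\<open>certified_pattern\<close> unrolled for four directions: \<open>r\<close> is the
  list of deviations, \<open>D\<close> the upper corner \<open>C + r\<close>, and \<open>l0\<close>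
  to \<open>l3\<close> form a row of \<open>L\<close> times the identity. The lists are passed in
  already computed.\<close>

definition pattern_check :: "(int \<times> nat \<times> nat \<times> nat \<times> nat) list \<Rightarrow> int list \<Rightarrow> int list \<Rightarrow> int list \<Rightarrow>
    int list \<Rightarrow> int list \<Rightarrow> int list \<Rightarrow> int list \<Rightarrow> int \<Rightarrow> int \<Rightarrow> int \<Rightarrow> int \<Rightarrow> int \<Rightarrow> int \<Rightarrow> bool" where
  "pattern_check ms C D r b0 b1 b2 b3 l0 l1 l2 l3 L Q \<longleftrightarrow>
     \<bar>24 * qev_int ms C - Q ^ 4\<bar> + (\<bar>24 * qdir_int ms C b0 - l0\<bar> + \<bar>24 * qdir_int ms C b1 - l1\<bar> +
       \<bar>24 * qdir_int ms C b2 - l2\<bar> + \<bar>24 * qdir_int ms C b3 - l3\<bar>)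
     + 24 * (qev_int ms D - qev_int ms C - qdir_int ms C r) \<le> L"

definition patterns_check :: "nat \<Rightarrow> nat list \<Rightarrow> bool list \<Rightarrow> int list \<Rightarrow> int list \<Rightarrow> int list \<Rightarrow> int list \<Rightarrow> int list \<Rightarrow> int list \<Rightarrow>
    int list \<Rightarrow> int \<Rightarrow> int \<Rightarrow> nat list \<Rightarrow> nat list \<Rightarrow> nat list \<Rightarrow> nat list \<Rightarrow> nat list \<Rightarrow> bool" where
  "patterns_check k t f C D r b0 b1 b2 b3 L Q s0 s1 s2 s3 s' \<longleftrightarrow>
     pattern_check (block_monomials k t f s0) C D r b0 b1 b2 b3 L 0 0 0 L Q \<and>
     pattern_check (block_monomials k t f s1) C D r b0 b1 b2 b3 0 L 0 0 L Q \<and>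
     pattern_check (block_monomials k t f s2) C D r b0 b1 b2 b3 0 0 L 0 L Q \<and>
     pattern_check (block_monomials k t f s3) C D r b0 b1 b2 b3 0 0 0 L L Q \<and>
     24 * qev_int (block_monomials k t f s') D < Q ^ 4 \<and> all_less r C"

fun certificate_check :: "certificate \<Rightarrow> bool" where
  "certificate_check (t, f, C, [b0, b1, b2, b3], L, [s0, s1, s2, s3], s') \<longleftrightarrow>
     0 < length t \<and> distinct t \<and> length C = length t \<and> 0 < L \<and>
     length b0 = length t \<and> length b1 = length t \<and> length b2 = length t \<and> length b3 = length t \<and>
     sum_list b0 = 0 \<and> sum_list b1 = 0 \<and> sum_list b2 = 0 \<and> sum_list b3 = 0 \<and>
     patterns_check (length t) t f C (add_abs (add_abs (add_abs (add_abs C b0) b1) b2) b3)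
       (add_abs (add_abs (add_abs (add_abs (replicate (length t) 0) b0) b1) b2) b3) b0 b1 b2 b3 L (sum_list C) s0 s1 s2 s3 s'"
| "certificate_check _ \<longleftrightarrow> False"

fun certificates_check :: "certificate list \<Rightarrow> bool" where
  "certificates_check [] \<longleftrightarrow> True"
| "certificates_check (c # cs) \<longleftrightarrow> certificate_check c \<and> certificates_check cs"

lemma qev_int_eq: "qev ms ((!) R) = qev_int ms R"
  by (induction ms R rule: qev_int.induct) (simp_all add: qev_def)

lemma qdir_int_eq: "qdir ms ((!) R) ((!) V) = qdir_int ms R V"
  by (induction ms R V rule: qdir_int.induct) (simp_all add: qdir_def)

lemma add_abs_length_nth:
  assumes "length xs = length ys"
  shows "length (add_abs xs ys) = length xs"
    and "l < length xs \<Longrightarrow> add_abs xs ys ! l = xs ! l + \<bar>ys ! l\<bar>"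
proof -
  show "length (add_abs xs ys) = length xs" using assms by (induction xs ys rule: list_induct2) simp_all
  show "add_abs xs ys ! l = xs ! l + \<bar>ys ! l\<bar>" if "l < length xs"
    using assms that by (induction xs ys arbitrary: l rule: list_induct2) (auto simp: nth_Cons split: nat.split)
qed

lemma all_less_nth:
  assumes "length xs = length ys" "all_less xs ys" "l < length xs"
  shows "xs ! l < ys ! l"
  using assms by (induction xs ys arbitrary: l rule: list_induct2) (auto simp: nth_Cons split: nat.split)

lemma certificate_check_certified:
  assumes "certificate_check (t, f, C, B, L, ss, s')"
  shows "certified t f C B L ss s'"
proof -
  obtain b0 b1 b2 b3 s0 s1 s2 s3 where B: "B = [b0, b1, b2, b3]" and ss: "ss = [s0, s1, s2, s3]"
    using assms by (cases "(t, f, C, B, L, ss, s')" rule: certificate_check.cases) auto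
  let ?k = "length t"
  define D where "D = add_abs (add_abs (add_abs (add_abs C b0) b1) b2) b3"
  define r where "r = add_abs (add_abs (add_abs (add_abs (replicate ?k 0) b0) b1) b2) b3"
  note chk = assms[unfolded B ss certificate_check.simps, folded D_def r_def]
  have len: "length C = ?k" "length b0 = ?k" "length b1 = ?k" "length b2 = ?k" "length b3 = ?k"
    using chk by blast+
  have dev: "deviation B C l = \<bar>b0 ! l\<bar> + \<bar>b1 ! l\<bar> + \<bar>b2 ! l\<bar> + \<bar>b3 ! l\<bar>" for l
    by (simp add: deviation_def B)
  have D: "D ! l = C ! l + deviation B C l" if "l < ?k" for l
    unfolding D_def dev using that len by (simp add: add_abs_length_nth)
  have r: "r ! l = deviation B C l" if "l < ?k" for l
    unfolding r_def dev using that len by (simp add: add_abs_length_nth)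
  have lr: "length r = ?k" unfolding r_def using len by (simp add: add_abs_length_nth)
  let ?m = "block_monomials ?k t f"
  have qD: "qev (?m s) (\<lambda>l. C ! l + deviation B C l) = qev_int (?m s) D" for s
    unfolding qev_int_eq[symmetric] by (rule block_monomials_cong) (simp add: D)
  have qr: "qdir (?m s) ((!) C) (deviation B C) = qdir_int (?m s) C r" for s
    unfolding qdir_int_eq[symmetric] by (rule block_monomials_cong) (simp_all add: r)
  have pc: "patterns_check ?k t f C D r b0 b1 b2 b3 L (sum_list C) s0 s1 s2 s3 s'"
    using chk by blast
  have u4: "[0..<4] = [0, 1, 2, 3::nat]" by (simp add: upt_conv_Cons)
  have "certified_pattern (?m (ss ! j)) C B L j" if "j \<in> {0, 1, 2, 3}" for j
    unfolding certified_pattern_def qD qr qev_int_eq qdir_int_eq u4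
    using that pc unfolding B ss patterns_check_def pattern_check_def by auto
  then have "list_all (\<lambda>j. certified_pattern (?m (ss ! j)) C B L j) [0..<4]"
    unfolding u4 by simp
  moreover have "list_all (\<lambda>l. deviation B C l < C ! l) [0..<?k]"
    using pc all_less_nth[of r C] r lr len unfolding patterns_check_def by (auto simp: list_all_iff)
  moreover have "24 * qev (?m s') (\<lambda>l. C ! l + deviation B C l) < sum_list C ^ 4"
    unfolding qD using pc unfolding patterns_check_def by blast
  moreover have "list_all (\<lambda>b. length b = ?k \<and> sum_list b = 0) B"
    using chk unfolding B by simp
  moreover have "length ss = 4" "length B = 4" by (simp_all add: ss B)
  moreover have "t \<noteq> []" "distinct t" "0 < L" using chk by blast+
  ultimately show ?thesis unfolding certified_def using len by blast
qed

text \<open>\<open>C\<close> is an approximate solution and \<open>B\<close> an approximate inverse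
  derivative, rounded to integers; how they were found is immaterial to the check. Many entries are
  images of one another under reversal, complement or inversion (up to the last component); listing
  them all avoids proving that densities respect these symmetries.\<close>

definition small_certs :: "certificate list" where
  "small_certs =
  [([2, 4, 0, 1, 3], [False, False, False, True, False],
    [47, 191, 161, 140, 161],
    [[1, -1, -1, 2, -1], [-2, 0, 0, -1, 3], [-1, -1, 3, -1, 0], [2, -2, 0, 0, 0]], 6265880615,
    [[1, 2, 3, 4], [1, 2, 4, 3], [2, 1, 3, 4], [2, 1, 4, 3]], [1, 3, 2, 4]),
   ([2, 0, 4, 3, 1], [True, True, True, False, True],
    [47, 191, 161, 140, 161],
    [[2, -2, 0, 0, 0], [-1, -1, 3, -1, 0], [-2, 0, 0, -1, 3], [1, -1, -1, 2, -1]], 6265880615,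
    [[3, 4, 1, 2], [3, 4, 2, 1], [4, 3, 1, 2], [4, 3, 2, 1]], [1, 3, 2, 4]),
   ([5, 0, 2, 4, 1, 3], [True, False, False, True, True, False],
    [182, 146, 224, 223, 79, 146],
    [[0, -1, 1, 2, -2, 0], [-2, 1, 1, -1, 3, -2], [-1, -1, 0, 0, 3, -1], [0, -3, 2, 1, -2, 2]], 16298305228,
    [[1, 2, 3, 4], [1, 3, 2, 4], [4, 2, 3, 1], [4, 3, 2, 1]], [2, 3, 1, 4]),
   ([4, 0, 2, 3, 1], [False, False, False, True, True],
    [45, 27, 107, 65, 56],
    [[-1, 1, -1, 2, -1], [-2, 2, 0, -1, 1], [-1, -2, 4, 0, -1], [-1, -1, 0, 0, 2]], 699694798,
    [[1, 2, 3, 4], [1, 4, 3, 2], [3, 2, 1, 4], [3, 4, 1, 2]], [1, 2, 4, 3]),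
   ([0, 4, 2, 1, 3], [True, True, True, False, False],
    [45, 27, 107, 65, 56],
    [[-1, -1, 0, 0, 2], [-1, -2, 4, 0, -1], [-2, 2, 0, -1, 1], [-1, 1, -1, 2, -1]], 699694798,
    [[2, 1, 4, 3], [2, 3, 4, 1], [4, 1, 2, 3], [4, 3, 2, 1]], [2, 1, 3, 4]),
   ([1, 4, 0, 3, 2], [True, False, False, True, False],
    [73, 105, 38, 134, 150],
    [[1, -1, 0, 2, -2], [0, -1, 1, 0, 0], [-2, -2, 0, 3, 1], [-2, 1, 1, 2, -2]], 3560857618,
    [[1, 2, 3, 4], [2, 1, 4, 3], [3, 4, 2, 1], [4, 3, 1, 2]], [1, 3, 2, 4]),
   ([3, 0, 4, 1, 2], [False, True, True, False, True],
    [73, 105, 38, 134, 150],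
    [[-2, 1, 1, 2, -2], [-2, -2, 0, 3, 1], [0, -1, 1, 0, 0], [1, -1, 0, 2, -2]], 3560857618,
    [[1, 2, 4, 3], [2, 1, 3, 4], [3, 4, 1, 2], [4, 3, 2, 1]], [2, 1, 4, 3]),
   ([3, 1, 2, 0, 4], [True, False, False, True, True],
    [76, 9, 104, 76, 35],
    [[0, 0, -2, 0, 2], [2, -1, 0, 0, -1], [0, 2, -2, 0, 0], [0, -1, 0, 2, -1]], 714817499,
    [[1, 2, 3, 4], [2, 3, 4, 1], [3, 4, 1, 2], [4, 1, 2, 3]], [1, 2, 4, 3]),
   ([1, 3, 2, 4, 0], [False, True, True, False, False],
    [76, 9, 104, 76, 35],
    [[0, -1, 0, 2, -1], [0, 2, -2, 0, 0], [2, -1, 0, 0, -1], [0, 0, -2, 0, 2]], 714817499,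
    [[1, 4, 3, 2], [2, 1, 4, 3], [3, 2, 1, 4], [4, 3, 2, 1]], [2, 4, 1, 3]),
   ([2, 4, 0, 5, 1, 3], [False, False, False, False, True, False],
    [106, 46, 38, 106, 166, 38],
    [[0, -2, 0, 0, 2, 0], [0, -1, 1, 0, -2, 2], [0, -1, 2, 0, -2, 1], [2, -4, 0, 2, 0, 0]], 2642414148,
    [[1, 2, 3, 4], [2, 4, 1, 3], [3, 1, 4, 2], [4, 3, 2, 1]], [4, 2, 3, 1]),
   ([1, 4, 2, 0, 3], [True, True, False, True, True],
    [205, 241, 158, 262, 134],
    [[2, -2, 3, -2, -1], [-1, 5, 0, -2, -2], [-2, -1, 3, -3, 3], [-1, 1, 3, 1, -4]], 29657284916,
    [[1, 2, 4, 3], [1, 3, 4, 2], [4, 2, 1, 3], [4, 3, 1, 2]], [2, 1, 4, 3]),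
   ([3, 0, 2, 4, 1], [False, False, True, False, False],
    [134, 262, 158, 241, 205],
    [[-4, 1, 3, 1, -1], [-2, -2, 0, 5, -1], [3, -3, 3, -1, -2], [-1, -2, 3, -2, 2]], 29657284916,
    [[2, 1, 3, 4], [2, 4, 3, 1], [3, 1, 2, 4], [3, 4, 2, 1]], [1, 3, 2, 4]),
   ([3, 0, 2, 4, 1], [True, True, False, True, True],
    [262, 205, 158, 134, 241],
    [[-2, 2, 3, -1, -2], [-2, -1, 0, -2, 5], [-3, -2, 3, 3, -1], [1, -1, 3, -4, 1]], 29657284916,
    [[1, 2, 4, 3], [1, 4, 2, 3], [3, 2, 4, 1], [3, 4, 2, 1]], [2, 1, 4, 3]),
   ([1, 4, 2, 0, 3], [False, False, True, False, False],
    [262, 205, 158, 134, 241],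
    [[1, -1, 3, -4, 1], [-3, -2, 3, 3, -1], [-2, -1, 0, -2, 5], [-2, 2, 3, -1, -2]], 29657284916,
    [[2, 1, 3, 4], [2, 3, 1, 4], [4, 1, 3, 2], [4, 3, 1, 2]], [1, 3, 2, 4]),
   ([2, 1, 0, 4, 3], [True, False, True, False, True],
    [137, 197, 126, 143, 97],
    [[4, -9, 3, 1, 1], [1, -2, 0, -3, 4], [6, -1, -1, -3, -1], [-1, -1, 6, -3, -1]], 16743655773,
    [[1, 2, 4, 3], [2, 1, 3, 4], [3, 4, 2, 1], [4, 3, 1, 2]], [1, 3, 2, 4]),
   ([2, 4, 0, 1, 3], [True, False, True, False, True],
    [151, 143, 112, 159, 135],
    [[3, 3, 2, -3, -5], [2, -4, 1, 0, 1], [0, 1, -4, 2, 1], [1, -1, 4, 0, -4]], 8091926614,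
    [[1, 2, 4, 3], [2, 3, 1, 4], [3, 4, 2, 1], [4, 1, 3, 2]], [1, 3, 4, 2]),
   ([2, 0, 4, 3, 1], [False, True, False, True, False],
    [151, 143, 112, 159, 135],
    [[1, -1, 4, 0, -4], [0, 1, -4, 2, 1], [2, -4, 1, 0, 1], [3, 3, 2, -3, -5]], 8091926614,
    [[1, 4, 2, 3], [2, 1, 3, 4], [3, 2, 4, 1], [4, 3, 1, 2]], [1, 3, 2, 4]),
   ([2, 3, 0, 4, 1], [True, False, True, True, False],
    [112, 159, 151, 135, 143],
    [[2, -3, 3, -5, 3], [4, 0, 1, -4, -1], [1, 0, 2, 1, -4], [-4, 2, 0, 1, 1]], 8091926614,
    [[1, 2, 4, 3], [2, 4, 3, 1], [3, 1, 2, 4], [4, 3, 1, 2]], [1, 4, 2, 3]),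
   ([1, 4, 0, 3, 2], [True, False, False, True, False],
    [143, 135, 151, 159, 112],
    [[-1, -4, 1, 0, 4], [1, 1, 0, 2, -4], [3, -5, 3, -3, 2], [-4, 1, 2, 0, 1]], 8091926614,
    [[1, 3, 4, 2], [2, 1, 3, 4], [3, 4, 2, 1], [4, 2, 1, 3]], [1, 3, 2, 4]),
   ([3, 0, 1, 4, 2], [True, True, False, True, False],
    [43, 177, 78, 86, 116],
    [[0, -2, 3, 0, -1], [-1, -1, 0, 3, -1], [1, 3, 0, 1, -5], [2, -7, 1, 0, 4]], 3720980853,
    [[1, 3, 2, 4], [1, 3, 4, 2], [3, 1, 2, 4], [3, 1, 4, 2]], [1, 4, 2, 3]),
   ([1, 4, 3, 0, 2], [False, False, True, False, True],
    [43, 177, 78, 86, 116],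
    [[2, -7, 1, 0, 4], [1, 3, 0, 1, -5], [-1, -1, 0, 3, -1], [0, -2, 3, 0, -1]], 3720980853,
    [[2, 4, 1, 3], [2, 4, 3, 1], [4, 2, 1, 3], [4, 2, 3, 1]], [1, 2, 4, 3]),
   ([1, 2, 4, 0, 3], [True, False, False, True, True],
    [177, 78, 116, 43, 86],
    [[-2, 3, -1, 0, 0], [-1, 0, -1, -1, 3], [3, 0, -5, 1, 1], [-7, 1, 4, 2, 0]], 3720980853,
    [[1, 3, 2, 4], [1, 4, 2, 3], [2, 3, 1, 4], [2, 4, 1, 3]], [1, 3, 4, 2]),
   ([3, 0, 4, 2, 1], [False, False, True, True, False],
    [86, 43, 116, 78, 177],
    [[0, 2, 4, 1, -7], [3, -1, -1, 0, -1], [1, 1, -5, 0, 3], [0, 0, -1, 3, -2]], 3720980853,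
    [[3, 1, 4, 2], [3, 2, 4, 1], [4, 1, 3, 2], [4, 2, 3, 1]], [1, 2, 4, 3]),
   ([4, 1, 2, 3, 0, 5], [True, False, False, False, False, True],
    [89, 24, 214, 94, 44, 35],
    [[-1, 4, -1, -1, -1, 0], [-1, -1, 1, 4, -1, -2], [4, 1, -1, 0, -2, -2], [-1, 2, -2, 0, 4, -3]], 5637463457,
    [[1, 3, 2, 4], [2, 1, 4, 3], [3, 4, 1, 2], [4, 2, 3, 1]], [1, 3, 4, 2]),
   ([1, 3, 4, 0, 2, 5], [True, False, True, True, False, False],
    [47, 139, 50, 128, 95, 41],
    [[1, 0, 1, -6, 2, 2], [3, 0, 0, -1, 0, -2], [0, 1, 3, -3, 0, -1], [-1, 0, 0, -1, 2, 0]], 3519160655,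
    [[1, 3, 2, 4], [2, 4, 1, 3], [3, 2, 4, 1], [4, 1, 3, 2]], [1, 4, 2, 3]),
   ([4, 2, 1, 5, 3, 0], [False, True, False, False, True, True],
    [47, 139, 50, 128, 95, 41],
    [[-1, 0, 0, -1, 2, 0], [0, 1, 3, -3, 0, -1], [3, 0, 0, -1, 0, -2], [1, 0, 1, -6, 2, 2]], 3519160655,
    [[1, 4, 2, 3], [2, 3, 1, 4], [3, 1, 4, 2], [4, 2, 3, 1]], [1, 3, 2, 4]),
   ([3, 0, 4, 1, 2, 5], [True, True, False, False, True, False],
    [128, 47, 95, 139, 50, 41],
    [[-6, 1, 2, 0, 1, 2], [-1, -1, 2, 0, 0, 0], [-1, 3, 0, 0, 0, -2], [-3, 0, 0, 1, 3, -1]], 3519160655,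
    [[1, 3, 2, 4], [2, 4, 3, 1], [3, 1, 4, 2], [4, 2, 1, 3]], [1, 3, 4, 2]),
   ([5, 2, 1, 4, 0, 3], [True, False, True, True, False, False],
    [41, 50, 139, 95, 47, 128],
    [[0, 0, 0, 2, -1, -1], [-2, 0, 0, 0, 3, -1], [-1, 3, 1, 0, 0, -3], [2, 1, 0, 2, 1, -6]], 3519160655,
    [[1, 3, 4, 2], [2, 4, 1, 3], [3, 1, 2, 4], [4, 2, 3, 1]], [1, 3, 2, 4]),
   ([0, 3, 4, 2, 1], [True, True, False, True, False],
    [75, 121, 222, 561, 21],
    [[2, 3, -2, -2, -1], [0, -2, 2, -2, 2], [-1, 0, -1, 0, 2], [-1, 2, 2, -2, -1]], 33220682523,
    [[1, 3, 4, 2], [1, 4, 3, 2], [2, 3, 4, 1], [2, 4, 3, 1]], [1, 3, 2, 4]),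
   ([4, 1, 0, 2, 3], [False, False, True, False, True],
    [75, 121, 222, 561, 21],
    [[-1, 2, 2, -2, -1], [-1, 0, -1, 0, 2], [0, -2, 2, -2, 2], [2, 3, -2, -2, -1]], 33220682523,
    [[3, 1, 2, 4], [3, 2, 1, 4], [4, 1, 2, 3], [4, 2, 1, 3]], [1, 3, 4, 2]),
   ([0, 4, 3, 1, 2], [True, False, True, True, False],
    [75, 21, 561, 121, 222],
    [[2, -1, -2, 3, -2], [0, 2, -2, -2, 2], [-1, 2, 0, 0, -1], [-1, -1, -2, 2, 2]], 33220682523,
    [[1, 4, 2, 3], [1, 4, 3, 2], [4, 1, 2, 3], [4, 1, 3, 2]], [1, 3, 2, 4]),
   ([2, 1, 3, 4, 0], [True, False, False, True, False],
    [222, 121, 561, 21, 75],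
    [[2, 2, -2, -1, -1], [2, -2, -2, 2, 0], [-1, 0, 0, 2, -1], [-2, 3, -2, -1, 2]], 33220682523,
    [[2, 3, 1, 4], [2, 3, 4, 1], [3, 2, 1, 4], [3, 2, 4, 1]], [1, 3, 4, 2]),
   ([3, 0, 2, 4, 1], [True, False, True, False, False],
    [78, 144, 56, 144, 78],
    [[-1, 0, 1, -1, 1], [2, -3, 0, -1, 2], [1, -1, 1, 0, -1], [2, -1, 0, -3, 2]], 1687383084,
    [[1, 3, 4, 2], [2, 4, 3, 1], [3, 1, 2, 4], [4, 2, 1, 3]], [1, 3, 2, 4]),
   ([1, 4, 2, 0, 3], [False, False, True, True, False],
    [144, 78, 56, 78, 144],
    [[0, 1, 1, -1, -1], [-1, -1, 1, 1, 0], [-1, 2, 0, 2, -3], [-3, 2, 0, 2, -1]], 1687383084,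
    [[1, 4, 2, 3], [2, 3, 1, 4], [3, 2, 4, 1], [4, 1, 3, 2]], [1, 3, 2, 4]),
   ([2, 0, 4, 3, 1], [False, True, True, False, True],
    [77, 136, 73, 152, 62],
    [[0, -1, 4, -3, 0], [1, -4, 0, 0, 3], [3, 0, 0, -1, -2], [0, 2, 0, -5, 3]], 4624526806,
    [[1, 3, 4, 2], [2, 4, 3, 1], [3, 2, 1, 4], [4, 1, 2, 3]], [1, 3, 2, 4]),
   ([2, 4, 0, 1, 3], [True, False, False, True, False],
    [77, 136, 73, 152, 62],
    [[0, 2, 0, -5, 3], [3, 0, 0, -1, -2], [1, -4, 0, 0, 3], [0, -1, 4, -3, 0]], 4624526806,
    [[1, 4, 3, 2], [2, 3, 4, 1], [3, 1, 2, 4], [4, 2, 1, 3]], [1, 3, 2, 4]),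
   ([1, 4, 0, 3, 2], [True, True, False, False, True],
    [136, 62, 77, 152, 73],
    [[-1, 0, 0, -3, 4], [2, 3, 0, -5, 0], [0, -2, 3, -1, 0], [-4, 3, 1, 0, 0]], 4624526806,
    [[1, 4, 2, 3], [2, 3, 4, 1], [3, 2, 1, 4], [4, 1, 3, 2]], [1, 3, 2, 4]),
   ([2, 3, 0, 4, 1], [False, True, True, False, False],
    [73, 152, 77, 62, 136],
    [[0, -5, 0, 3, 2], [0, 0, 1, 3, -4], [4, -3, 0, 0, -1], [0, -1, 3, -2, 0]], 4624526806,
    [[1, 4, 3, 2], [2, 3, 1, 4], [3, 2, 4, 1], [4, 1, 2, 3]], [1, 3, 2, 4]),
   ([0, 2, 3, 1, 4], [True, False, True, True, True],
    [47, 73, 59, 87, 34],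
    [[2, 2, -1, 0, -3], [-1, 1, 3, -1, -2], [-3, 2, -1, 0, 2], [-1, 0, -1, 3, -1]], 826318383,
    [[1, 4, 3, 2], [2, 3, 4, 1], [3, 2, 1, 4], [4, 1, 2, 3]], [2, 1, 4, 3]),
   ([3, 0, 5, 2, 1, 4], [True, True, False, False, True, True],
    [210, 172, 182, 147, 117, 172],
    [[1, 2, 1, -4, -2, 2], [3, -6, 3, 0, 1, -1], [-1, -1, 5, 3, 1, -7], [3, 0, -2, -2, 1, 0]], 30683383592,
    [[2, 1, 4, 3], [2, 4, 1, 3], [3, 1, 4, 2], [3, 4, 1, 2]], [1, 3, 4, 2])]"

text \<open>Two sets, each closed under reversal, complement and inversion, that are treated with 12
  and 13 blocks; the others use five or six.\<close>

definition large_certs :: "certificate list" where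
  "large_certs =
  [([7, 1, 3, 9, 8, 11, 6, 0, 2, 4, 10, 5], [False, False, False, True, True, False, True, False, False, False, True, False],
    [3099, 2550, 2468, 1875, 1659, 1768, 3129, 2200, 1854, 3095, 3196, 3107],
    [[10, -2, 2, 7, 1, -2, -21, 1, 1, 0, 5, -2],
     [7, -1, 3, 5, 1, -1, -17, 1, 1, 0, 2, -1],
     [8, -2, 1, 7, 2, -1, -20, 2, 2, 0, 3, -2],
     [12, -2, 2, 5, 0, -3, -20, 2, 0, 1, 4, -1]], 529452232773485,
    [[1, 2, 3, 4], [2, 1, 4, 3], [3, 4, 1, 2], [4, 3, 2, 1]], [4, 2, 3, 1]),
   ([7, 1, 2, 9, 4, 12, 6, 0, 8, 3, 10, 11, 5], [True, True, False, False, False, True, True, True, False, False, False, True, True],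
    [14456, 9019, 14046, 22697, 9304, 14812, 31705, 14863, 9988, 23162, 12953, 7718, 15277],
    [[18, -24, -19, -1, 13, -18, 2, 15, -8, -3, 22, 27, -24],
     [21, -29, -23, -3, 14, -14, -1, 24, -9, -5, 23, 28, -26],
     [27, -29, -23, -3, 14, -19, -1, 18, -9, -5, 23, 28, -21],
     [21, -28, -24, -1, 14, -18, 7, 18, -8, -3, 21, 26, -25]], 416133621668520896,
    [[1, 3, 2, 4], [2, 4, 1, 3], [3, 1, 4, 2], [4, 2, 3, 1]], [2, 4, 3, 1])]"

lemma small_certs_check: "certificates_check small_certs"
  by code_simp

lemma large_certs_check: "certificates_check large_certs"
  by code_simp

section \<open>Enumeration of the exceptional sets\<close>

definition perm_lists :: "nat list list" where
  "perm_lists = filter distinct (product_lists (replicate 4 [1, 2, 3, 4]))"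

lemma plist_in_perm_lists:
  assumes "\<sigma> \<in> point_perms 4"
  shows "plist \<sigma> \<in> set perm_lists"
proof -
  have p: "papply \<sigma> permutes {1..4}" using assms by (simp add: point_perms_def)
  have "distinct (plist \<sigma>)" by (simp add: plist_def inj_eq[OF permutes_inj[OF p]])
  moreover have m: "papply \<sigma> i \<in> set [1, 2, 3, 4]" if "i \<in> {1..4}" for i
    using permutes_in_image[OF p, of i] that by auto
  have "plist \<sigma> \<in> set (product_lists [[1, 2, 3, 4], [1, 2, 3, 4], [1, 2, 3, 4], [1, 2, 3, 4]])"
    unfolding product_lists_set mem_Collect_eq plist_def list.map list_all2_Cons list_all2_Nil
    by (intro conjI m TrueI) auto
  moreover have "replicate 4 xs = [xs, xs, xs, xs]" for xs :: "nat list" by (simp add: numeral_eq_Suc)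
  ultimately show ?thesis by (simp add: perm_lists_def del: product_lists.simps)
qed

fun mem_list :: "nat list \<Rightarrow> nat list list \<Rightarrow> bool" where
  "mem_list x [] \<longleftrightarrow> False"
| "mem_list x (y # ys) \<longleftrightarrow> x = y \<or> mem_list x ys"

fun contained :: "nat list list \<Rightarrow> nat list list \<Rightarrow> bool" where
  "contained [] ss \<longleftrightarrow> True"
| "contained (x # xs) ss \<longleftrightarrow> mem_list x ss \<and> contained xs ss"

fun pattern_sets :: "certificate list \<Rightarrow> nat list list list" where
  "pattern_sets [] = []"
| "pattern_sets ((t, f, C, B, L, ss, s') # cs) = ss # pattern_sets cs"

fun covered :: "nat list list \<Rightarrow> nat list list list \<Rightarrow> bool" where
  "covered q [] \<longleftrightarrow> False"
| "covered q (ss # sss) \<longleftrightarrow> contained q ss \<or> covered q sss"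

fun all_covered :: "nat list list list \<Rightarrow> nat list list list \<Rightarrow> bool" where
  "all_covered [] sss \<longleftrightarrow> True"
| "all_covered (q # qs) sss \<longleftrightarrow> covered q sss \<and> all_covered qs sss"

lemma contained_iff: "contained q ss \<longleftrightarrow> set q \<subseteq> set ss"
proof -
  have "mem_list x ss \<longleftrightarrow> x \<in> set ss" for x by (induction ss) auto
  then show ?thesis by (induction q) auto
qed

lemma all_covered_elem:
  assumes "all_covered qs sss" "q \<in> set qs"
  shows "\<exists>ss\<in>set sss. set q \<subseteq> set ss"
proof -
  have "covered q sss" using assms by (induction qs) auto
  then show ?thesis by (induction sss) (auto simp: contained_iff)
qed

lemma pattern_sets_elem:
  "ss \<in> set (pattern_sets cs) \<Longrightarrow> \<exists>t f C B L s'. (t, f, C, B, L, ss, s') \<in> set cs"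
proof -
  assume "ss \<in> set (pattern_sets cs)"
  then have "\<exists>c\<in>set cs. fst (snd (snd (snd (snd (snd c))))) = ss"
    by (induction cs rule: pattern_sets.induct) auto
  then obtain c where "c \<in> set cs" "fst (snd (snd (snd (snd (snd c))))) = ss" by blast
  moreover obtain t f C B L r s' where "c = (t, f, C, B, L, r, s')" by (metis prod.exhaust)
  ultimately have "(t, f, C, B, L, ss, s') \<in> set cs" by simp
  then show ?thesis by blast
qed

fun disjoint_lists :: "nat list \<Rightarrow> nat list \<Rightarrow> bool" where
  "disjoint_lists (x # xs) (y # ys) \<longleftrightarrow> x \<noteq> y \<and> disjoint_lists xs ys"
| "disjoint_lists _ _ \<longleftrightarrow> True"

fun filter_disjoint :: "nat list \<Rightarrow> nat list list \<Rightarrow> nat list list" where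
  "filter_disjoint x [] = []"
| "filter_disjoint x (y # ys) = (if disjoint_lists x y then y # filter_disjoint x ys else filter_disjoint x ys)"

text \<open>Row sets of Latin squares are the 4-cliques in the graph that joins permutations without
  a common value at any position. The search keeps only the later neighbours of the members chosen
  so far.\<close>

fun cliques :: "nat \<Rightarrow> nat list list \<Rightarrow> nat list list \<Rightarrow> nat list list list" where
  "cliques 0 q xs = [q]"
| "cliques (Suc n) q [] = []"
| "cliques (Suc n) q (x # xs) = cliques n (x # q) (filter_disjoint x xs) @ cliques (Suc n) q xs"

lemma cliques_complete:
  assumes "A \<subseteq> set xs" "card A = n"
    "\<And>x y. x \<in> A \<Longrightarrow> y \<in> A \<Longrightarrow> x \<noteq> y \<Longrightarrow> disjoint_lists x y"
  shows "\<exists>q'\<in>set (cliques n q xs). set q' = A \<union> set q"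
  using assms
proof (induction n q xs arbitrary: A rule: cliques.induct)
  case (1 q xs)
  then have "A = {}" using finite_subset[of A "set xs"] by auto
  then show ?case by simp
next
  case (3 n q x xs)
  show ?case
  proof (cases "x \<in> A")
    case True
    have fin: "finite A" using 3(3) finite_subset by blast
    have f: "set (filter_disjoint x ys) = {y \<in> set ys. disjoint_lists x y}" for ys
      by (induction ys) auto
    have "\<exists>q'\<in>set (cliques n (x # q) (filter_disjoint x xs)). set q' = (A - {x}) \<union> set (x # q)"
    proof (rule 3(1))
      show "A - {x} \<subseteq> set (filter_disjoint x xs)" using 3(3,5) True by (auto simp: f)
      show "card (A - {x}) = n" using 3(4) True fin by simp
    qed (use 3(5) in auto)
    moreover have "(A - {x}) \<union> set (x # q) = A \<union> set q" using True by auto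
    ultimately show ?thesis by auto
  next
    case False
    then have "A \<subseteq> set xs" using 3(3) by auto
    then show ?thesis using 3(2)[of A] 3(4,5) by auto
  qed
qed simp

fun between :: "nat list \<Rightarrow> nat list \<Rightarrow> nat list \<Rightarrow> bool" where
  "between (x # xs) (y # ys) (u # us) \<longleftrightarrow> (u = x \<or> u = y) \<and> between xs ys us"
| "between _ _ _ \<longleftrightarrow> True"

text \<open>If every entry of \<open>u\<close> comes from \<open>x\<close> or \<open>y\<close>, the
  subtraction of naturals is exact and leaves the entry not chosen.\<close>

fun opposite :: "nat list \<Rightarrow> nat list \<Rightarrow> nat list \<Rightarrow> nat list" where
  "opposite (x # xs) (y # ys) (u # us) = (x + y - u) # opposite xs ys us"
| "opposite _ _ _ = []"

fun relations1 :: "nat list \<Rightarrow> nat list \<Rightarrow> nat list list \<Rightarrow> nat list list list" where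
  "relations1 x y [] = []"
| "relations1 x y (u # us) =
     (if between x y u then [x, y, u, opposite x y u] # relations1 x y us else relations1 x y us)"

fun relations2 :: "nat list \<Rightarrow> nat list list \<Rightarrow> nat list list \<Rightarrow> nat list list list" where
  "relations2 x [] us = []"
| "relations2 x (y # ys) us = relations1 x y us @ relations2 x ys us"

fun relations :: "nat list list \<Rightarrow> nat list list \<Rightarrow> nat list list list" where
  "relations [] us = []"
| "relations (x # xs) us = relations2 x xs us @ relations xs us"

text \<open>The choices \<open>u = x\<close> and \<open>u = y\<close> solve the relation trivially
  and are discarded by the distinctness test.\<close>

fun proper_quads :: "nat list list list \<Rightarrow> nat list list list" where
  "proper_quads [] = []"
| "proper_quads (q # qs) = (if distinct q then q # proper_quads qs else proper_quads qs)"

text \<open>Each pair \<open>x\<close>, \<open>y\<close> is enumerated only in its order in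
  \<open>xs\<close>, which is unknown; the hypotheses therefore come in both orders, and only the
  resulting set is claimed.\<close>

lemma relations_complete:
  assumes "x \<in> set xs" "y \<in> set xs" "u \<in> set us" "distinct [x, y, u, v]"
    and "between x y u" "between y x u" "opposite x y u = v" "opposite y x u = v"
  shows "\<exists>q\<in>set (proper_quads (relations xs us)). set q = {x, y, u, v}"
proof -
  have p: "set (proper_quads qs) = {q \<in> set qs. distinct q}" for qs by (induction qs) auto
  have c1: "[x, y, u, v] \<in> set (relations1 x y us)" if "between x y u" "opposite x y u = v" for x y
    using that \<open>u \<in> set us\<close> by (induction us) auto
  have c2: "q \<in> set (relations2 x ys us)" if "q \<in> set (relations1 x y us)" "y \<in> set ys" for x y ys q
    using that by (induction ys) auto
  have "x \<noteq> y" using assms(4) by simp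
  with assms(1,2) have "[x, y, u, v] \<in> set (relations xs us) \<or> [y, x, u, v] \<in> set (relations xs us)"
  proof (induction xs)
    case (Cons a xs)
    then show ?case using c2[OF c1, of x y xs] c2[OF c1, of y x xs] assms(5-8) by auto
  qed simp
  moreover have "distinct [y, x, u, v]" using assms(4) by auto
  ultimately have "[x, y, u, v] \<in> set (proper_quads (relations xs us)) \<or> [y, x, u, v] \<in> set (proper_quads (relations xs us))"
    using assms(4) by (simp only: p mem_Collect_eq) blast
  then show ?thesis by (auto intro: bexI[rotated])
qed

text \<open>There are 24 such sets: the 576 Latin squares of order four, up to the order of the
  rows.\<close>

lemma latin_sets_covered:
  "all_covered (cliques 4 [] perm_lists) (pattern_sets small_certs @ pattern_sets large_certs)"
  by code_simp

text \<open>A nontrivial \<open>P\<^sub>x + P\<^sub>y = P\<^sub>u + P\<^sub>v\<close> requires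
  \<open>x\<close> and \<open>y\<close> to differ by a permutation with two nontrivial cycles, hence
  by a double transposition. Then \<open>{x, y}\<close> determines \<open>{u, v}\<close>, so the 36
  such pairs give 18 sets.\<close>

lemma relation_sets_covered:
  "all_covered (proper_quads (relations perm_lists perm_lists)) (pattern_sets small_certs @ pattern_sets large_certs)"
  by code_simp

fun extra_patterns :: "certificate list \<Rightarrow> nat list list" where
  "extra_patterns [] = []"
| "extra_patterns ((t, f, C, B, L, ss, s') # cs) = s' # extra_patterns cs"

text \<open>The fifth pattern must be a genuine permutation: a list that is no permutation could
  satisfy the density inequality without contradicting quasirandomness.\<close>

lemma extra_patterns_perms:
  "contained (extra_patterns small_certs) perm_lists"
  "contained (extra_patterns large_certs) perm_lists"
  by code_simp+

lemma perm_lists_surj: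
  assumes "xs \<in> set perm_lists"
  shows "\<exists>\<sigma>\<in>point_perms 4. plist \<sigma> = xs"
proof -
  have "\<exists>a b c d. xs = [a, b, c, d] \<and> {a, b, c, d} \<subseteq> {1, 2, 3, 4} \<and> distinct xs"
    using assms unfolding perm_lists_def set_filter product_lists_set mem_Collect_eq
    by (auto simp: numeral_eq_Suc list_all2_Cons2)
  then obtain a b c d where xs: "xs = [a, b, c, d]" and sub: "{a, b, c, d} \<subseteq> {1, 2, 3, 4}"
    and dis: "distinct [a, b, c, d]" by blast
  define p where "p i = (if i = 1 then a else if i = 2 then b else if i = 3 then c else if i = 4 then d else i)" for i :: nat
  have e: "{1..4} = {1, 2, 3, 4::nat}" by auto
  have "p permutes {1..4}"
  proof (rule bij_imp_permutes)
    have "inj_on p {1..4}" unfolding e using dis by (auto simp: inj_on_def p_def)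
    moreover have "p ` {1..4} \<subseteq> {1..4}" unfolding e using sub by (auto simp: p_def)
    ultimately show "bij_betw p {1..4} {1..4}" by (simp add: bij_betw_def endo_inj_surj)
  qed (auto simp: p_def)
  then have "(4, p) \<in> point_perms 4" by (simp add: point_perms_def)
  moreover have "plist (4, p) = xs" by (simp add: plist_def p_def xs)
  ultimately show ?thesis by blast
qed

lemma certificates_check_elem: "certificates_check cs \<Longrightarrow> c \<in> set cs \<Longrightarrow> certificate_check c"
  by (induction cs) auto

lemma extra_patterns_elem: "(t, f, C, B, L, ss, s') \<in> set cs \<Longrightarrow> s' \<in> set (extra_patterns cs)"
  by (induction cs rule: extra_patterns.induct) auto

lemma covered_not_forcing:
  assumes S: "S \<subseteq> point_perms 4" "plist ` S \<subseteq> set ss"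
    and ss: "ss \<in> set (pattern_sets small_certs @ pattern_sets large_certs)"
  shows "\<not> quasirandom_forcing S"
proof -
  have "\<exists>cs\<in>{small_certs, large_certs}. ss \<in> set (pattern_sets cs)" using ss by auto
  then obtain cs where cs: "certificates_check cs" "contained (extra_patterns cs) perm_lists" "ss \<in> set (pattern_sets cs)"
    using small_certs_check large_certs_check extra_patterns_perms by blast
  obtain t f C B L s' where c: "(t, f, C, B, L, ss, s') \<in> set cs" using pattern_sets_elem[OF cs(3)] by blast
  have "s' \<in> set perm_lists" using extra_patterns_elem[OF c] cs(2) by (auto simp: contained_iff)
  then obtain \<sigma> where "\<sigma> \<in> point_perms 4" "plist \<sigma> = s'" using perm_lists_surj by blast
  then show ?thesis
    by (rule certified_not_forcing[OF certificate_check_certified[OF certificates_check_elem[OF cs(1) c]] S])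
qed

section \<open>From exceptional sets of permutations to the enumerated lists\<close>

lemma pos_eq_iff:
  assumes "\<sigma> \<in> point_perms 4" "\<tau> \<in> point_perms 4" "i < 4"
  shows "pos \<sigma> i = pos \<tau> i \<longleftrightarrow> papply \<sigma> (Suc i) = papply \<tau> (Suc i)"
proof -
  have "papply \<rho> (Suc i) \<in> {1..4}" if "\<rho> \<in> point_perms 4" for \<rho>
    using that assms(3) permutes_in_image[of "papply \<rho>" "{1..4}" "Suc i"] by (simp add: point_perms_def)
  from this[OF assms(1)] this[OF assms(2)] show ?thesis by (auto simp: pos_def)
qed

lemma inj_plist: "inj_on plist (point_perms 4)"
proof (rule inj_onI)
  fix \<sigma> \<tau> assume a: "\<sigma> \<in> point_perms 4" "\<tau> \<in> point_perms 4" "plist \<sigma> = plist \<tau>"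
  show "\<sigma> = \<tau>"
  proof (rule pos_inj[OF a(1,2)])
    fix i :: nat assume "i < 4"
    then have "i \<in> {0, 1, 2, 3}" by auto
    then show "pos \<sigma> i = pos \<tau> i" using a(3) by (elim insertE) (simp_all add: plist_def pos_def numeral_eq_Suc)
  qed
qed

lemma latin_not_forcing:
  assumes S: "S \<subseteq> point_perms 4" "card S = 4"
    and dis: "\<And>\<sigma> \<tau> i. \<sigma> \<in> S \<Longrightarrow> \<tau> \<in> S \<Longrightarrow> \<sigma> \<noteq> \<tau> \<Longrightarrow> i < 4 \<Longrightarrow> pos \<sigma> i \<noteq> pos \<tau> i"
  shows "\<not> quasirandom_forcing S"
proof -
  have "card (plist ` S) = 4" using card_image[OF inj_on_subset[OF inj_plist S(1)]] S(2) by simp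
  moreover have "disjoint_lists (plist \<sigma>) (plist \<tau>)" if "\<sigma> \<in> S" "\<tau> \<in> S" "\<sigma> \<noteq> \<tau>" for \<sigma> \<tau>
  proof -
    have "papply \<sigma> (Suc i) \<noteq> papply \<tau> (Suc i)" if "i < 4" for i
      using dis[OF \<open>\<sigma> \<in> S\<close> \<open>\<tau> \<in> S\<close> \<open>\<sigma> \<noteq> \<tau>\<close> that] by (auto simp: pos_def)
    from this[of 0] this[of 1] this[of 2] this[of 3] show ?thesis by (simp add: plist_def numeral_eq_Suc)
  qed
  moreover have "plist ` S \<subseteq> set perm_lists" using S(1) plist_in_perm_lists by blast
  ultimately obtain q where "q \<in> set (cliques 4 [] perm_lists)" "set q = plist ` S \<union> set []"
    using cliques_complete[of "plist ` S" perm_lists 4 "[]"] by blast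
  then obtain ss where "ss \<in> set (pattern_sets small_certs @ pattern_sets large_certs)" "plist ` S \<subseteq> set ss"
    using all_covered_elem[OF latin_sets_covered] by (metis Un_empty_right list.set(1))
  then show ?thesis using covered_not_forcing[OF S(1)] by blast
qed

lemma paired_not_forcing:
  assumes S: "{x, y, u, v} \<subseteq> point_perms 4" "distinct [x, y, u, v]"
    and pr: "\<And>i. i < 4 \<Longrightarrow> pos x i = pos u i \<and> pos y i = pos v i \<or> pos x i = pos v i \<and> pos y i = pos u i"
  shows "\<not> quasirandom_forcing {x, y, u, v}"
proof -
  have p: "papply x (Suc i) = papply u (Suc i) \<and> papply y (Suc i) = papply v (Suc i) \<or>
      papply x (Suc i) = papply v (Suc i) \<and> papply y (Suc i) = papply u (Suc i)" if "i < 4" for i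
    using pr[OF that] S(1) that by (simp add: pos_eq_iff)
  have "\<exists>q\<in>set (proper_quads (relations perm_lists perm_lists)). set q = {plist x, plist y, plist u, plist v}"
  proof (rule relations_complete)
    show "plist x \<in> set perm_lists" "plist y \<in> set perm_lists" "plist u \<in> set perm_lists"
      using S(1) plist_in_perm_lists by auto
    have "distinct (map plist [x, y, u, v])"
      using S inj_on_subset[OF inj_plist S(1)] by (subst distinct_map) auto
    then show "distinct [plist x, plist y, plist u, plist v]" by simp
    show "between (plist x) (plist y) (plist u)" "between (plist y) (plist x) (plist u)"
      using p[of 0] p[of 1] p[of 2] p[of 3] by (auto simp: plist_def numeral_eq_Suc)
    show "opposite (plist x) (plist y) (plist u) = plist v" "opposite (plist y) (plist x) (plist u) = plist v"
      using p[of 0] p[of 1] p[of 2] p[of 3] by (auto simp: plist_def numeral_eq_Suc)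
  qed
  then obtain ss where "ss \<in> set (pattern_sets small_certs @ pattern_sets large_certs)"
    "plist ` {x, y, u, v} \<subseteq> set ss"
    using all_covered_elem[OF relation_sets_covered] by (metis image_empty image_insert)
  then show ?thesis using covered_not_forcing[OF S(1)] by blast
qed

lemma card_point_perms: "finite (point_perms 4)" "card (point_perms 4) = 24"
proof -
  have e: "point_perms 4 = Pair 4 ` {p. p permutes {1..4}}" by (auto simp: point_perms_def)
  show "finite (point_perms 4)" unfolding e by (simp add: finite_permutations)
  have "card (point_perms 4) = card {p. p permutes {1..4::nat}}"
    unfolding e by (rule card_image) (simp add: inj_on_def)
  also have "\<dots> = 24" using card_permutations[of "{1..4::nat}" 4] by (simp add: fact_numeral)
  finally show "card (point_perms 4) = 24" .
qed

theorem theorem1: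
  fixes S :: "sized_perm set"
  assumes "S \<subseteq> point_perms 4"
    and "quasirandom_forcing S"
  shows "5 \<le> card S"
proof (rule ccontr)
  assume "\<not> 5 \<le> card S"
  then obtain T where T: "S \<subseteq> T" "T \<subseteq> point_perms 4" "card T = 4"
    using exists_subset_between[of S 4 "point_perms 4"] assms(1) card_point_perms by auto
  have forcing: "quasirandom_forcing T"
    using assms(2) T(1) unfolding quasirandom_forcing_def by blast
  show False
  proof (cases "independent (insert 1 (perm_vec ` T))")
    case True
    then show False using not_forcing_if_independent[OF T(2,3)] forcing by blast
  next
    case False
    have fin: "finite T" using T(2) card_point_perms(1) finite_subset by blast
    have dep: "dependent (insert 1 (perm_vec ` T))" using False by simp
    obtain c and d :: real where cd: "(d \<noteq> 0 \<or> (\<exists>\<sigma>\<in>T. c \<sigma> \<noteq> 0)) \<and>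
        (\<forall>i<4. \<forall>j<4. (\<Sum>\<sigma>\<in>T. if pos \<sigma> i = j then c \<sigma> else 0) = d)"
      using relation_if_dependent[OF T(2) fin dep] by (elim exE) (rule that)
    have "(\<forall>\<sigma>\<in>T. \<forall>\<tau>\<in>T. \<sigma> \<noteq> \<tau> \<longrightarrow> (\<forall>i<4. pos \<sigma> i \<noteq> pos \<tau> i)) \<or>
      (\<exists>x y u v. T = {x, y, u, v} \<and> distinct [x, y, u, v] \<and>
        (\<forall>i<4. pos x i = pos u i \<and> pos y i = pos v i \<or> pos x i = pos v i \<and> pos y i = pos u i))"
      by (rule relation_cases[OF T(2,3) cd[THEN conjunct1]]) (rule cd[THEN conjunct2, rule_format])
    then show False
    proof (elim disjE exE conjE)
      assume "\<forall>\<sigma>\<in>T. \<forall>\<tau>\<in>T. \<sigma> \<noteq> \<tau> \<longrightarrow> (\<forall>i<4. pos \<sigma> i \<noteq> pos \<tau> i)"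
      then show False using latin_not_forcing[OF T(2,3)] forcing by blast
    next
      fix x y u v
      assume a: "T = {x, y, u, v}" "distinct [x, y, u, v]"
        "\<forall>i<4. pos x i = pos u i \<and> pos y i = pos v i \<or> pos x i = pos v i \<and> pos y i = pos u i"
      show False
        using paired_not_forcing[OF T(2)[unfolded a(1)] a(2) a(3)[rule_format]] forcing unfolding a(1) by blast
    qed
  qed
qed

end
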